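(* Let $M$ be a closed manifold with $\dim M\ge 2$, equipped with a Riemannian metric with norm $\|\cdot\|$ on tangent vectors, and let $f\colon M\to M$ be a $C^1$-diffeomorphism. Suppose the tangent bundle has a $Tf$-invariant splitting $T_xM=E^s(x)\oplus E^{cu}(x)$ for all $x\in M$ such that $x\mapsto E^{cu}(x)$ is a.e. continuous and $x\mapsto E^s(x)$ is measurable. Assume that for a.e. $x\in M$ (that is, for $\mu$-a.e. $x$, for every $f$-invariant Borel probability measure $\mu$ on $M$), $$\limsup_{n\to\infty}\|T_xf^n(v)\|<1\qquad\text{for all } v\in E^s(x) \text{ with } \|v\|=1,$$ and $$\liminf_{n\to\infty}\|T_xf^n(v)\|>1\qquad\text{for all } v\in E^{cu}(x)\text{ with } \|v\|=1.$$ Then $f$ is quasi-Anosov. Moreover, there exist two constants $K>0$ and $\varrho>1$ such that to every $x\in M$ there corresponds some $\ell(x)>0$ for which, for all integers $m\ge 0$, $$\|T_xf^{n+m}(v)\|\ge K\varrho^m\|T_xf^n(v)\|\qquad\text{for all } v\in E^{cu}(x)\text{ and all integers } n\ge\ell(x),$$ and $$\|T_xf^{n-m}(v)\|\ge K\varrho^{m}\|T_xf^n(v)\|\qquad\text{for all } v\in E^{s}(x)\text{ and all integers } n\le-\ell(x).$$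
   Context: A closed manifold is a smooth, compact, boundaryless manifold. For $n\in\mathbb{Z}$, $T_xf^n\colon T_xM\to T_{f^n(x)}M$ is the derivative of $f^n$ at $x$. The splitting is $Tf$-invariant if $T_xf(E^s(x))=E^s(f(x))$ and $T_xf(E^{cu}(x))=E^{cu}(f(x))$ for all $x\in M$. $\mathcal{M}_f$ denotes the set of all $f$-invariant Borel probability measures on $M$. A property holds for "a.e." $x$ if for every $\mu\in\mathcal{M}_f$ it holds for $\mu$-a.e. $x$. The map $x\mapsto E^{cu}(x)$ (viewed as a map into the Grassmannian bundle of linear subspaces of the tangent spaces) is "a.e. continuous" if its set of discontinuity points has $\mu$-measure $0$ for every $\mu\in\mathcal{M}_f$. $f$ is quasi-Anosov if for every $x\in M$ and every unit tangent vector $v\in T_xM$, the bi-infinite sequence $\{\|T_xf^n(v)\|\}_{-\infty<n<+\infty}$ is unbounded. *)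

theory Defs
  imports "HOL-Probability.Probability" "HOL-Library.Function_Algebras"
begin

text \<open>
  The manifold is the whole type \<open>'m\<close>; its smooth structure is given by a (not necessarily
  maximal) smooth atlas modelled on the Euclidean space \<open>'e\<close>, so \<open>DIM('e)\<close> is its dimension.
  A tangent vector at \<open>x\<close> is a rule assigning to each chart at \<open>x\<close> its coordinate
  vector, transforming under a change of charts by the Jacobian of the transition map.
\<close>

instantiation "fun" :: (type, real_vector) real_vector
begin

definition scaleR_fun :: "real \<Rightarrow> ('a \<Rightarrow> 'b) \<Rightarrow> 'a \<Rightarrow> 'b"
  where "scaleR_fun r v = (\<lambda>i. r *\<^sub>R v i)"

instance
  by standard (simp_all add: scaleR_fun_def fun_eq_iff scaleR_add_right scaleR_add_left)

end


subsection \<open>Differentiability classes in Euclidean spaces\<close>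

text \<open>Meant for open \<open>S\<close>: all iterated directional derivatives up to order \<open>k\<close> exist
  in the Frechet sense and are continuous.\<close>

primrec Ck_on :: "nat \<Rightarrow> ('a::euclidean_space \<Rightarrow> 'b::euclidean_space) \<Rightarrow> 'a set \<Rightarrow> bool" where
  "Ck_on 0 f S \<longleftrightarrow> continuous_on S f"
| "Ck_on (Suc k) f S \<longleftrightarrow>
     (\<forall>x\<in>S. f differentiable (at x)) \<and>
     (\<forall>v. Ck_on k (\<lambda>x. frechet_derivative f (at x) v) S)"

definition smooth_on :: "('a::euclidean_space \<Rightarrow> 'b::euclidean_space) \<Rightarrow> 'a set \<Rightarrow> bool"
  where "smooth_on f S \<longleftrightarrow> (\<forall>k. Ck_on k f S)"


subsection \<open>Closed manifolds\<close>

type_synonym ('m, 'e) chart = "'m set \<times> ('m \<Rightarrow> 'e)"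

abbreviation cdom :: "('m, 'e) chart \<Rightarrow> 'm set" where "cdom c \<equiv> fst c"
abbreviation cmap :: "('m, 'e) chart \<Rightarrow> 'm \<Rightarrow> 'e" where "cmap c \<equiv> snd c"

definition cinv :: "('m, 'e) chart \<Rightarrow> 'e \<Rightarrow> 'm"
  where "cinv c = inv_into (cdom c) (cmap c)"

definition smooth_atlas ::
    "('m::{t2_space, second_countable_topology}, 'e::euclidean_space) chart set \<Rightarrow> bool" where
  "smooth_atlas A \<longleftrightarrow>
     (\<Union>c\<in>A. cdom c) = UNIV \<and>
     (\<forall>c\<in>A. open (cdom c) \<and> open (cmap c ` cdom c) \<and>
            homeomorphism (cdom c) (cmap c ` cdom c) (cmap c) (cinv c)) \<and>
     (\<forall>c\<in>A. \<forall>d\<in>A. smooth_on (cmap d \<circ> cinv c) (cmap c ` (cdom c \<inter> cdom d)))"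

definition closed_manifold ::
    "('m::{t2_space, second_countable_topology}, 'e::euclidean_space) chart set \<Rightarrow> bool"
  where "closed_manifold A \<longleftrightarrow> smooth_atlas A \<and> compact (UNIV :: 'm set)"


subsection \<open>Tangent spaces and derivatives\<close>

type_synonym ('m, 'e) tvec = "('m, 'e) chart \<Rightarrow> 'e"

definition local_deriv ::
    "('m, 'e::euclidean_space) chart \<Rightarrow> ('m, 'e) chart \<Rightarrow> ('m \<Rightarrow> 'm) \<Rightarrow> 'm \<Rightarrow> 'e \<Rightarrow> 'e"
  where "local_deriv c d f x = frechet_derivative (cmap d \<circ> f \<circ> cinv c) (at (cmap c x))"

text \<open>Outside the charts at \<open>x\<close> a tangent vector is set to zero, so that it is
  determined by its coordinates.\<close>

definition tangent_space ::
    "('m, 'e::euclidean_space) chart set \<Rightarrow> 'm \<Rightarrow> ('m, 'e) tvec set" where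
  "tangent_space A x =
     {v. (\<forall>c\<in>A. \<forall>d\<in>A. x \<in> cdom c \<and> x \<in> cdom d \<longrightarrow> v d = local_deriv c d id x (v c)) \<and>
         (\<forall>c. \<not> (c \<in> A \<and> x \<in> cdom c) \<longrightarrow> v c = 0)}"

text \<open>The tangent vector at \<open>x\<close> with coordinates \<open>a\<close> in the chart \<open>c\<close>.\<close>

definition coord_vec ::
    "('m, 'e::euclidean_space) chart set \<Rightarrow> ('m, 'e) chart \<Rightarrow> 'm \<Rightarrow> 'e \<Rightarrow> ('m, 'e) tvec" where
  "coord_vec A c x a =
     (\<lambda>d. if d \<in> A \<and> x \<in> cdom d then local_deriv c d id x a else 0)"

definition chart_at :: "('m, 'e) chart set \<Rightarrow> 'm \<Rightarrow> ('m, 'e) chart"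
  where "chart_at A x = (SOME c. c \<in> A \<and> x \<in> cdom c)"

text \<open>The choice of the chart at \<open>x\<close> is immaterial, see \<open>tangent_map_in_chart\<close> below.\<close>

definition tangent_map ::
    "('m, 'e::euclidean_space) chart set \<Rightarrow> ('m \<Rightarrow> 'm) \<Rightarrow> 'm \<Rightarrow> ('m, 'e) tvec \<Rightarrow> ('m, 'e) tvec" where
  "tangent_map A f x v =
     (\<lambda>d. if d \<in> A \<and> f x \<in> cdom d
          then local_deriv (chart_at A x) d f x (v (chart_at A x)) else 0)"

definition C1_map ::
    "('m::topological_space, 'e::euclidean_space) chart set \<Rightarrow> ('m \<Rightarrow> 'm) \<Rightarrow> bool" where
  "C1_map A f \<longleftrightarrow>
     continuous_on UNIV f \<and>
     (\<forall>c\<in>A. \<forall>d\<in>A. Ck_on 1 (cmap d \<circ> f \<circ> cinv c) (cmap c ` (cdom c \<inter> f -` cdom d)))"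

definition C1_diffeo ::
    "('m::topological_space, 'e::euclidean_space) chart set \<Rightarrow> ('m \<Rightarrow> 'm) \<Rightarrow> bool"
  where "C1_diffeo A f \<longleftrightarrow> bij f \<and> C1_map A f \<and> C1_map A (inv f)"

definition int_iter :: "('m \<Rightarrow> 'm) \<Rightarrow> int \<Rightarrow> 'm \<Rightarrow> 'm"
  where "int_iter f n = (if 0 \<le> n then f ^^ nat n else inv f ^^ nat (- n))"

text \<open>\<open>T\<^sub>x f\<^sup>n\<close>: the derivative of the \<open>n\<close>-th iterate, for any integer \<open>n\<close>.\<close>

definition tangent_iter ::
    "('m, 'e::euclidean_space) chart set \<Rightarrow> ('m \<Rightarrow> 'm) \<Rightarrow> 'm \<Rightarrow> int \<Rightarrow> ('m, 'e) tvec \<Rightarrow> ('m, 'e) tvec"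
  where "tangent_iter A f x n = tangent_map A (int_iter f n) x"


subsection \<open>Riemannian metrics\<close>

definition riemannian_metric ::
    "('m, 'e::euclidean_space) chart set \<Rightarrow>
     ('m \<Rightarrow> ('m, 'e) tvec \<Rightarrow> ('m, 'e) tvec \<Rightarrow> real) \<Rightarrow> bool" where
  "riemannian_metric A g \<longleftrightarrow>
     (\<forall>x. \<forall>u\<in>tangent_space A x. \<forall>v\<in>tangent_space A x. \<forall>w\<in>tangent_space A x. \<forall>a b.
        g x (a *\<^sub>R u + b *\<^sub>R v) w = a * g x u w + b * g x v w) \<and>
     (\<forall>x. \<forall>u\<in>tangent_space A x. \<forall>v\<in>tangent_space A x. g x u v = g x v u) \<and>
     (\<forall>x. \<forall>v\<in>tangent_space A x. v \<noteq> 0 \<longrightarrow> 0 < g x v v) \<and>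
     (\<forall>c\<in>A. \<forall>a b.
        smooth_on (\<lambda>y. g (cinv c y) (coord_vec A c (cinv c y) a) (coord_vec A c (cinv c y) b))
          (cmap c ` cdom c))"

definition rnorm :: "('m \<Rightarrow> 'v \<Rightarrow> 'v \<Rightarrow> real) \<Rightarrow> 'm \<Rightarrow> 'v \<Rightarrow> real"
  where "rnorm g x v = sqrt (g x v v)"

text \<open>\<open>\<parallel>T\<^sub>x f\<^sup>n v\<parallel>\<close>, measured in the tangent space at \<open>f\<^sup>n(x)\<close>.\<close>

definition norm_iter ::
    "('m, 'e::euclidean_space) chart set \<Rightarrow> ('m \<Rightarrow> ('m, 'e) tvec \<Rightarrow> ('m, 'e) tvec \<Rightarrow> real) \<Rightarrow>
     ('m \<Rightarrow> 'm) \<Rightarrow> 'm \<Rightarrow> int \<Rightarrow> ('m, 'e) tvec \<Rightarrow> real"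
  where "norm_iter A g f x n v = rnorm g (int_iter f n x) (tangent_iter A f x n v)"


subsection \<open>Fields of subspaces of the tangent bundle\<close>

definition subspace_field ::
    "('m, 'e::euclidean_space) chart set \<Rightarrow> ('m \<Rightarrow> ('m, 'e) tvec set) \<Rightarrow> bool"
  where "subspace_field A E \<longleftrightarrow> (\<forall>x. subspace (E x) \<and> E x \<subseteq> tangent_space A x)"

definition invariant_splitting ::
    "('m, 'e::euclidean_space) chart set \<Rightarrow> ('m \<Rightarrow> 'm) \<Rightarrow>
     ('m \<Rightarrow> ('m, 'e) tvec set) \<Rightarrow> ('m \<Rightarrow> ('m, 'e) tvec set) \<Rightarrow> bool" where
  "invariant_splitting A f E F \<longleftrightarrow>
     subspace_field A E \<and> subspace_field A F \<and>
     (\<forall>x. E x \<inter> F x = {0} \<and> tangent_space A x = {u + v | u v. u \<in> E x \<and> v \<in> F x}) \<and>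
     (\<forall>x. tangent_map A f x ` E x = E (f x) \<and> tangent_map A f x ` F x = F (f x))"

text \<open>The Grassmannian of all linear subspaces of \<open>'e\<close> is topologised as a subset of the
  space of endomorphisms, by identifying a subspace with the orthogonal projection onto it.
  The Grassmannian bundle is given the topology for which every chart \<open>c\<close>
  induces a trivialisation over \<open>cdom c\<close>; hence a section is continuous at a point (is Borel
  measurable) iff its expression in each chart is.\<close>

definition orth_proj :: "'e::euclidean_space set \<Rightarrow> 'e \<Rightarrow>\<^sub>L 'e"
  where "orth_proj V = Blinfun (closest_point V)"

definition field_in_chart ::
    "('m, 'e::euclidean_space) chart \<Rightarrow> ('m \<Rightarrow> ('m, 'e) tvec set) \<Rightarrow> 'm \<Rightarrow> 'e \<Rightarrow>\<^sub>L 'e"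
  where "field_in_chart c E x = orth_proj ((\<lambda>v. v c) ` E x)"

definition field_continuous_at ::
    "('m::t2_space, 'e::euclidean_space) chart set \<Rightarrow> ('m \<Rightarrow> ('m, 'e) tvec set) \<Rightarrow> 'm \<Rightarrow> bool"
  where "field_continuous_at A E x \<longleftrightarrow>
    (\<forall>c\<in>A. x \<in> cdom c \<longrightarrow> isCont (field_in_chart c E) x)"

definition field_measurable ::
    "('m::topological_space, 'e::euclidean_space) chart set \<Rightarrow> ('m \<Rightarrow> ('m, 'e) tvec set) \<Rightarrow> bool"
  where "field_measurable A E \<longleftrightarrow>
    (\<forall>c\<in>A. field_in_chart c E \<in> borel_measurable (restrict_space borel (cdom c)))"


subsection \<open>Invariant measures and quasi-Anosov diffeomorphisms\<close>

definition invariant_measures :: "('m::topological_space \<Rightarrow> 'm) \<Rightarrow> 'm measure set"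
  where "invariant_measures f = {\<mu>. sets \<mu> = sets borel \<and> prob_space \<mu> \<and> distr \<mu> borel f = \<mu>}"

definition quasi_Anosov ::
    "('m, 'e::euclidean_space) chart set \<Rightarrow> ('m \<Rightarrow> ('m, 'e) tvec \<Rightarrow> ('m, 'e) tvec \<Rightarrow> real) \<Rightarrow>
     ('m \<Rightarrow> 'm) \<Rightarrow> bool" where
  "quasi_Anosov A g f \<longleftrightarrow>
     (\<forall>x. \<forall>v\<in>tangent_space A x. rnorm g x v = 1 \<longrightarrow>
        \<not> bounded (range (\<lambda>n::int. norm_iter A g f x n v)))"


subsection \<open>Basic facts\<close>

lemma blinfun_apply_orth_proj:
  fixes V :: "'e::euclidean_space set"
  assumes V: "subspace V"
  shows "blinfun_apply (orth_proj V) = closest_point V"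
    and "closest_point V u \<in> V"
    and "w \<in> V \<Longrightarrow> orthogonal (u - closest_point V u) w"
proof -
  let ?P = "closest_point V"
  have cl: "closed V" "V \<noteq> {}" "convex V"
    using V closed_subspace subspace_0 subspace_imp_convex by auto
  have inV: "?P u \<in> V" for u
    using cl closest_point_in_set by blast
  have orth: "(u - ?P u) \<bullet> w = 0" if "w \<in> V" for u w
  proof -
    have "(u - ?P u) \<bullet> ((?P u + w) - ?P u) \<le> 0"
      using closest_point_dot[of V "?P u + w" u] cl V inV that by (auto intro: subspace_add)
    moreover have "(u - ?P u) \<bullet> ((?P u - w) - ?P u) \<le> 0"
      using closest_point_dot[of V "?P u - w" u] cl V inV that by (auto intro: subspace_diff)
    ultimately show ?thesis by simp
  qed
  have uniq: "?P u = p" if "p \<in> V" "\<And>w. w \<in> V \<Longrightarrow> (u - p) \<bullet> w = 0" for u p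
  proof -
    have "?P u - p \<in> V" using inV that(1) V subspace_diff by blast
    then have "(u - p) \<bullet> (?P u - p) = 0" "(u - ?P u) \<bullet> (?P u - p) = 0"
      using orth that(2) by auto
    then have "(?P u - p) \<bullet> (?P u - p) = 0" by (simp add: inner_diff_left)
    then show ?thesis by simp
  qed
  have "linear ?P"
  proof (rule linearI)
    show "?P (u + v) = ?P u + ?P v" for u v
      by (rule uniq) (use V inV orth[of _ u] orth[of _ v] in
          \<open>auto simp: subspace_add inner_add_left inner_diff_left\<close>)
    show "?P (r *\<^sub>R u) = r *\<^sub>R ?P u" for r u
      by (rule uniq) (use V inV orth[of _ u] in
          \<open>auto simp: subspace_scale inner_diff_left\<close>)
  qed
  then show "blinfun_apply (orth_proj V) = ?P"
    unfolding orth_proj_def by (simp add: bounded_linear_Blinfun_apply linear_conv_bounded_linear)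
  show "?P u \<in> V" by (rule inV)
  show "w \<in> V \<Longrightarrow> orthogonal (u - ?P u) w" by (simp add: orthogonal_def orth)
qed

lemma atlas_chart:
  assumes "smooth_atlas A" "c \<in> A"
  shows "open (cdom c)" "open (cmap c ` cdom c)" "continuous_on (cdom c) (cmap c)"
    "continuous_on (cmap c ` cdom c) (cinv c)" "x \<in> cdom c \<Longrightarrow> cinv c (cmap c x) = x"
  using assms unfolding smooth_atlas_def homeomorphism_def by blast+

lemma tangent_spaceI:
  assumes "\<And>c d. c \<in> A \<Longrightarrow> d \<in> A \<Longrightarrow> x \<in> cdom c \<Longrightarrow> x \<in> cdom d \<Longrightarrow> v d = local_deriv c d id x (v c)"
    and "\<And>c. \<not> (c \<in> A \<and> x \<in> cdom c) \<Longrightarrow> v c = 0"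
  shows "v \<in> tangent_space A x"
  using assms unfolding tangent_space_def by blast

lemma tangent_spaceD:
  assumes "v \<in> tangent_space A x"
  shows "c \<in> A \<Longrightarrow> d \<in> A \<Longrightarrow> x \<in> cdom c \<Longrightarrow> x \<in> cdom d \<Longrightarrow> v d = local_deriv c d id x (v c)"
    and "\<not> (c \<in> A \<and> x \<in> cdom c) \<Longrightarrow> v c = 0"
  using assms unfolding tangent_space_def by blast+

lemma chart_at:
  assumes "smooth_atlas A"
  shows "chart_at A x \<in> A" "x \<in> cdom (chart_at A x)"
proof -
  have "\<exists>c. c \<in> A \<and> x \<in> cdom c" using assms unfolding smooth_atlas_def by blast
  then have "chart_at A x \<in> A \<and> x \<in> cdom (chart_at A x)"
    unfolding chart_at_def by (rule someI_ex)
  then show "chart_at A x \<in> A" "x \<in> cdom (chart_at A x)" by auto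
qed

lemma C1_map_id:
  assumes "smooth_atlas A"
  shows "C1_map A id"
proof -
  have "Ck_on 1 (cmap d \<circ> id \<circ> cinv c) (cmap c ` (cdom c \<inter> id -` cdom d))"
    if "c \<in> A" "d \<in> A" for c d
    using assms that unfolding smooth_atlas_def smooth_on_def by (simp only: comp_id vimage_id id_apply)
  then show ?thesis unfolding C1_map_def by (simp add: continuous_on_id' id_def)
qed

lemma local_deriv_has_derivative:
  assumes "C1_map A f" "c \<in> A" "d \<in> A" "x \<in> cdom c" "f x \<in> cdom d"
  shows "((cmap d \<circ> f \<circ> cinv c) has_derivative local_deriv c d f x) (at (cmap c x))"
proof -
  have "(cmap d \<circ> f \<circ> cinv c) differentiable (at (cmap c x))"
    using assms unfolding C1_map_def by (auto simp: One_nat_def)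
  then show ?thesis
    unfolding local_deriv_def by (simp only: frechet_derivative_works)
qed

lemma local_deriv_comp:
  assumes A: "smooth_atlas A" and f: "C1_map A f" and h: "C1_map A h"
    and c: "c \<in> A" "x \<in> cdom c" and d: "d \<in> A" "f x \<in> cdom d"
    and e: "e \<in> A" "h (f x) \<in> cdom e"
  shows "local_deriv c e (h \<circ> f) x a = local_deriv d e h (f x) (local_deriv c d f x a)"
proof -
  let ?p = "cmap c x"
  let ?F = "cmap d \<circ> f \<circ> cinv c" and ?H = "cmap e \<circ> h \<circ> cinv d"
  let ?W = "cmap c ` cdom c \<inter> cinv c -` (f -` cdom d)"
  have Fp: "?F ?p = cmap d (f x)" using atlas_chart(5)[OF A c(1)] c by simp
  have 1: "(?F has_derivative local_deriv c d f x) (at ?p)"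
    by (rule local_deriv_has_derivative[OF f c(1) d(1) c(2) d(2)])
  have "(?H has_derivative local_deriv d e h (f x)) (at (?F ?p))"
    unfolding Fp by (rule local_deriv_has_derivative[OF h d(1) e(1) d(2) e(2)])
  from diff_chain_at[OF 1 this]
  have 2: "((?H \<circ> ?F) has_derivative (local_deriv d e h (f x) \<circ> local_deriv c d f x)) (at ?p)" .
  have "open (f -` cdom d)"
    using f atlas_chart(1)[OF A d(1)] unfolding C1_map_def
    by (simp add: continuous_on_open_vimage)
  then have W: "open ?W"
    using continuous_open_preimage[OF atlas_chart(4)[OF A c(1)] atlas_chart(2)[OF A c(1)]] by blast
  have pW: "?p \<in> ?W" using atlas_chart(5)[OF A c(1)] c d by auto
  have eq: "(?H \<circ> ?F) y = (cmap e \<circ> (h \<circ> f) \<circ> cinv c) y" if "y \<in> ?W" for y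
    using that atlas_chart(5)[OF A d(1)] by auto
  have "((cmap e \<circ> (h \<circ> f) \<circ> cinv c) has_derivative
          (local_deriv d e h (f x) \<circ> local_deriv c d f x)) (at ?p)"
    by (rule has_derivative_transform_within_open[OF 2 W pW eq])
  from frechet_derivative_at[OF this] show ?thesis
    unfolding local_deriv_def by (metis comp_apply)
qed

lemma local_deriv_same_chart:
  assumes A: "smooth_atlas A" and c: "c \<in> A" "x \<in> cdom c"
  shows "local_deriv c c id x a = a"
proof -
  have "((cmap c \<circ> id \<circ> cinv c) has_derivative (\<lambda>a. a)) (at (cmap c x))"
  proof (rule has_derivative_transform_within_open[OF has_derivative_ident])
    show "open (cmap c ` cdom c)" by (rule atlas_chart(2)[OF A c(1)])
    show "cmap c x \<in> cmap c ` cdom c" using c by blast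
    show "y = (cmap c \<circ> id \<circ> cinv c) y" if "y \<in> cmap c ` cdom c" for y
      using that atlas_chart(5)[OF A c(1)] by auto
  qed
  from frechet_derivative_at[OF this] show ?thesis
    unfolding local_deriv_def by metis
qed

lemma tangent_map_in_chart:
  assumes A: "smooth_atlas A" and f: "C1_map A f" and v: "v \<in> tangent_space A x"
    and c: "c \<in> A" "x \<in> cdom c" and d: "d \<in> A" "f x \<in> cdom d"
  shows "tangent_map A f x v d = local_deriv c d f x (v c)"
proof -
  let ?b = "chart_at A x"
  have b: "?b \<in> A" "x \<in> cdom ?b" using chart_at[OF A] by auto
  have vc: "v c = local_deriv ?b c id x (v ?b)"
    using v b c unfolding tangent_space_def by blast
  have "local_deriv ?b d (f \<circ> id) x (v ?b) = local_deriv c d f (id x) (local_deriv ?b c id x (v ?b))"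
    by (rule local_deriv_comp[OF A C1_map_id[OF A] f b]) (use c d in auto)
  then show ?thesis unfolding tangent_map_def vc using d by simp
qed

lemma tangent_map_in_tangent_space:
  assumes A: "smooth_atlas A" and f: "C1_map A f" and v: "v \<in> tangent_space A x"
  shows "tangent_map A f x v \<in> tangent_space A (f x)"
proof -
  let ?b = "chart_at A x"
  have b: "?b \<in> A" "x \<in> cdom ?b" using chart_at[OF A] by auto
  show ?thesis
  proof (rule tangent_spaceI)
    fix c d assume cd: "c \<in> A" "d \<in> A" "f x \<in> cdom c" "f x \<in> cdom d"
    have "local_deriv ?b d (id \<circ> f) x a = local_deriv c d id (f x) (local_deriv ?b c f x a)" for a
      by (rule local_deriv_comp[OF A f C1_map_id[OF A] b]) (use cd in simp_all)
    then show "tangent_map A f x v d = local_deriv c d id (f x) (tangent_map A f x v c)"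
      unfolding tangent_map_def using cd by (simp only: id_comp simp_thms if_True)
  qed (auto simp: tangent_map_def)
qed

lemma subspace_tangent_space:
  assumes A: "smooth_atlas A"
  shows "subspace (tangent_space A x)"
proof -
  have lin: "linear (local_deriv c d id x)"
    if "c \<in> A" "d \<in> A" "x \<in> cdom c" "x \<in> cdom d" for c d
    using local_deriv_has_derivative[OF C1_map_id[OF A] that(1,2,3)] that(4)
    by (simp add: has_derivative_linear)
  note D = tangent_spaceD
  show ?thesis
  proof (rule subspaceI)
    show "0 \<in> tangent_space A x"
      by (rule tangent_spaceI) (simp_all only: zero_fun_apply linear_0[OF lin])
    fix u r assume u: "u \<in> tangent_space A x"
    show "r *\<^sub>R u \<in> tangent_space A x"
    proof (rule tangent_spaceI)
      fix c d assume cd: "c \<in> A" "d \<in> A" "x \<in> cdom c" "x \<in> cdom d"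
      show "(r *\<^sub>R u) d = local_deriv c d id x ((r *\<^sub>R u) c)"
        unfolding scaleR_fun_def linear_scale[OF lin[OF cd]] D(1)[OF u cd, symmetric] ..
    qed (simp only: scaleR_fun_def D(2)[OF u] scaleR_zero_right simp_thms)
    fix v assume v: "v \<in> tangent_space A x"
    show "u + v \<in> tangent_space A x"
    proof (rule tangent_spaceI)
      fix c d assume cd: "c \<in> A" "d \<in> A" "x \<in> cdom c" "x \<in> cdom d"
      show "(u + v) d = local_deriv c d id x ((u + v) c)"
        unfolding plus_fun_apply linear_add[OF lin[OF cd]]
          D(1)[OF u cd, symmetric] D(1)[OF v cd, symmetric] ..
    qed (simp only: plus_fun_apply D(2)[OF u] D(2)[OF v] add_0_right simp_thms)
  qed
qed

text \<open>Each chart at \<open>x\<close> identifies the tangent space at \<open>x\<close> with \<open>'e\<close>.\<close>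

lemma bij_betw_chart_coordinates:
  assumes A: "smooth_atlas A" and c: "c \<in> A" "x \<in> cdom c"
  shows "bij_betw (\<lambda>v. v c) (tangent_space A x) UNIV"
proof (rule bij_betw_byWitness[where f' = "coord_vec A c x"])
  show "\<forall>v\<in>tangent_space A x. coord_vec A c x (v c) = v"
  proof (intro ballI ext)
    fix v d assume v: "v \<in> tangent_space A x"
    show "coord_vec A c x (v c) d = v d"
    proof (cases "d \<in> A \<and> x \<in> cdom d")
      case True
      then show ?thesis
        using tangent_spaceD(1)[OF v c(1) _ c(2), of d] by (simp only: coord_vec_def if_True simp_thms)
    next
      case False
      then show ?thesis using tangent_spaceD(2)[OF v] by (simp only: coord_vec_def if_False simp_thms)
    qed
  qed
  show "\<forall>a\<in>UNIV. coord_vec A c x a c = a"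
    using local_deriv_same_chart[OF A c] c unfolding coord_vec_def by simp
  show "coord_vec A c x ` UNIV \<subseteq> tangent_space A x"
  proof safe
    fix a
    show "coord_vec A c x a \<in> tangent_space A x"
    proof (rule tangent_spaceI)
      fix d e assume de: "d \<in> A" "e \<in> A" "x \<in> cdom d" "x \<in> cdom e"
      have "local_deriv c e (id \<circ> id) x a = local_deriv d e id (id x) (local_deriv c d id x a)"
        by (rule local_deriv_comp[OF A C1_map_id[OF A] C1_map_id[OF A] c]) (use de in simp_all)
      then show "coord_vec A c x a e = local_deriv d e id x (coord_vec A c x a d)"
        unfolding coord_vec_def using de by (simp only: id_comp id_apply simp_thms if_True)
    qed (auto simp: coord_vec_def)
  qed
qed simp

end

theory Submission
  imports Defs
begin

text \<open>
  For a linear cocycle \<open>L\<close> on a vector bundle, consider the induced homeomorphism of the unit sphere bundle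
  and the continuous function \<open>\<phi> v = ln \<parallel>L v\<parallel>\<close>. If the vectors of an invariant subbundle \<open>W\<close> were not
  expanded by a given factor in any number of steps, orbit averages of worse and worse vectors would have
  a weak limit \<open>\<nu>\<close>, an invariant measure with \<open>\<integral> \<phi> d\<nu> \<le> 0\<close>, which lives on \<open>W\<close> because \<open>W\<close> is a.e. continuous.
  But if the orbit of almost every vector in \<open>W\<close> has lower limit of the norms above the initial norm, for some
  measurable norm, then Poincare recurrence yields \<open>\<integral> \<phi> d\<nu> > 0\<close>. So \<open>W\<close> is uniformly expanded.

  This applies to \<open>E\<^sup>c\<^sup>u\<close>, and in the dual bundle to the annihilator of \<open>E\<^sup>c\<^sup>u\<close>, where the contraction along \<open>E\<^sup>s\<close>
  turns into expansion. Thus \<open>Tf\<close> expands \<open>E\<^sup>c\<^sup>u\<close> and contracts the quotient of the tangent bundle by \<open>E\<^sup>c\<^sup>u\<close>, both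
  uniformly. Hence vectors outside \<open>E\<^sup>c\<^sup>u\<close> grow exponentially in backward time, and along a backward orbit the
  norm of a vector in \<open>E\<^sup>s\<close> becomes comparable to the quotient norm.
\<close>


subsection \<open>Birkhoff sums of measure preserving maps\<close>

text \<open>\<open>Es\<close> is only measurable: a weak limit of averages over vectors of
  \<open>Es\<close> may leave \<open>Es\<close>, so the averaging argument cannot be run there
  directly. The annihilator of \<open>Ecu\<close> is continuous wherever \<open>Ecu\<close> is,
  hence it survives the limit. The two cocycles preserve the pairing of covectors with vectors, so a
  shrinking vector of \<open>Es\<close> forces the covectors that it pairs with to grow;
  \<open>Es\<close> enters only through a supremum that defines a norm on the annihilator, and for a
  norm measurability is enough. The hypotheses carry no rate: the gain depends on the vector, and
  the logarithm of a measurable norm need not be integrable. Positivity of the integral is therefore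
  proved modulo coboundaries of nonintegrable functions. Growth in the quotient says nothing about
  the angle between \<open>Es\<close> and \<open>Ecu\<close>, for which no uniform bound is at hand.
  Its effect is divided by a fixed factor in each block of backward steps, so it is forgotten after
  a number of steps that depends on the point alone; this is the origin of \<open>l\<close>.\<close>

lemma AE_funpow_measure_preserving:
  assumes F: "F \<in> measurable M M" and inv: "distr M M F = M" and P: "AE x in M. P x"
  shows "AE x in M. \<forall>n. P ((F ^^ n) x)"
proof -
  have "AE x in M. P ((F ^^ n) x)" for n
  proof (induction n)
    case (Suc n)
    have "AE x in distr M M F. P ((F ^^ n) x)" unfolding inv by (rule Suc)
    from AE_distrD[OF F this] show ?case by (simp add: funpow_swap1)
  qed (use P in simp)
  then show ?thesis by (simp add: AE_all_countable)
qed

lemma measurable_funpow: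
  assumes "F \<in> measurable M M"
  shows "F ^^ n \<in> measurable M M"
proof (induction n)
  case (Suc n)
  then show ?case using measurable_comp[OF Suc assms] by (simp add: comp_def)
qed (simp add: id_def)

text \<open>Poincare recurrence with a waiting time. The preimages of \<open>A\<close> under the
  iterates at multiples of \<open>Suc k\<close> all have the measure of \<open>A\<close>, so they
  cannot be pairwise disjoint in a probability space; a common point of two of them yields the
  return.\<close>

lemma (in prob_space) exists_return:
  assumes F: "F \<in> measurable M M" and inv: "distr M M F = M"
    and A: "A \<in> sets M" "0 < prob A"
  shows "\<exists>x\<in>A. \<exists>n\<ge>k. (F ^^ n) x \<in> A"
proof (rule ccontr)
  assume no: "\<not> ?thesis"
  define k' where "k' = Suc k"
  define V where "V i = (F ^^ (i * k')) -` A \<inter> space M" for i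
  have Fn: "F ^^ n \<in> measurable M M" for n by (rule measurable_funpow[OF F])
  have V: "V i \<in> events" for i unfolding V_def using Fn A(1) by (rule measurable_sets)
  have distr: "distr M M (F ^^ n) = M" for n
  proof (induction n)
    case 0 show ?case by (simp add: id_def)
  next
    case (Suc n)
    have "distr M M (F ^^ Suc n) = distr (distr M M (F ^^ n)) M F"
      by (simp only: distr_distr[OF F Fn[of n]] funpow.simps)
    then show ?case by (simp only: Suc inv)
  qed
  have PV: "prob (V i) = prob A" for i
    using measure_distr[OF Fn A(1)] distr unfolding V_def by metis
  have disj: "V i \<inter> V j = {}" if "i < j" for i j
  proof (rule ccontr)
    assume "V i \<inter> V j \<noteq> {}"
    then obtain x where x: "(F ^^ (i * k')) x \<in> A" "(F ^^ (j * k')) x \<in> A" unfolding V_def by auto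
    have "j * k' = (j - i) * k' + i * k'" using that by (metis add_mult_distrib le_add_diff_inverse2 less_imp_le)
    then have "(F ^^ ((j - i) * k')) ((F ^^ (i * k')) x) \<in> A"
      using x(2) by (simp add: funpow_add)
    moreover have "k \<le> (j - i) * k'"
    proof -
      have "1 * k' \<le> (j - i) * k'" using that by (intro mult_right_mono) auto
      then show ?thesis unfolding k'_def by simp
    qed
    ultimately show False using no x(1) by blast
  qed
  obtain m :: nat where m: "1 < m * prob A" using ex_less_of_nat_mult[OF A(2)] by blast
  have "prob (\<Union>i\<in>{..<m}. V i) = (\<Sum>i<m. prob (V i))"
  proof (rule finite_measure_finite_Union)
    show "disjoint_family_on V {..<m}"
      unfolding disjoint_family_on_def using disj by (metis Int_commute linorder_neqE_nat)
  qed (use V in auto)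
  also have "\<dots> = m * prob A" by (simp add: PV)
  finally show False using m prob_le_1[of "\<Union>i\<in>{..<m}. V i"] by simp
qed

text \<open>\<open>\<Phi>\<close> need not be integrable; the inequality comes from Fatou's lemma applied to truncations of \<open>\<Phi>\<close>.\<close>

lemma (in prob_space) nn_integral_coboundary_le:
  fixes \<Phi> :: "'a \<Rightarrow> real"
  assumes F: "F \<in> measurable M M" and inv: "distr M M F = M"
    and [measurable]: "\<Phi> \<in> borel_measurable M"
    and C: "0 \<le> C" "AE x in M. \<Phi> x - \<Phi> (F x) \<le> C"
  shows "(\<integral>\<^sup>+x. ennreal (C - (\<Phi> x - \<Phi> (F x))) \<partial>M) \<le> ennreal C"
proof -
  note F[measurable]
  define T where "T k x = max (- real k) (min (real k) x)" for k and x :: real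
  define u where "u k x = T k (\<Phi> x) - T k (\<Phi> (F x))" for k x
  have Tm[measurable]: "T k \<in> borel_measurable borel" for k unfolding T_def by measurable
  have Tb: "\<bar>T k x\<bar> \<le> real k" for k x unfolding T_def by auto
  have um[measurable]: "u k \<in> borel_measurable M" for k unfolding u_def by measurable
  have int: "integrable M (\<lambda>x. T k (\<Phi> x))" "integrable M (\<lambda>x. T k (\<Phi> (F x)))" for k
    using Tb by (auto intro!: integrable_const_bound[where B="real k"])
  have "integral\<^sup>L M (\<lambda>x. T k (\<Phi> (F x))) = integral\<^sup>L (distr M M F) (\<lambda>x. T k (\<Phi> x))" for k
    by (rule integral_distr[symmetric]) auto
  then have u0: "integral\<^sup>L M (u k) = 0" "integrable M (u k)" for k
    using int inv unfolding u_def by simp_all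
  \<comment> \<open>\<open>T k\<close> is nondecreasing and 1-Lipschitz, so a truncated difference
    is at most the positive part of the difference itself; as \<open>0 \<le> C\<close>, the bound is
    inherited.\<close>
  have le: "AE x in M. u k x \<le> C" for k
    using C(2) by eventually_elim (use C(1) in \<open>auto simp: u_def T_def max_def min_def split: if_splits\<close>)
  have k: "(\<integral>\<^sup>+x. ennreal (C - u k x) \<partial>M) = ennreal C" for k
  proof -
    have "(\<integral>\<^sup>+x. ennreal (C - u k x) \<partial>M) = ennreal (\<integral>x. C - u k x \<partial>M)"
      by (rule nn_integral_eq_integral) (use u0 le in auto)
    then show ?thesis using u0 by (simp add: prob_space)
  qed
  have lim: "liminf (\<lambda>k. ennreal (C - u k x)) = ennreal (C - (\<Phi> x - \<Phi> (F x)))" for x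
  proof -
    obtain N :: nat where N: "max \<bar>\<Phi> x\<bar> \<bar>\<Phi> (F x)\<bar> \<le> real N" using real_arch_simple by blast
    have "\<forall>\<^sub>F k in sequentially. ennreal (C - u k x) = ennreal (C - (\<Phi> x - \<Phi> (F x)))"
      using eventually_ge_at_top[of N]
    proof eventually_elim
      case (elim k)
      then have "T k (\<Phi> x) = \<Phi> x" "T k (\<Phi> (F x)) = \<Phi> (F x)" using N unfolding T_def by auto
      then show ?case unfolding u_def by simp
    qed
    then show ?thesis by (intro lim_imp_Liminf tendsto_eventually) auto
  qed
  have "(\<integral>\<^sup>+x. liminf (\<lambda>k. ennreal (C - u k x)) \<partial>M) \<le> liminf (\<lambda>k. \<integral>\<^sup>+x. ennreal (C - u k x) \<partial>M)"
    by (rule nn_integral_liminf) measurable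
  then show ?thesis by (simp add: lim k Liminf_const)
qed

text \<open>With \<open>\<psi> = (INF n\<ge>0. \<theta> n)\<close> and \<open>\<eta> = (INF n\<ge>1. \<theta> n)\<close> one has \<open>\<psi> = min 0 \<eta>\<close>, so that \<open>\<phi>\<close> is the sum of
  \<open>max 0 \<eta>\<close> and a coboundary. If \<open>\<phi>\<close> had nonpositive integral, \<open>\<eta> \<le> 0\<close> would follow and \<open>\<theta>\<close> would itself be
  a coboundary, contradicting Poincare recurrence.\<close>

lemma (in prob_space) integral_pos_if_birkhoff_sums_eventually_pos:
  fixes \<phi> h :: "'a \<Rightarrow> real"
  assumes F: "F \<in> measurable M M" and inv: "distr M M F = M"
    and \<phi>m: "\<phi> \<in> borel_measurable M" and \<phi>b: "\<And>x. x \<in> space M \<Longrightarrow> \<bar>\<phi> x\<bar> \<le> C"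
    and hm: "h \<in> borel_measurable M"
    and pos: "AE x in M. \<exists>\<epsilon>>0. \<forall>\<^sub>F n in sequentially.
      \<epsilon> \<le> (\<Sum>k<n. \<phi> ((F ^^ k) x)) + h ((F ^^ n) x) - h x"
  shows "0 < integral\<^sup>L M \<phi>"
proof (rule ccontr)
  assume "\<not> 0 < integral\<^sup>L M \<phi>"
  then have nonpos: "integral\<^sup>L M \<phi> \<le> 0" by simp
  note [measurable] = F \<phi>m hm measurable_funpow[OF F]
  define \<theta> where "\<theta> n x = (\<Sum>k<n. \<phi> ((F ^^ k) x)) + h ((F ^^ n) x) - h x" for n x
  have [measurable]: "\<theta> n \<in> borel_measurable M" for n unfolding \<theta>_def by measurable
  have \<theta>0: "\<theta> 0 x = 0" for x by (simp add: \<theta>_def)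
  have \<theta>Suc: "\<theta> (Suc n) x = \<theta> 1 x + \<theta> n (F x)" for n x
    unfolding \<theta>_def by (subst sum.lessThan_Suc_shift) (simp add: funpow_swap1)
  \<comment> \<open>The infimum is formed in \<open>ereal\<close>, where it is measurable without
    any bound. Where it is infinite, \<psi> takes the default value 0; by \<open>bdd\<close> this
    happens only on a null set.\<close>
  define \<psi> where "\<psi> x = real_of_ereal (INF n. ereal (\<theta> n x))" for x
  have [measurable]: "\<psi> \<in> borel_measurable M" unfolding \<psi>_def by measurable
  have bdd: "AE x in M. bdd_below (range (\<lambda>n. \<theta> n x))"
    using pos
  proof eventually_elim
    case (elim x)
    then obtain \<epsilon> N where e: "\<epsilon> > 0" "\<And>n. n \<ge> N \<Longrightarrow> \<epsilon> \<le> \<theta> n x"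
      unfolding \<theta>_def eventually_sequentially by blast
    have "Min (insert 0 ((\<lambda>n. \<theta> n x) ` {..<N})) \<le> \<theta> n x" for n
    proof (cases "n < N")
      case False
      have "Min (insert 0 ((\<lambda>n. \<theta> n x) ` {..<N})) \<le> 0" by (rule Min_le) auto
      then show ?thesis using e(1) e(2)[of n] False by linarith
    qed (auto intro!: Min_le)
    then show ?case by (rule bdd_belowI2)
  qed
  define Good where "Good x \<longleftrightarrow> bdd_below (range (\<lambda>n. \<theta> n x))" for x
  have \<psi>Inf: "\<psi> x = (INF n. \<theta> n x)" if g: "Good x" for x
  proof -
    have "\<bar>INF n. ereal (\<theta> n x)\<bar> \<noteq> \<infinity>"
    proof -
      obtain b where "\<forall>y\<in>range (\<lambda>n. \<theta> n x). b \<le> y" using g[unfolded Good_def bdd_below_def] ..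
      then have b: "b \<le> \<theta> n x" for n by simp
      have "ereal b \<le> (INF n. ereal (\<theta> n x))" by (rule INF_greatest) (simp add: b)
      moreover have "(INF n. ereal (\<theta> n x)) \<le> ereal (\<theta> 0 x)" by (rule INF_lower) simp
      ultimately show ?thesis by auto
    qed
    then have "ereal (INF n. \<theta> n x) = (INF n. ereal (\<theta> n x))" by (rule ereal_INF)
    then show ?thesis unfolding \<psi>_def by (metis real_of_ereal.simps(1))
  qed
  define \<eta> where "\<eta> x = \<theta> 1 x + \<psi> (F x)" for x
  have [measurable]: "\<eta> \<in> borel_measurable M" unfolding \<eta>_def by measurable
  have \<psi>\<eta>: "\<psi> x = min 0 (\<eta> x)" if g: "Good x" "Good (F x)" for x
  proof (rule antisym)
    have b: "bdd_below (range (\<lambda>n. \<theta> n x))" "bdd_below (range (\<lambda>n. \<theta> n (F x)))"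
      using g unfolding Good_def by auto
    have 1: "\<psi> x \<le> \<theta> n x" for n using cInf_lower[OF rangeI b(1)] by (simp only: \<psi>Inf[OF g(1)])
    have "\<psi> x - \<theta> 1 x \<le> \<theta> n (F x)" for n using 1[of "Suc n"] \<theta>Suc[of n x] by linarith
    then have "\<psi> x - \<theta> 1 x \<le> \<psi> (F x)" unfolding \<psi>Inf[OF g(2)] by (intro cINF_greatest) auto
    then show "\<psi> x \<le> min 0 (\<eta> x)" using 1[of 0] \<theta>0 unfolding \<eta>_def by simp
    have 2: "\<psi> (F x) \<le> \<theta> n (F x)" for n using cInf_lower[OF rangeI b(2)] by (simp only: \<psi>Inf[OF g(2)])
    have "min 0 (\<eta> x) \<le> \<theta> n x" for n
    proof (cases n)
      case (Suc m)
      then show ?thesis using 2[of m] \<theta>Suc[of m x] unfolding \<eta>_def by simp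
    qed (simp add: \<theta>0)
    then show "min 0 (\<eta> x) \<le> \<psi> x" unfolding \<psi>Inf[OF g(1)] by (intro cINF_greatest) auto
  qed
  define \<Phi> where "\<Phi> x = \<psi> x + h x" for x
  have [measurable]: "\<Phi> \<in> borel_measurable M" unfolding \<Phi>_def by measurable
  have "AE x in M. \<forall>n. Good ((F ^^ n) x)"
    by (rule AE_funpow_measure_preserving[OF F inv, where P = Good]) (use bdd in \<open>simp only: Good_def\<close>)
  then have good: "AE x in M. Good x \<and> Good (F x)"
  proof eventually_elim
    case (elim x)
    then show ?case using spec[OF elim, of 0] spec[OF elim, of 1] by simp
  qed
  \<comment> \<open>This is \<eta> - min 0 \<eta> = max 0 \<eta>, with \<open>h\<close> absorbed
    into \<Phi>.\<close>
  have decomp: "AE x in M. \<phi> x = max 0 (\<eta> x) + (\<Phi> x - \<Phi> (F x))"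
    using good
  proof eventually_elim
    case (elim x)
    then have "\<psi> x = min 0 (\<eta> x)" using \<psi>\<eta> by blast
    moreover have "\<eta> x = \<phi> x + h (F x) - h x + \<psi> (F x)" unfolding \<eta>_def \<theta>_def by simp
    ultimately show ?case unfolding \<Phi>_def by (auto simp: max_def min_def)
  qed
  have C0: "0 \<le> C" using \<phi>b subprob_not_empty by (meson abs_ge_zero all_not_in_conv order_trans)
  have u: "AE x in M. \<Phi> x - \<Phi> (F x) \<le> C"
    using decomp AE_space by eventually_elim (use \<phi>b in \<open>fastforce simp: abs_le_iff max_def split: if_splits\<close>)
  have \<phi>i: "integrable M \<phi>" using \<phi>b by (auto intro!: integrable_const_bound[where B=C])
  \<comment> \<open>Both summands are nonnegative, so neither \<eta> nor \<Phi> has to be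
    integrable. The total is at most \<open>C\<close>, while the first summand alone integrates to
    at least \<open>C\<close> when \<phi> has nonpositive integral.\<close>
  have "(\<integral>\<^sup>+x. ennreal (C - \<phi> x) + ennreal (max 0 (\<eta> x)) \<partial>M)
      = (\<integral>\<^sup>+x. ennreal (C - (\<Phi> x - \<Phi> (F x))) \<partial>M)"
  proof (rule nn_integral_cong_AE)
    show "AE x in M. ennreal (C - \<phi> x) + ennreal (max 0 (\<eta> x)) = ennreal (C - (\<Phi> x - \<Phi> (F x)))"
      using decomp AE_space
    proof eventually_elim
      case (elim x)
      then have "0 \<le> C - \<phi> x" using \<phi>b[of x] by auto
      then show ?case using elim by (subst ennreal_plus[symmetric]) (auto intro!: arg_cong[where f=ennreal])
    qed
  qed
  then have 1: "(\<integral>\<^sup>+x. ennreal (C - \<phi> x) \<partial>M) + (\<integral>\<^sup>+x. ennreal (max 0 (\<eta> x)) \<partial>M) \<le> ennreal C"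
    using nn_integral_coboundary_le[OF F inv _ C0 u] by (simp add: nn_integral_add)
  have 2: "(\<integral>\<^sup>+x. ennreal (C - \<phi> x) \<partial>M) = ennreal (\<integral>x. C - \<phi> x \<partial>M)"
    by (rule nn_integral_eq_integral) (use \<phi>i \<phi>b in \<open>auto intro!: AE_I2 simp: abs_le_iff\<close>)
  have 3: "ennreal C \<le> ennreal (\<integral>x. C - \<phi> x \<partial>M)"
    using \<phi>i nonpos by (intro ennreal_leI) (simp add: prob_space)
  have "ennreal C + (\<integral>\<^sup>+x. ennreal (max 0 (\<eta> x)) \<partial>M) \<le> ennreal C + 0"
    using order_trans[OF add_right_mono[OF 3] 1[unfolded 2]] by simp
  then have "(\<integral>\<^sup>+x. ennreal (max 0 (\<eta> x)) \<partial>M) = 0"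
    unfolding ennreal_add_left_cancel_le infinity_ennreal_def by (simp only: ennreal_neq_top le_zero_eq simp_thms)
  moreover have "(\<lambda>x. ennreal (max 0 (\<eta> x))) \<in> borel_measurable M" by measurable
  ultimately have "AE x in M. ennreal (max 0 (\<eta> x)) = 0" by (simp only: nn_integral_0_iff_AE)
  then have \<eta>0: "AE x in M. \<eta> x \<le> 0" by eventually_elim (simp only: ennreal_eq_0_iff max.bounded_iff)
  have "AE x in M. \<theta> 1 x = \<psi> x - \<psi> (F x)"
    using decomp \<eta>0 by eventually_elim (simp add: \<theta>_def \<Phi>_def max_def)
  then have "AE x in M. \<forall>n. \<theta> 1 ((F ^^ n) x) = \<psi> ((F ^^ n) x) - \<psi> (F ((F ^^ n) x))"
    by (rule AE_funpow_measure_preserving[OF F inv, where P = "\<lambda>x. \<theta> 1 x = \<psi> x - \<psi> (F x)"])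
  then have cob: "AE x in M. \<forall>n. \<theta> n x = \<psi> x - \<psi> ((F ^^ n) x)"
  proof eventually_elim
    case (elim x)
    have "\<theta> n x = \<psi> x - \<psi> ((F ^^ n) x)" for n
    proof (induction n)
      case (Suc n)
      have "\<theta> (Suc n) x = \<theta> n x + \<theta> 1 ((F ^^ n) x)" unfolding \<theta>_def by simp
      then show ?case using Suc elim[rule_format, of n] by simp
    qed (simp add: \<theta>0)
    then show ?case by simp
  qed
  \<comment> \<open>By \<open>cob\<close>, eventual positivity of \<theta> means that \<psi> stays
    below its initial value by a fixed amount from some time on. The points for which amount and
    time are governed by \<open>k\<close> are cut into slices on which \<psi> varies by less than
    that amount. No point can return to its slice after \<open>k\<close> or more steps, yet
    recurrence demands a return as soon as one slice has positive measure.\<close>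
  define A where "A k i = {x \<in> space M. (\<forall>n\<in>{k..}. \<psi> ((F ^^ n) x) \<le> \<psi> x - 1 / real (Suc k)) \<and>
      real_of_int i \<le> real (Suc k) * \<psi> x \<and> real (Suc k) * \<psi> x < real_of_int i + 1}" for k :: nat and i :: int
  have Am: "A k i \<in> sets M" for k i unfolding A_def by measurable
  have "AE x in M. \<exists>k i. x \<in> A k i"
    using cob pos AE_space
  proof eventually_elim
    case (elim x)
    then obtain \<epsilon> N where e: "\<epsilon> > 0" "\<And>n. n \<ge> N \<Longrightarrow> \<epsilon> \<le> \<theta> n x"
      unfolding \<theta>_def eventually_sequentially by blast
    obtain N' where N': "1 / real (Suc N') < \<epsilon>" using nat_approx_posE[OF e(1)] by blast
    define k where "k = max N N'"
    have "1 / real (Suc k) \<le> 1 / real (Suc N')" unfolding k_def by (simp add: field_simps)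
    then have "1 / real (Suc k) \<le> \<epsilon>" using N' by simp
    then have 1: "\<psi> ((F ^^ n) x) \<le> \<psi> x - 1 / real (Suc k)" if "n \<ge> k" for n
    proof -
      have "\<epsilon> \<le> \<theta> n x" using that e(2) unfolding k_def by simp
      then show ?thesis using spec[OF elim(1), of n] \<open>1 / real (Suc k) \<le> \<epsilon>\<close> by linarith
    qed
    have "x \<in> A k \<lfloor>real (Suc k) * \<psi> x\<rfloor>"
      unfolding A_def mem_Collect_eq
      by (intro conjI ballI 1 elim(3) of_int_floor_le real_of_int_floor_add_one_gt) (simp only: atLeast_iff)
    then show ?case by (intro exI)
  qed
  then have "\<exists>k i. prob (A k i) \<noteq> 0"
  proof (rule contrapos_pp)
    assume "\<not> (\<exists>k i. prob (A k i) \<noteq> 0)"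
    then have "AE x in M. x \<notin> A k i" for k i
      using Am by (intro AE_not_in) (simp add: null_setsI emeasure_eq_measure)
    then have 0: "AE x in M. \<forall>k i. x \<notin> A k i" by (simp add: AE_all_countable)
    show "\<not> (AE x in M. \<exists>k i. x \<in> A k i)"
    proof
      assume "AE x in M. \<exists>k i. x \<in> A k i"
      with 0 have "AE x in M. False" by eventually_elim blast
      then show False by simp
    qed
  qed
  then obtain k i where ki: "0 < prob (A k i)" using zero_less_measure_iff by blast
  obtain x n where x: "x \<in> A k i" "n \<ge> k" "(F ^^ n) x \<in> A k i"
    using exists_return[OF F inv Am ki, of k] by blast
  have "\<psi> ((F ^^ n) x) \<le> \<psi> x - 1 / real (Suc k)" using x(1,2) unfolding A_def by simp
  then have "real (Suc k) * \<psi> ((F ^^ n) x) \<le> real (Suc k) * (\<psi> x - 1 / real (Suc k))"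
    by (rule mult_left_mono) simp
  also have "\<dots> = real (Suc k) * \<psi> x - 1" by (simp add: field_simps)
  finally show False using x(1,3) unfolding A_def by simp
qed


subsection \<open>Invariant measures on compact spaces\<close>

text \<open>The sign of \<open>cos (2 \<pi> 4^n t)\<close> encodes the \<open>n\<close>-th binary digit; both signs are attained on disjoint
  closed sets, as in a Cantor set.\<close>

lemma exists_real_with_digits:
  fixes b :: "nat \<Rightarrow> bool"
  shows "\<exists>t\<in>{0..1}. \<forall>n. if b n then cos (2 * pi * 4 ^ n * t) \<le> - 1 / 2 else 1 / 2 \<le> cos (2 * pi * 4 ^ n * t)"
proof -
  \<comment> \<open>Base 4 expansion with digits 0 and 2. Multiplication by \<open>4 ^ n\<close>
    brings digit n to the front modulo 1. What follows it is at most 1/6 and contributes an angle of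
    at most pi/3, whose cosine is at least 1/2; the digit 2 adds half a turn and flips the
    sign.\<close>
  define d :: "nat \<Rightarrow> real" where "d k = (if b k then 1 / 2 else 0)" for k
  have d: "0 \<le> d k" "d k \<le> 1 / 2" for k unfolding d_def by auto
  have "(\<lambda>k. (1/2) * (1/4::real) ^ k) sums ((1/2) * (1 / (1 - 1/4)))"
    by (intro sums_mult geometric_sums) simp
  then have geo: "summable (\<lambda>k. (1/2) * (1/4::real) ^ k)" "(\<Sum>k. (1/2) * (1/4::real) ^ k) = 2 / 3"
    by (auto simp: sums_iff)
  have sum: "summable (\<lambda>k. d (k + n) * (1 / 4) ^ k)" for n
    by (rule summable_comparison_test'[OF geo(1), of 0]) (use d in \<open>auto simp: abs_mult intro!: mult_right_mono\<close>)
  define R where "R n = (\<Sum>k. d (k + n) * (1 / 4) ^ k)" for n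
  have Rb: "0 \<le> R n" "R n \<le> 2 / 3" for n
    unfolding R_def geo(2)[symmetric]
    by (intro suminf_nonneg sum suminf_le geo mult_nonneg_nonneg mult_right_mono d; simp)+
  have RSuc: "R n = d n + R (Suc n) / 4" for n
  proof -
    have "R n = (\<Sum>k. d (Suc k + n) * (1 / 4) ^ Suc k) + d n"
      unfolding R_def using suminf_split_head[OF sum[of n]] by simp
    also have "(\<Sum>k. d (Suc k + n) * (1 / 4) ^ Suc k) = (\<Sum>k. (d (k + Suc n) * (1 / 4) ^ k) / 4)" by simp
    also have "\<dots> = R (Suc n) / 4" unfolding R_def by (rule suminf_divide[OF sum])
    finally show ?thesis by simp
  qed
  have shift: "\<exists>m::int. 4 ^ n * R 0 = R n + of_int m" for n
  proof (induction n)
    case 0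
    show ?case by (rule exI[of _ 0]) simp
  next
    case (Suc n)
    then obtain m where "4 ^ n * R 0 = R n + of_int m" by blast
    then have "4 ^ Suc n * R 0 = R (Suc n) + of_int (4 * m + (if b n then 2 else 0))"
      using RSuc[of n] unfolding d_def by auto
    then show ?case by blast
  qed
  show ?thesis
  proof (intro bexI allI)
    show "R 0 \<in> {0..1}" using Rb[of 0] by simp
    fix n
    obtain m where m: "4 ^ n * R 0 = R n + of_int m" using shift by blast
    define s where "s = R (Suc n) / 4"
    have s: "0 \<le> s" "s \<le> 1 / 6" using Rb[of "Suc n"] unfolding s_def by auto
    have "2 * pi * 4 ^ n * R 0 = 2 * pi * R n + 2 * pi * of_int m"
      using m by (metis (no_types, opaque_lifting) distrib_left mult.assoc)
    then have c: "cos (2 * pi * 4 ^ n * R 0) = cos (2 * pi * R n)"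
      by (simp only: cos_add cos_int_2pin sin_int_2pin mult_1_right mult_zero_right diff_zero)
    have cs: "1 / 2 \<le> cos (2 * pi * s)"
    proof -
      have "cos (pi / 3) \<le> cos (2 * pi * s)"
        by (rule cos_monotone_0_pi_le) (use s pi_gt_zero in auto)
      then show ?thesis by (simp add: cos_60)
    qed
    show "if b n then cos (2 * pi * 4 ^ n * R 0) \<le> - 1 / 2 else 1 / 2 \<le> cos (2 * pi * 4 ^ n * R 0)"
    proof (cases "b n")
      case True
      then have "2 * pi * R n = pi + 2 * pi * s" using RSuc[of n] unfolding s_def d_def by (simp add: algebra_simps)
      then show ?thesis using True cs c by simp
    next
      case False
      then have "R n = s" using RSuc[of n] unfolding s_def d_def by simp
      then show ?thesis using False cs c by simp
    qed
  qed
qed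

text \<open>The \<open>n\<close>-th digit of \<open>t\<close> records whether \<open>\<pi> t\<close> is taken from the closure of the \<open>n\<close>-th basic open
  set or from its complement.\<close>

lemma compact_image_of_compact_real:
  fixes Z :: "'t::{t2_space, second_countable_topology} set"
  assumes Z: "compact Z"
  obtains K :: "real set" and \<pi> :: "real \<Rightarrow> 't"
  where "compact K" "continuous_on K \<pi>" "\<pi> ` K = Z"
proof -
  obtain BB :: "'t set set" where BB: "countable BB" "topological_basis BB" using ex_countable_basis by blast
  have "BB \<noteq> {}" using BB(2) unfolding topological_basis_def by (metis UNIV_I UnionE empty_iff open_UNIV subset_empty)
  then obtain B :: "nat \<Rightarrow> 't set" where B: "range B = BB" using BB(1) by (metis range_from_nat_into)
  define D where "D n b = {t \<in> {0..1::real}. if b then cos (2 * pi * 4 ^ n * t) \<le> - 1 / 2 else 1 / 2 \<le> cos (2 * pi * 4 ^ n * t)}"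
    for n :: nat and b :: bool
  define C where "C n b = (if b then closure (B n) else - B n)" for n b
  \<comment> \<open>The graph of \<pi>. A point on the boundary of \<open>B n\<close> is compatible
    with both values of the n-th digit, so it may be coded by several reals; only surjectivity of
    \<pi> is wanted.\<close>
  define \<Gamma> where "\<Gamma> = (\<Inter>n. \<Union>b. D n b \<times> C n b) \<inter> ({0..1} \<times> Z)"
  have D_closed: "closed (D n b)" for n b
  proof -
    have "closed ({0..1::real} \<inter> {t. cos (2 * pi * 4 ^ n * t) \<le> - 1 / 2})"
      "closed ({0..1::real} \<inter> {t. 1 / 2 \<le> cos (2 * pi * 4 ^ n * t)})"
      by (intro closed_Int closed_Collect_le continuous_intros closed_atLeastAtMost)+
    then show ?thesis unfolding D_def by (cases b) (simp_all add: Int_def)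
  qed
  have openB: "open (B n)" for n using B BB(2) topological_basis_open by blast
  have "closed (\<Union>b. D n b \<times> C n b)" for n
    by (intro closed_UN closed_Times D_closed ballI) (use openB in \<open>simp_all add: C_def closed_Compl\<close>)
  then have \<Gamma>c: "compact \<Gamma>" unfolding \<Gamma>_def
    by (intro closed_Int_compact closed_INT compact_Times Z compact_Icc) auto
  \<comment> \<open>Disjoint neighbourhoods of z and z' provide a basic set around z whose closure
    misses z', so that neither value of the n-th digit of t suits both points.\<close>
  have uniq: "z = z'" if "(t, z) \<in> \<Gamma>" "(t, z') \<in> \<Gamma>" for t z z'
  proof (rule ccontr)
    assume "z \<noteq> z'"
    then obtain U V where UV: "open U" "open V" "z \<in> U" "z' \<in> V" "U \<inter> V = {}" by (meson hausdorff)
    obtain n where n: "z \<in> B n" "B n \<subseteq> U" using topological_basisE[OF BB(2) UV(1,3)] B by (metis rangeE)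
    have "z' \<notin> closure (B n)" using UV n by (metis disjoint_iff closure_iff_nhds_not_empty order_trans subset_iff)
    moreover have "z \<in> C n b \<and> z' \<in> C n b" if "t \<in> D n b" for b
      using \<open>(t, z) \<in> \<Gamma>\<close> \<open>(t, z') \<in> \<Gamma>\<close> that unfolding \<Gamma>_def D_def by (cases b) (force split: if_splits)+
    moreover have "\<exists>b. t \<in> D n b" using \<open>(t, z) \<in> \<Gamma>\<close> unfolding \<Gamma>_def by blast
    ultimately show False using n(1) unfolding C_def by (metis ComplD)
  qed
  have ex: "\<exists>t. (t, z) \<in> \<Gamma>" if "z \<in> Z" for z
  proof -
    obtain t where t: "t \<in> {0..1}" "\<And>n. if z \<in> B n then cos (2 * pi * 4 ^ n * t) \<le> - 1 / 2 else 1 / 2 \<le> cos (2 * pi * 4 ^ n * t)"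
      using exists_real_with_digits[of "\<lambda>n. z \<in> B n"] by blast
    have "t \<in> D n (z \<in> B n)" "z \<in> C n (z \<in> B n)" for n
      using t(1) t(2)[of n] closure_subset[of "B n"] unfolding D_def C_def by auto
    then show ?thesis using t(1) that unfolding \<Gamma>_def by blast
  qed
  define K where "K = fst ` \<Gamma>"
  define \<pi> where "\<pi> t = (THE z. (t, z) \<in> \<Gamma>)" for t
  have \<pi>: "(t, \<pi> t) \<in> \<Gamma>" if "t \<in> K" for t
  proof -
    from that obtain p where "p \<in> \<Gamma>" "t = fst p" unfolding K_def by blast
    then have p: "(t, snd p) \<in> \<Gamma>" by simp
    show ?thesis unfolding \<pi>_def by (rule theI[where P = "\<lambda>z. (t, z) \<in> \<Gamma>", OF p]) (rule uniq[OF _ p])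
  qed
  have \<pi>eq: "\<pi> t = z" if "(t, z) \<in> \<Gamma>" for t z
    unfolding \<pi>_def by (rule the_equality[where P = "\<lambda>z. (t, z) \<in> \<Gamma>", OF that]) (rule uniq[OF _ that])
  show thesis
  proof
    show "compact K" unfolding K_def by (intro compact_continuous_image \<Gamma>c continuous_intros)
    show "\<pi> ` K = Z"
    proof
      show "\<pi> ` K \<subseteq> Z" using \<pi> unfolding \<Gamma>_def by blast
      show "Z \<subseteq> \<pi> ` K"
      proof
        fix z assume "z \<in> Z"
        then obtain t where t: "(t, z) \<in> \<Gamma>" using ex by blast
        then have "t \<in> K" unfolding K_def by (rule rev_image_eqI) simp
        then show "z \<in> \<pi> ` K" using \<pi>eq[OF t] by blast
      qed
    qed
    \<comment> \<open>\<Gamma> is compact and projects injectively onto \<open>K\<close>, so the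
      inverse of the projection is continuous, and \<pi> is its second component.\<close>
    have "continuous_on K (\<lambda>t. the_inv_into \<Gamma> fst t)"
      unfolding K_def by (rule continuous_on_inv_into[OF _ \<Gamma>c])
        (auto intro!: inj_onI continuous_intros dest: uniq)
    then have "continuous_on K (\<lambda>t. snd (the_inv_into \<Gamma> fst t))" by (intro continuous_intros)
    moreover have "snd (the_inv_into \<Gamma> fst t) = \<pi> t" if "t \<in> K" for t
    proof -
      have inj: "inj_on fst \<Gamma>" by (auto intro!: inj_onI dest: uniq)
      have "(t, \<pi> t) \<in> \<Gamma>" using \<pi> that by blast
      from the_inv_into_f_f[OF inj this] show ?thesis by simp
    qed
    ultimately show "continuous_on K \<pi>" by (simp cong: continuous_on_cong)
  qed
qed

lemma Hausdorff_space_euclidean_t2: "Hausdorff_space (euclidean :: 't::t2_space topology)"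
  unfolding Hausdorff_space_def
proof (intro allI impI)
  fix x y :: 't
  assume "x \<in> topspace euclidean \<and> y \<in> topspace euclidean \<and> x \<noteq> y"
  then obtain U V where "open U" "open V" "x \<in> U" "y \<in> V" "U \<inter> V = {}" using hausdorff[of x y] by auto
  then show "\<exists>U V. openin euclidean U \<and> openin euclidean V \<and> x \<in> U \<and> y \<in> V \<and> disjnt U V"
    by (intro exI[of _ U] exI[of _ V]) (simp add: disjnt_def flip: open_openin)
qed

text \<open>Closed sets generate the Borel sets, so it suffices to approximate the indicator of a
  closed \<open>C\<close> on \<open>Z\<close> by continuous functions. Without a metric, products of
  factors 1 - u i serve the purpose, where u i vanishes on \<open>C\<close> and equals 1 on the
  closure of the i-th basic set whenever that closure misses \<open>C\<close> inside
  \<open>Z\<close>. Each point of \<open>Z\<close> outside \<open>C\<close> lies in such a basic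
  set, so the products eventually vanish there.\<close>

lemma prob_eqI_compact:
  fixes Z :: "'t::{t2_space, second_countable_topology} set"
  assumes Z: "compact Z"
    and \<mu>: "prob_space \<mu>" "sets \<mu> = sets borel" "AE z in \<mu>. z \<in> Z"
    and \<nu>: "prob_space \<nu>" "sets \<nu> = sets borel" "AE z in \<nu>. z \<in> Z"
    and eq: "\<And>u :: 't \<Rightarrow> real. continuous_on Z u \<Longrightarrow>
      (\<integral>z. indicator Z z *\<^sub>R u z \<partial>\<mu>) = (\<integral>z. indicator Z z *\<^sub>R u z \<partial>\<nu>)"
  shows "\<mu> = \<nu>"
proof -
  interpret \<mu>: prob_space \<mu> by fact
  interpret \<nu>: prob_space \<nu> by fact
  have Zc: "closed Z" by (rule compact_imp_closed[OF Z])
  have nX: "normal_space (top_of_set Z)"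
    using compact_Hausdorff_or_regular_imp_normal_space compact_space_subtopology
      Hausdorff_space_subtopology Hausdorff_space_euclidean_t2 Z compactin_euclidean_iff by blast
  obtain BB :: "'t set set" where BB: "countable BB" "topological_basis BB" using ex_countable_basis by blast
  have "BB \<noteq> {}" using BB(2) unfolding topological_basis_def by (metis UNIV_I UnionE empty_iff open_UNIV subset_empty)
  then obtain B :: "nat \<Rightarrow> 't set" where B: "range B = BB" using BB(1) by (metis range_from_nat_into)
  have main: "measure \<mu> C = measure \<nu> C" if C: "closed C" for C
  proof -
    have "\<exists>u. continuous_on Z u \<and> (\<forall>z\<in>Z. u z \<in> {0..1::real}) \<and> (\<forall>z\<in>Z \<inter> C. u z = 0) \<and>
        (closure (B n) \<inter> C \<inter> Z = {} \<longrightarrow> (\<forall>z\<in>Z \<inter> closure (B n). u z = 1))" for n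
    proof (cases "closure (B n) \<inter> C \<inter> Z = {}")
      case True
      obtain u where "continuous_map (top_of_set Z) (top_of_set {0..1::real}) u"
        "u ` (Z \<inter> C) \<subseteq> {0}" "u ` (Z \<inter> closure (B n)) \<subseteq> {1}"
        by (rule Urysohn_lemma[OF nX, of "Z \<inter> C" "Z \<inter> closure (B n)" 0 1])
          (use C True in \<open>auto simp: disjnt_def closedin_closed_Int\<close>)
      then show ?thesis by (intro exI[of _ u]) (auto simp: continuous_map_in_subtopology)
    qed (auto intro!: exI[of _ "\<lambda>_. 0"])
    then obtain u where u: "\<And>n. continuous_on Z (u n)" "\<And>n z. z \<in> Z \<Longrightarrow> 0 \<le> u n z \<and> u n z \<le> (1::real)"
      "\<And>n z. z \<in> Z \<Longrightarrow> z \<in> C \<Longrightarrow> u n z = 0"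
      "\<And>n z. closure (B n) \<inter> C \<inter> Z = {} \<Longrightarrow> z \<in> Z \<Longrightarrow> z \<in> closure (B n) \<Longrightarrow> u n z = 1"
      by (metis (no_types, lifting) IntI atLeastAtMost_iff)
    define h where "h m z = (\<Prod>i<m. 1 - u i z)" for m :: nat and z
    have hc: "continuous_on Z (h m)" for m unfolding h_def by (intro continuous_intros u)
    have hb: "0 \<le> h m z \<and> h m z \<le> 1" if "z \<in> Z" for m z
      unfolding h_def using u(2)[OF that] by (auto intro!: prod_nonneg prod_le_1)
    have lim: "(\<lambda>m. indicator Z z *\<^sub>R h m z) \<longlonglongrightarrow> indicator (Z \<inter> C) z" for z
    proof (cases "z \<in> Z - C")
      case False
      then have "indicator Z z *\<^sub>R h m z = indicator (Z \<inter> C) z" for m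
        using u(3) unfolding h_def by (cases "z \<in> Z") auto
      then show ?thesis by simp
    next
      case True
      have "compact (Z \<inter> C)" using Z C by (simp add: compact_Int_closed)
      then obtain U V where UV: "open U" "open V" "z \<in> U" "Z \<inter> C \<subseteq> V" "U \<inter> V = {}"
        using Hausdorff_space_compact_separation[OF Hausdorff_space_euclidean_t2, of "{z}" "Z \<inter> C"] True
        by (auto simp: disjnt_def open_openin[symmetric])
      obtain n where n: "z \<in> B n" "B n \<subseteq> U" using topological_basisE[OF BB(2) UV(1,3)] B by (metis rangeE)
      have "closure (B n) \<subseteq> - V" using UV n by (intro closure_minimal) (auto simp: closed_Compl)
      then have "closure (B n) \<inter> C \<inter> Z = {}" using UV by blast
      then have "u n z = 1" using u(4) True n(1) closure_subset by blast
      then have "h m z = 0" if "m > n" for m unfolding h_def using that by (intro prod_zero) auto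
      then have "\<forall>\<^sub>F m in sequentially. indicator Z z *\<^sub>R h m z = indicator (Z \<inter> C) z"
        using True by (intro eventually_sequentiallyI[of "Suc n"]) simp
      then show ?thesis by (rule tendsto_eventually)
    qed
    have conv: "(\<lambda>m. \<integral>z. indicator Z z *\<^sub>R h m z \<partial>\<xi>) \<longlonglongrightarrow> measure \<xi> C"
      if \<xi>: "prob_space \<xi>" "sets \<xi> = sets borel" "AE z in \<xi>. z \<in> Z" for \<xi>
    proof -
      interpret prob_space \<xi> by fact
      have "(\<lambda>m. \<integral>z. indicator Z z *\<^sub>R h m z \<partial>\<xi>) \<longlonglongrightarrow> (\<integral>z. indicator (Z \<inter> C) z \<partial>\<xi>)"
      proof (rule integral_dominated_convergence[where w = "\<lambda>_. 1"])
        show "(\<lambda>z. indicator Z z *\<^sub>R h m z) \<in> borel_measurable \<xi>" for m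
          using borel_measurable_continuous_on_indicator[OF _ hc] Zc \<xi>(2) by (simp cong: measurable_cong_sets)
        show "indicator (Z \<inter> C) \<in> borel_measurable \<xi>" by (subst measurable_cong_sets[OF \<xi>(2) refl]) (intro borel_measurable_indicator borel_closed closed_Int Zc C)
        show "AE z in \<xi>. norm (indicator Z z *\<^sub>R h m z) \<le> 1" for m
          using hb by (intro AE_I2) (auto simp: indicator_def)
      qed (use lim in auto)
      also have "(\<integral>z. indicator (Z \<inter> C) z \<partial>\<xi>) = measure \<xi> (Z \<inter> C)"
        using sets_eq_imp_space_eq[OF \<xi>(2)] by simp
      also have "measure \<xi> (Z \<inter> C) = measure \<xi> C"
        using \<xi>(3) by (intro measure_eq_AE) (use Zc C in \<open>auto simp: \<xi>(2)\<close>)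
      finally show ?thesis .
    qed
    show ?thesis using LIMSEQ_unique[OF conv[OF \<mu>]] conv[OF \<nu>] eq[OF hc] by simp
  qed
  show ?thesis
  proof (rule measure_eqI_generator_eq[where E = "{C. closed C}" and \<Omega> = UNIV and A = "\<lambda>_. UNIV"])
    show "Int_stable {C :: 't set. closed C}" by (auto intro!: Int_stableI)
    show "sets \<mu> = sigma_sets UNIV {C. closed C}" "sets \<nu> = sigma_sets UNIV {C. closed C}"
      unfolding \<mu>(2) \<nu>(2) borel_eq_closed by (simp_all add: sets_measure_of)
    show "emeasure \<mu> C = emeasure \<nu> C" if "C \<in> {C. closed C}" for C
      using main that by (simp add: \<mu>.emeasure_eq_measure \<nu>.emeasure_eq_measure)
  qed (auto simp: \<mu>.emeasure_eq_measure)
qed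

text \<open>The orbit segments are lifted to the real line along a continuous surjection from a compact
  set of reals, where Helly's selection theorem provides the limit measure.\<close>

lemma exists_limit_measure:
  fixes Z :: "'t::{t2_space, second_countable_topology} set"
  assumes Z: "compact Z" and p: "\<And>n k. p n k \<in> Z"
  shows "\<exists>\<nu> (r :: nat \<Rightarrow> nat). prob_space \<nu> \<and> sets \<nu> = sets borel \<and> strict_mono r \<and>
    (\<forall>u :: 't \<Rightarrow> real. continuous_on Z u \<longrightarrow>
       (\<lambda>j. (\<Sum>k\<le>r j. u (p (r j) k)) / real (Suc (r j))) \<longlonglongrightarrow> (\<integral>z. indicator Z z *\<^sub>R u z \<partial>\<nu>)) \<and>
    (\<forall>D. closed D \<longrightarrow> (\<forall>n k. p n k \<in> D) \<longrightarrow> (AE z in \<nu>. z \<in> D))"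
proof -
  obtain K :: "real set" and \<pi> :: "real \<Rightarrow> 't" where K: "compact K" "continuous_on K \<pi>" "\<pi> ` K = Z"
    using compact_image_of_compact_real[OF Z] .
  have Kc: "closed K" by (rule compact_imp_closed[OF K(1)])
  define t where "t n k = inv_into K \<pi> (p n k)" for n k
  have t: "t n k \<in> K" "\<pi> (t n k) = p n k" for n k
    unfolding t_def using p[of n k] by (simp_all add: inv_into_into f_inv_into_f K(3))
  define \<mu> where "\<mu> n = distr (measure_pmf (pmf_of_set {..n})) borel (t n)" for n
  have \<mu>d: "real_distribution (\<mu> n)" for n
    unfolding \<mu>_def by (rule prob_space.real_distribution_distr[OF prob_space_measure_pmf]) simp
  have \<mu>int: "integral\<^sup>L (\<mu> n) u = (\<Sum>k\<le>n. u (t n k)) / real (Suc n)"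
    if "u \<in> borel_measurable borel" for n and u :: "real \<Rightarrow> real"
    unfolding \<mu>_def using that by (subst integral_distr) (auto simp: integral_pmf_of_set)
  have "tight \<mu>" unfolding tight_def
  proof (intro conjI allI impI \<mu>d)
    fix \<epsilon> :: real assume "\<epsilon> > 0"
    obtain b where b: "\<And>x. x \<in> K \<Longrightarrow> \<bar>x\<bar> \<le> b" "b > 0"
      using compact_imp_bounded[OF K(1)] unfolding bounded_pos by auto
    \<comment> \<open>All lifted points lie in the bounded set \<open>K\<close>. The interval is
      open on the left, hence \<open>- b - 1\<close> instead of \<open>- b\<close>.\<close>
    have "measure (\<mu> n) {- b - 1<..b} = 1" for n
    proof -
      have "- b - 1 < t n k \<and> t n k \<le> b" for k using b(1)[OF t(1)[of n k]] by auto
      then have "t n -` {- b - 1<..b} = UNIV" by auto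
      then show ?thesis unfolding \<mu>_def by (subst measure_distr) simp_all
    qed
    then show "\<exists>a b. a < b \<and> (\<forall>n. 1 - \<epsilon> < measure (\<mu> n) {a<..b})"
      using \<open>\<epsilon> > 0\<close> b(2) by (intro exI[of _ "- b - 1"] exI[of _ b]) auto
  qed
  from tight_imp_convergent_subsubsequence[OF this strict_mono_id]
  obtain r M where r: "strict_mono (r :: nat \<Rightarrow> nat)" and M: "real_distribution M" and w: "weak_conv_m (\<mu> \<circ> id \<circ> r) M"
    by blast
  interpret M: real_distribution M by (rule M)
  have lim: "(\<lambda>j. (\<Sum>k\<le>r j. u (t (r j) k)) / real (Suc (r j))) \<longlonglongrightarrow> integral\<^sup>L M u"
    if "continuous_on UNIV u" "\<And>x. \<bar>u x\<bar> \<le> b" for u :: "real \<Rightarrow> real" and b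
  proof -
    have "(\<lambda>j. integral\<^sup>L ((\<mu> \<circ> id \<circ> r) j) u) \<longlonglongrightarrow> integral\<^sup>L M u"
      using weak_conv_imp_integral_bdd_continuous_conv[OF _ M w, of u b] \<mu>d that
      by (auto simp: continuous_on_eq_continuous_at)
    then show ?thesis using \<mu>int borel_measurable_continuous_onI[OF that(1)] by simp
  qed
  have supp: "AE x in M. x \<in> S" if S: "closed S" "\<And>n k. t n k \<in> S" for S
  proof -
    have Sne: "S \<noteq> {}" using S(2) by blast
    \<comment> \<open>A bounded continuous test function that vanishes exactly on the closed set
      \<open>S\<close>. It is zero at every lifted point, so its integral against the limit is zero
      as well.\<close>
    define u where "u x = min 1 (infdist x S)" for x
    have uc: "continuous_on UNIV u" unfolding u_def by (intro continuous_intros)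
    have ub: "\<bar>u x\<bar> \<le> 1" "0 \<le> u x" for x unfolding u_def using infdist_nonneg[of x S] by auto
    have "u (t n k) = 0" for n k unfolding u_def using S(2) by simp
    then have "integral\<^sup>L M u = 0" using lim[OF uc ub(1)] by (simp add: LIMSEQ_const_iff)
    moreover have "integrable M u"
      using ub borel_measurable_continuous_onI[OF uc] by (auto intro!: M.integrable_const_bound[where B=1])
    ultimately have "AE x in M. u x = 0"
      using integral_nonneg_eq_0_iff_AE[of M u] ub by simp
    then show ?thesis
    proof eventually_elim
      case (elim x)
      then have "infdist x S = 0" unfolding u_def by (auto simp: min_def split: if_splits)
      then show ?case using in_closed_iff_infdist_zero[OF S(1) Sne] by blast
    qed
  qed
  \<comment> \<open>A Borel extension of \<pi> to the whole line. \<open>M\<close> is carried by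
    \<open>K\<close>, so the value chosen off \<open>K\<close> does not affect \<nu>.\<close>
  define P where "P x = (if x \<in> K then \<pi> x else p 0 0)" for x
  have P[measurable]: "P \<in> borel_measurable borel"
    unfolding P_def using Kc K(2) by (intro borel_measurable_continuous_on_if) auto
  have Pt: "P (t n k) = p n k" for n k using t unfolding P_def by simp
  define \<nu> where "\<nu> = distr M borel P"
  show ?thesis
  proof (intro exI[of _ \<nu>] exI[of _ r] conjI allI impI)
    show "prob_space \<nu>" unfolding \<nu>_def by (rule M.prob_space_distr) simp
    show "sets \<nu> = sets borel" unfolding \<nu>_def by simp
    show "AE z in \<nu>. z \<in> D" if D: "closed D" "\<forall>n k. p n k \<in> D" for D
    proof -
      have "closed (K \<inter> \<pi> -` D)" using continuous_closed_preimage[OF K(2) Kc D(1)] .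
      then have "AE x in M. x \<in> K \<inter> \<pi> -` D" by (rule supp) (use t D in auto)
      then have "AE x in M. P x \<in> D" by eventually_elim (simp add: P_def)
      then show ?thesis unfolding \<nu>_def using D(1) by (subst AE_distr_iff) auto
    qed
    fix u :: "'t \<Rightarrow> real" assume u: "continuous_on Z u"
    obtain b where b: "\<And>z. z \<in> Z \<Longrightarrow> \<bar>u z\<bar> \<le> b" "b > 0"
      using compact_imp_bounded[OF compact_continuous_image[OF u Z]] unfolding bounded_pos by auto
    have "continuous_on K (u \<circ> \<pi>)" using continuous_on_compose[OF K(2)] u K(3) by simp
    then obtain v where v: "continuous_on UNIV v" "\<And>x. x \<in> K \<Longrightarrow> v x = u (\<pi> x)" "\<And>x. \<bar>v x\<bar> \<le> b"
      using Tietze[of K "u \<circ> \<pi>" UNIV b] Kc b K(3) by (auto simp: closed_closedin[symmetric])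
    have "(\<integral>z. indicator Z z *\<^sub>R u z \<partial>\<nu>) = (\<integral>x. indicator Z (P x) *\<^sub>R u (P x) \<partial>M)"
      unfolding \<nu>_def by (rule integral_distr)
        (use borel_measurable_continuous_on_indicator[OF _ u] compact_imp_closed[OF Z] in auto)
    also have "\<dots> = integral\<^sup>L M v"
    proof (rule integral_cong_AE)
      have "(\<lambda>z. indicator Z z *\<^sub>R u z) \<in> borel_measurable borel"
        using borel_measurable_continuous_on_indicator[OF _ u] compact_imp_closed[OF Z] by auto
      from measurable_compose[OF P this]
      show "(\<lambda>x. indicator Z (P x) *\<^sub>R u (P x)) \<in> borel_measurable M" by simp
      show "v \<in> borel_measurable M" using borel_measurable_continuous_onI[OF v(1)] by simp
      show "AE x in M. indicator Z (P x) *\<^sub>R u (P x) = v x"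
        using supp[OF Kc t(1)] by eventually_elim (use K(3) v(2) in \<open>auto simp: P_def\<close>)
    qed
    finally have i: "(\<integral>z. indicator Z z *\<^sub>R u z \<partial>\<nu>) = integral\<^sup>L M v" .
    have "v (t n k) = u (p n k)" for n k using v(2) t by simp
    then show "(\<lambda>j. (\<Sum>k\<le>r j. u (p (r j) k)) / real (Suc (r j))) \<longlonglongrightarrow> (\<integral>z. indicator Z z *\<^sub>R u z \<partial>\<nu>)"
      using lim[OF v(1,3)] i by simp
  qed (rule r)
qed

text \<open>The averages run over segments of different orbits, yet along each segment the averages
  of u and of u after F differ only by two end terms, of order 1/n, so the limit is invariant. In
  the same way a bound \<open>C\<close> on the sums of \<phi> becomes C/n and disappears in the
  limit. F is continued by the identity off \<open>Z\<close> to obtain a map defined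
  everywhere.\<close>

lemma krylov_bogoliubov:
  fixes Z :: "'t::{t2_space, second_countable_topology} set"
  assumes Z: "compact Z" and F: "continuous_on Z F" "F ` Z \<subseteq> Z" and y: "\<And>n. y n \<in> Z"
    and \<phi>: "continuous_on Z (\<phi> :: 't \<Rightarrow> real)"
    and C: "\<And>n. (\<Sum>k<n. \<phi> ((F ^^ k) (y n))) \<le> C"
  shows "\<exists>\<nu>. prob_space \<nu> \<and> sets \<nu> = sets borel \<and> distr \<nu> borel (\<lambda>z. if z \<in> Z then F z else z) = \<nu> \<and>
    (\<forall>D. closed D \<longrightarrow> (\<forall>n k. (F ^^ k) (y n) \<in> D) \<longrightarrow> (AE z in \<nu>. z \<in> D)) \<and>
    (\<integral>z. indicator Z z *\<^sub>R \<phi> z \<partial>\<nu>) \<le> 0"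
proof -
  have FZ: "(F ^^ k) (y n) \<in> Z" for n k by (induction k) (use y F(2) in auto)
  \<comment> \<open>The n-th average has \<open>Suc n\<close> terms, so its segment starts at
    \<open>y (Suc n)\<close>, the point whose sum of \<open>Suc n\<close> terms is bounded by
    \<open>C\<close>.\<close>
  define p where "p n k = (F ^^ k) (y (Suc n))" for n k
  have p: "p n k \<in> Z" for n k unfolding p_def by (rule FZ)
  obtain \<nu> and r :: "nat \<Rightarrow> nat" where \<nu>: "prob_space \<nu>" "sets \<nu> = sets borel" and r: "strict_mono r"
    and lim': "\<forall>u :: 't \<Rightarrow> real. continuous_on Z u \<longrightarrow>
       (\<lambda>j. (\<Sum>k\<le>r j. u (p (r j) k)) / real (Suc (r j))) \<longlonglongrightarrow> (\<integral>z. indicator Z z *\<^sub>R u z \<partial>\<nu>)"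
    and D': "\<forall>D. closed D \<longrightarrow> (\<forall>n k. p n k \<in> D) \<longrightarrow> (AE z in \<nu>. z \<in> D)"
    using exists_limit_measure[of Z p, OF Z p] by (elim exE conjE)
  note lim = lim'[rule_format] and D = D'[rule_format]
  interpret \<nu>: prob_space \<nu> by fact
  define G where "G z = (if z \<in> Z then F z else z)" for z
  have Zc: "closed Z" by (rule compact_imp_closed[OF Z])
  have [measurable]: "G \<in> borel_measurable borel"
    unfolding G_def using Zc F by (intro borel_measurable_continuous_on_if continuous_intros) auto
  have Gm: "G \<in> measurable \<nu> borel" using \<nu>(2) by (simp cong: measurable_cong_sets)
  have \<nu>Z: "AE z in \<nu>. z \<in> Z" by (rule D[OF Zc p])
  have inverse0: "(\<lambda>j. c / real (Suc (r j))) \<longlonglongrightarrow> 0" for c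
    using LIMSEQ_subseq_LIMSEQ[OF LIMSEQ_Suc[OF lim_const_over_n[of c]] r] by (simp add: comp_def)
  have "distr \<nu> borel G = \<nu>"
  proof (rule prob_eqI_compact[OF Z _ _ _ \<nu> \<nu>Z])
    show "prob_space (distr \<nu> borel G)" by (rule \<nu>.prob_space_distr[OF Gm])
    show "AE z in distr \<nu> borel G. z \<in> Z"
      using \<nu>Z Zc F(2) by (subst AE_distr_iff[OF Gm]) (auto simp: G_def)
    fix u :: "'t \<Rightarrow> real" assume u: "continuous_on Z u"
    then have uF: "continuous_on Z (\<lambda>z. u (F z))"
      using continuous_on_compose2[OF u F(1)] F(2) by simp
    obtain b where b: "\<And>z. z \<in> Z \<Longrightarrow> \<bar>u z\<bar> \<le> b"
      using compact_imp_bounded[OF compact_continuous_image[OF u Z]] unfolding bounded_iff by auto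
    have um: "(\<lambda>z. indicator Z z *\<^sub>R u z) \<in> borel_measurable borel"
      using borel_measurable_continuous_on_indicator[OF _ u] Zc by auto
    have "(\<integral>z. indicator Z z *\<^sub>R u z \<partial>distr \<nu> borel G) = (\<integral>z. indicator Z (G z) *\<^sub>R u (G z) \<partial>\<nu>)"
      by (rule integral_distr[OF Gm um])
    also have "\<dots> = (\<integral>z. indicator Z z *\<^sub>R u (F z) \<partial>\<nu>)"
      by (rule Bochner_Integration.integral_cong) (use F(2) in \<open>auto simp: G_def indicator_def\<close>)
    also have "\<dots> = (\<integral>z. indicator Z z *\<^sub>R u z \<partial>\<nu>)"
    proof -
      have "(\<lambda>j. (\<Sum>k\<le>r j. u (F (p (r j) k))) / real (Suc (r j)) - (\<Sum>k\<le>r j. u (p (r j) k)) / real (Suc (r j)))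
          \<longlonglongrightarrow> (\<integral>z. indicator Z z *\<^sub>R u (F z) \<partial>\<nu>) - (\<integral>z. indicator Z z *\<^sub>R u z \<partial>\<nu>)"
        by (intro tendsto_diff lim u uF)
      moreover have "(\<lambda>j. (\<Sum>k\<le>r j. u (F (p (r j) k))) / real (Suc (r j)) - (\<Sum>k\<le>r j. u (p (r j) k)) / real (Suc (r j)))
          \<longlonglongrightarrow> 0"
      proof (rule Lim_null_comparison[OF _ inverse0[of "2 * b"]])
        show "\<forall>\<^sub>F j in sequentially. norm ((\<Sum>k\<le>r j. u (F (p (r j) k))) / real (Suc (r j)) - (\<Sum>k\<le>r j. u (p (r j) k)) / real (Suc (r j)))
            \<le> 2 * b / real (Suc (r j))"
        proof (rule always_eventually, rule allI)
          fix j
          have "(\<Sum>k\<le>n. u (F (p (r j) k))) - (\<Sum>k\<le>n. u (p (r j) k)) = u (p (r j) (Suc n)) - u (p (r j) 0)" for n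
            by (induction n) (auto simp: p_def)
          then have "\<bar>(\<Sum>k\<le>r j. u (F (p (r j) k))) - (\<Sum>k\<le>r j. u (p (r j) k))\<bar> \<le> 2 * b"
            using b[OF p[of "r j" "Suc (r j)"]] b[OF p[of "r j" 0]] by auto
          then show "norm ((\<Sum>k\<le>r j. u (F (p (r j) k))) / real (Suc (r j)) - (\<Sum>k\<le>r j. u (p (r j) k)) / real (Suc (r j)))
            \<le> 2 * b / real (Suc (r j))"
            unfolding diff_divide_distrib[symmetric] real_norm_def abs_divide by (simp add: divide_right_mono)
        qed
      qed
      ultimately have "(\<integral>z. indicator Z z *\<^sub>R u (F z) \<partial>\<nu>) - (\<integral>z. indicator Z z *\<^sub>R u z \<partial>\<nu>) = 0"
        by (rule LIMSEQ_unique)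
      then show ?thesis by simp
    qed
    finally show "(\<integral>z. indicator Z z *\<^sub>R u z \<partial>distr \<nu> borel G) = (\<integral>z. indicator Z z *\<^sub>R u z \<partial>\<nu>)" .
  qed simp
  moreover have "(\<integral>z. indicator Z z *\<^sub>R \<phi> z \<partial>\<nu>) \<le> 0"
  proof (rule LIMSEQ_le[OF lim[OF \<phi>] inverse0[of C]])
    show "\<exists>N. \<forall>j\<ge>N. (\<Sum>k\<le>r j. \<phi> (p (r j) k)) / real (Suc (r j)) \<le> C / real (Suc (r j))"
      using C[of "Suc (r j)" for j] unfolding p_def lessThan_Suc_atMost
      by (intro exI[of _ 0] allI impI divide_right_mono) auto
  qed
  moreover have "AE z in \<nu>. z \<in> C" if "closed C" "\<forall>n k. (F ^^ k) (y n) \<in> C" for C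
    by (rule D[OF that(1)]) (use that(2) in \<open>simp add: p_def\<close>)
  ultimately show ?thesis using \<nu> unfolding G_def by (intro exI[of _ \<nu>] conjI) auto
qed

text \<open>If every n failed, each n would have its own point of \<open>D\<close> with a small n-th
  sum, and these segments yield an invariant \<nu> on the closure of \<open>D\<close> with
  nonpositive integral of \<phi>. The null sets of the hypothesis live in the base: \<open>q\<close>
  carries \<nu> to an f-invariant measure, and since the hypothesis speaks of all points of a fibre
  at once, it pulls back to \<nu>-almost every point, where it forces a positive integral.\<close>

lemma birkhoff_sums_exceed_bound:
  fixes Z :: "'t::{t2_space, second_countable_topology} set"
    and f :: "'m::{t2_space, second_countable_topology} \<Rightarrow> 'm"
  assumes Z: "compact Z" and F: "continuous_on Z F" "F ` Z \<subseteq> Z"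
    and q: "continuous_on Z q" and f: "continuous_on UNIV f" and qF: "\<And>z. z \<in> Z \<Longrightarrow> q (F z) = f (q z)"
    and \<phi>: "continuous_on Z (\<phi> :: 't \<Rightarrow> real)"
    and h: "(\<lambda>z. indicator Z z *\<^sub>R h z :: real) \<in> borel_measurable borel"
    and D: "D \<subseteq> Z" "F ` D \<subseteq> D"
    and AE: "\<And>\<mu>. \<mu> \<in> invariant_measures f \<Longrightarrow> AE x in \<mu>. \<forall>z\<in>Z \<inter> closure D. q z = x \<longrightarrow>
      (\<exists>\<epsilon>>0. \<forall>\<^sub>F n in sequentially. \<epsilon> \<le> (\<Sum>k<n. \<phi> ((F ^^ k) z)) + h ((F ^^ n) z) - h z)"
  shows "\<exists>n. \<forall>z\<in>D. C < (\<Sum>k<n. \<phi> ((F ^^ k) z))"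
proof (rule ccontr)
  assume "\<not> ?thesis"
  then have "\<forall>n. \<exists>z\<in>D. (\<Sum>k<n. \<phi> ((F ^^ k) z)) \<le> C" by (meson not_le)
  then obtain y where y: "\<And>n. y n \<in> D" "\<And>n. (\<Sum>k<n. \<phi> ((F ^^ k) (y n))) \<le> C" by metis
  have yZ: "y n \<in> Z" for n using y(1) D(1) by blast
  have FD: "(F ^^ k) z \<in> D" if "z \<in> D" for k z by (induction k) (use that D(2) in auto)
  have FZ: "(F ^^ k) z \<in> Z" if "z \<in> Z" for k z by (induction k) (use that F(2) in auto)
  have Zc: "closed Z" by (rule compact_imp_closed[OF Z])
  define G where "G = (\<lambda>z. if z \<in> Z then F z else z)"
  obtain \<nu> where \<nu>: "prob_space \<nu>" "sets \<nu> = sets borel" and inv: "distr \<nu> borel G = \<nu>"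
    and supp: "\<forall>E. closed E \<longrightarrow> (\<forall>n k. (F ^^ k) (y n) \<in> E) \<longrightarrow> (AE z in \<nu>. z \<in> E)"
    and int: "(\<integral>z. indicator Z z *\<^sub>R \<phi> z \<partial>\<nu>) \<le> 0"
    using krylov_bogoliubov[of Z F y \<phi> C, OF Z F yZ \<phi> y(2)] unfolding G_def by (elim exE conjE)
  interpret prob_space \<nu> by fact
  have \<nu>Z: "AE z in \<nu>. z \<in> Z" using supp Zc FZ[OF yZ] by simp
  have \<nu>D: "AE z in \<nu>. z \<in> closure D" using supp FD[OF y(1)] closure_subset by (metis closed_closure subsetD)
  have Gb: "G \<in> borel_measurable borel"
    unfolding G_def using Zc F by (intro borel_measurable_continuous_on_if continuous_intros) auto
  then have Gm: "G \<in> measurable \<nu> \<nu>" "G \<in> measurable \<nu> borel" using \<nu>(2) by (simp_all cong: measurable_cong_sets)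
  have "distr \<nu> \<nu> G = distr \<nu> borel G" by (rule distr_cong) (simp_all add: \<nu>(2))
  then have inv': "distr \<nu> \<nu> G = \<nu>" using inv by simp
  have G: "(G ^^ k) z = (F ^^ k) z" if "z \<in> Z" for k z
    by (induction k) (use FZ[OF that] in \<open>auto simp: G_def\<close>)
  define Q where "Q z = (if z \<in> Z then q z else q (y 0))" for z
  have Qb: "Q \<in> borel_measurable borel"
    unfolding Q_def using Zc q by (intro borel_measurable_continuous_on_if) auto
  then have Qm: "Q \<in> measurable \<nu> borel" using \<nu>(2) by (simp cong: measurable_cong_sets)
  have fm: "f \<in> borel_measurable borel" by (rule borel_measurable_continuous_onI[OF f])
  define \<mu> where "\<mu> = distr \<nu> borel Q"
  have "distr \<mu> borel f = distr \<nu> borel (f \<circ> Q)"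
    unfolding \<mu>_def by (rule distr_distr[OF fm Qm])
  also have "\<dots> = distr \<nu> borel (Q \<circ> G)"
  proof (rule distr_cong_AE[OF refl refl])
    show "AE z in \<nu>. (f \<circ> Q) z = (Q \<circ> G) z"
      using \<nu>Z by eventually_elim (use qF F(2) in \<open>auto simp: Q_def G_def\<close>)
    show "f \<circ> Q \<in> measurable \<nu> borel" by (rule measurable_comp[OF Qm fm])
    show "Q \<circ> G \<in> measurable \<nu> borel" by (rule measurable_comp[OF Gm(2) Qb])
  qed
  also have "\<dots> = distr (distr \<nu> borel G) borel Q" by (rule distr_distr[OF Qb Gm(2), symmetric])
  also have "\<dots> = \<mu>" unfolding inv \<mu>_def ..
  finally have "\<mu> \<in> invariant_measures f"
    unfolding invariant_measures_def \<mu>_def using prob_space_distr[OF Qm] by simp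
  from AE[OF this] have "AE z in \<nu>. \<forall>z'\<in>Z \<inter> closure D. q z' = Q z \<longrightarrow>
      (\<exists>\<epsilon>>0. \<forall>\<^sub>F n in sequentially. \<epsilon> \<le> (\<Sum>k<n. \<phi> ((F ^^ k) z')) + h ((F ^^ n) z') - h z')"
    unfolding \<mu>_def by (rule AE_distrD[OF Qm])
  then have pos: "AE z in \<nu>. \<exists>\<epsilon>>0. \<forall>\<^sub>F n in sequentially.
      \<epsilon> \<le> (\<Sum>k<n. indicator Z ((G ^^ k) z) *\<^sub>R \<phi> ((G ^^ k) z)) + indicator Z ((G ^^ n) z) *\<^sub>R h ((G ^^ n) z) - indicator Z z *\<^sub>R h z"
    using \<nu>Z \<nu>D
  proof eventually_elim
    case (elim z)
    then have "z \<in> Z \<inter> closure D" "q z = Q z" by (auto simp: Q_def)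
    moreover have "indicator Z ((G ^^ k) z) *\<^sub>R u ((G ^^ k) z) = u ((F ^^ k) z)" for k and u :: "'t \<Rightarrow> real"
      using FZ[OF elim(2), of k] G[OF elim(2)] by simp
    ultimately show ?case using elim(1,2) by simp
  qed
  obtain b where b: "\<And>z. z \<in> Z \<Longrightarrow> \<bar>\<phi> z\<bar> \<le> b"
    using compact_imp_bounded[OF compact_continuous_image[OF \<phi> Z]] unfolding bounded_iff by auto
  have b0: "0 \<le> b" using b[OF yZ[of 0]] by linarith
  have "0 < (\<integral>z. indicator Z z *\<^sub>R \<phi> z \<partial>\<nu>)"
  proof (rule integral_pos_if_birkhoff_sums_eventually_pos[OF Gm(1) inv' _ _ _ pos])
    show "(\<lambda>z. indicator Z z *\<^sub>R \<phi> z) \<in> borel_measurable \<nu>"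
      using borel_measurable_continuous_on_indicator[OF _ \<phi>] Zc \<nu>(2) by (simp cong: measurable_cong_sets)
    show "(\<lambda>z. indicator Z z *\<^sub>R h z) \<in> borel_measurable \<nu>"
      using h \<nu>(2) by (simp cong: measurable_cong_sets)
    show "\<bar>indicator Z z *\<^sub>R \<phi> z\<bar> \<le> b" for z using b b0 by (cases "z \<in> Z") auto
  qed
  with int show False by simp
qed


subsection \<open>Linear cocycles over compact spaces\<close>

text \<open>A linear cocycle on a vector bundle over a compact space, in a trivialisation of the bundle by
  possibly discontinuous fibre coordinates. The linear isomorphism \<open>co i x\<close> turns the fibre coordinates
  at \<open>x\<close> into those of the \<open>i\<close>-th chart, in which everything is continuous, and \<open>ic i x\<close> is its inverse;
  \<open>\<rho> i\<close> is a bump function for the \<open>i\<close>-th chart domain \<open>U i\<close>.\<close>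

locale bundle_cocycle =
  fixes k :: nat and U S :: "nat \<Rightarrow> 'm::{t2_space, second_countable_topology} set"
    and \<rho> :: "nat \<Rightarrow> 'm \<Rightarrow> real"
    and co ic :: "nat \<Rightarrow> 'm \<Rightarrow> 'e::euclidean_space \<Rightarrow> 'e"
    and f :: "'m \<Rightarrow> 'm" and B Bi :: "'m \<Rightarrow> 'e \<Rightarrow> 'e"
  assumes compact_UNIV: "compact (UNIV :: 'm set)"
    and open_U: "i < k \<Longrightarrow> open (U i)"
    and closed_S: "i < k \<Longrightarrow> closed (S i)" and S_subset: "i < k \<Longrightarrow> S i \<subseteq> U i"
    and \<rho>_cont: "i < k \<Longrightarrow> continuous_on UNIV (\<rho> i)" and \<rho>_nonneg: "i < k \<Longrightarrow> 0 \<le> \<rho> i x"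
    and \<rho>_supp: "i < k \<Longrightarrow> x \<notin> S i \<Longrightarrow> \<rho> i x = 0" and \<rho>_pos: "\<exists>i<k. 0 < \<rho> i x"
    and f_cont: "continuous_on UNIV f"
    and lin_co: "i < k \<Longrightarrow> x \<in> U i \<Longrightarrow> linear (co i x)"
    and lin_ic: "i < k \<Longrightarrow> x \<in> U i \<Longrightarrow> linear (ic i x)"
    and co_ic: "i < k \<Longrightarrow> x \<in> U i \<Longrightarrow> co i x (ic i x a) = a"
    and ic_co: "i < k \<Longrightarrow> x \<in> U i \<Longrightarrow> ic i x (co i x a) = a"
    and lin_B: "linear (B x)" and lin_Bi: "linear (Bi x)"
    and B_Bi: "B x (Bi x a) = a" and Bi_B: "Bi x (B x a) = a"
    and cont_trans: "i < k \<Longrightarrow> j < k \<Longrightarrow> continuous_on ((U i \<inter> U j) \<times> UNIV) (\<lambda>(x, a). co j x (ic i x a))"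
    and cont_B: "i < k \<Longrightarrow> j < k \<Longrightarrow>
      continuous_on ((U i \<inter> f -` U j) \<times> UNIV) (\<lambda>(x, a). co j (f x) (B x (ic i x a)))"
    and cont_Bi: "i < k \<Longrightarrow> j < k \<Longrightarrow>
      continuous_on ((U i \<inter> f -` U j) \<times> UNIV) (\<lambda>(x, a). co i x (Bi x (ic j (f x) a)))"
begin

section \<open>Fibre norms and the unit sphere bundle\<close>

definition fnorm :: "'m \<Rightarrow> 'e \<Rightarrow> real" where
  "fnorm x a = (\<Sum>i<k. \<rho> i x * norm (co i x a))"

text \<open>The coordinates in all charts at once, each damped by its bump function. This places the
  bundle inside a product space that is Hausdorff and second countable, in a way that is continuous
  in every chart although the fibre coordinates themselves jump.\<close>

definition emb :: "'m \<Rightarrow> 'e \<Rightarrow> nat \<Rightarrow> 'e" where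
  "emb x a = (\<lambda>i. if i < k then \<rho> i x *\<^sub>R co i x a else 0)"

definition V :: "nat \<Rightarrow> 'm set" where "V i = {x. 0 < \<rho> i x}"

definition usphere :: "('m \<times> (nat \<Rightarrow> 'e)) set" where
  "usphere = {(x, emb x a) | x a. fnorm x a = 1}"

lemma V_subset: "i < k \<Longrightarrow> V i \<subseteq> U i"
  unfolding V_def using \<rho>_supp S_subset by force

lemma open_V: "i < k \<Longrightarrow> open (V i)"
  unfolding V_def by (intro open_Collect_less continuous_intros \<rho>_cont)

lemma V_cover: "\<exists>i<k. x \<in> V i" unfolding V_def using \<rho>_pos by simp

lemma \<rho>_zero_or_U: "i < k \<Longrightarrow> \<rho> i x = 0 \<or> x \<in> U i"
  using \<rho>_supp S_subset by blast

lemma fnorm_emb: "fnorm x a = (\<Sum>i<k. norm (emb x a i))"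
  unfolding fnorm_def emb_def by (intro sum.cong) (auto simp: \<rho>_nonneg)

lemma emb_scaleR: "emb x (r *\<^sub>R a) = (\<lambda>i. r *\<^sub>R emb x a i)"
proof
  fix i
  show "emb x (r *\<^sub>R a) i = r *\<^sub>R emb x a i"
    using \<rho>_zero_or_U[of i x] linear_scale[OF lin_co[of i x], of r a] unfolding emb_def by auto
qed

lemma fnorm_scaleR: "fnorm x (r *\<^sub>R a) = \<bar>r\<bar> * fnorm x a"
  unfolding fnorm_emb emb_scaleR by (simp add: sum_distrib_left)

lemma fnorm_nonneg: "0 \<le> fnorm x a" unfolding fnorm_emb by (intro sum_nonneg) simp

lemma fnorm_triangle: "fnorm x (a + b) \<le> fnorm x a + fnorm x b"
proof -
  have "\<rho> i x * norm (co i x (a + b)) \<le> \<rho> i x * norm (co i x a) + \<rho> i x * norm (co i x b)" if "i < k" for i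
    using \<rho>_zero_or_U[OF that, of x] \<rho>_nonneg[OF that, of x] linear_add[OF lin_co[OF that, of x], of a b]
      norm_triangle_ineq[of "co i x a" "co i x b"]
    by (auto simp flip: distrib_left intro: mult_left_mono)
  then show ?thesis unfolding fnorm_def sum.distrib[symmetric] by (intro sum_mono) simp
qed

lemma fnorm_pos: "a \<noteq> 0 \<Longrightarrow> 0 < fnorm x a"
proof -
  assume a: "a \<noteq> 0"
  obtain i where i: "i < k" "x \<in> V i" using V_cover by blast
  then have xU: "x \<in> U i" using V_subset by blast
  have "co i x a \<noteq> 0" using ic_co[OF i(1) xU, of a] linear_0[OF lin_ic[OF i(1) xU]] a by auto
  then have "0 < \<rho> i x * norm (co i x a)" using i(2) unfolding V_def by simp
  also have "\<dots> \<le> fnorm x a" unfolding fnorm_def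
    by (rule member_le_sum) (use i \<rho>_nonneg in auto)
  finally show ?thesis .
qed

lemma fnorm_0: "fnorm x 0 = 0" using fnorm_scaleR[of x 0 0] by simp

lemma fnorm_eq_0_iff: "fnorm x a = 0 \<longleftrightarrow> a = 0" using fnorm_pos[of a x] fnorm_0 by (cases "a = 0") auto

text \<open>A left inverse of \<open>emb\<close>. On the image of \<open>emb\<close> the choice of
  the chart is immaterial by \<open>ic_emb\<close>, so continuity can be checked in any chart at the
  point.\<close>

definition dec :: "'m \<times> (nat \<Rightarrow> 'e) \<Rightarrow> 'e" where
  "dec z = (let i = SOME i. i < k \<and> fst z \<in> V i in ic i (fst z) (snd z i /\<^sub>R \<rho> i (fst z)))"

lemma ic_emb: "i < k \<Longrightarrow> x \<in> V i \<Longrightarrow> ic i x (emb x a i /\<^sub>R \<rho> i x) = a"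
  using V_subset[of i] ic_co[of i x a] unfolding emb_def V_def by auto

lemma dec_emb: "dec (x, emb x a) = a"
proof -
  define i where "i = (SOME i. i < k \<and> x \<in> V i)"
  have "i < k \<and> x \<in> V i" unfolding i_def by (rule someI_ex[OF V_cover])
  then show ?thesis using ic_emb[of i x a] unfolding dec_def fst_conv snd_conv i_def[symmetric] by simp
qed

lemma usphere_cases:
  assumes "z \<in> usphere"
  obtains x a where "z = (x, emb x a)" "fnorm x a = 1" "a \<noteq> 0" "dec z = a"
proof -
  from assms obtain x a where *: "z = (x, emb x a)" "fnorm x a = 1" unfolding usphere_def by blast
  then have "a \<noteq> 0" using fnorm_0 by auto
  with * show thesis using that dec_emb by simp
qed

text \<open>\<open>H\<close> is controlled only where \<open>h x\<close> lies in \<open>U j\<close>,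
  but off \<open>S j\<close> the bump vanishes. The set \<open>U j\<close> and the complement of
  \<open>S j\<close> are open and cover everything, so the two continuous pieces glue.\<close>

lemma continuous_on_bump:
  fixes H :: "'m \<times> 'e \<Rightarrow> 'e"
  assumes X: "open X" and h: "continuous_on UNIV h" and j: "j < k"
    and H: "continuous_on ((X \<inter> h -` U j) \<times> T) H"
  shows "continuous_on (X \<times> T) (\<lambda>(x, b). \<rho> j (h x) *\<^sub>R H (x, b))"
proof -
  let ?G = "\<lambda>(x, b). \<rho> j (h x) *\<^sub>R H (x, b)"
  have hU: "open (h -` U j)" "open (h -` (- S j))"
    using h open_U[OF j] closed_S[OF j] by (auto simp: continuous_on_open_vimage open_Compl)
  have "continuous_on ((X \<inter> h -` U j) \<times> T) (\<lambda>p. \<rho> j (h (fst p)) *\<^sub>R H p)"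
    using continuous_on_compose2[OF \<rho>_cont[OF j] continuous_on_compose2[OF h continuous_on_fst[OF continuous_on_id]]] H
    by (intro continuous_on_scaleR) (auto simp: id_def)
  then have 1: "continuous_on ((X \<inter> h -` U j) \<times> T) ?G" by (simp add: case_prod_beta')
  have 2: "continuous_on ((X \<inter> h -` (- S j)) \<times> T) ?G"
    by (rule continuous_on_eq[where f = "\<lambda>_. 0"]) (use \<rho>_supp[OF j] in \<open>auto intro: continuous_intros\<close>)
  have eq: "X \<times> T = (X \<inter> h -` U j) \<times> T \<union> (X \<inter> h -` (- S j)) \<times> T"
    using S_subset[OF j] by auto
  have "openin (top_of_set (X \<times> T)) ((X \<inter> h -` Y) \<times> T)" if "open (h -` Y)" for Y
    by (rule openin_Times) (use X that in \<open>auto simp: openin_open_Int openin_open\<close>)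
  from continuous_on_Un_local_open[OF _ _ 1 2] this[OF hU(1)] this[OF hU(2)] show ?thesis
    unfolding eq by blast
qed

lemma continuous_on_emb_comp:
  fixes L :: "'m \<Rightarrow> 'e \<Rightarrow> 'e"
  assumes i: "i < k" and h: "continuous_on UNIV h"
    and L: "\<And>j. j < k \<Longrightarrow> continuous_on ((U i \<inter> h -` U j) \<times> UNIV) (\<lambda>(x, b). co j (h x) (L x b))"
  shows "continuous_on (V i \<times> UNIV) (\<lambda>(x, b). emb (h x) (L x b))"
    and "continuous_on (V i \<times> UNIV) (\<lambda>(x, b). fnorm (h x) (L x b))"
proof -
  have "continuous_on (V i \<times> UNIV) (\<lambda>p. emb (h (fst p)) (L (fst p) (snd p)) j)" for j
  proof (cases "j < k")
    case True
    have "continuous_on ((V i \<inter> h -` U j) \<times> UNIV) (\<lambda>(x, b). co j (h x) (L x b))"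
      by (rule continuous_on_subset[OF L[OF True]]) (use V_subset[OF i] in auto)
    from continuous_on_bump[OF open_V[OF i] h True this]
    show ?thesis unfolding emb_def using True by (simp add: case_prod_beta')
  qed (simp add: emb_def)
  then show 1: "continuous_on (V i \<times> UNIV) (\<lambda>(x, b). emb (h x) (L x b))"
    unfolding case_prod_beta' by (rule continuous_on_coordinatewise_then_product)
  show "continuous_on (V i \<times> UNIV) (\<lambda>(x, b). fnorm (h x) (L x b))"
    using continuous_on_product_then_coordinatewise[OF 1]
    unfolding fnorm_emb case_prod_beta' by (intro continuous_on_sum continuous_on_norm) auto
qed

lemma continuous_on_emb:
  assumes "i < k"
  shows "continuous_on (V i \<times> UNIV) (\<lambda>(x, b). emb x (ic i x b))"
    and continuous_on_fnorm: "continuous_on (V i \<times> UNIV) (\<lambda>(x, b). fnorm x (ic i x b))"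
  using continuous_on_emb_comp[OF assms continuous_on_id, of "ic i"] cont_trans[OF assms] by auto

lemma continuous_on_emb_B:
  assumes "i < k"
  shows "continuous_on (V i \<times> UNIV) (\<lambda>(x, b). emb (f x) (B x (ic i x b)))"
    and continuous_on_fnorm_B: "continuous_on (V i \<times> UNIV) (\<lambda>(x, b). fnorm (f x) (B x (ic i x b)))"
  using continuous_on_emb_comp[OF assms f_cont, of "\<lambda>x b. B x (ic i x b)"] cont_B[OF assms] by auto

text \<open>The base is covered by the compact sets \<open>Sc i\<close> on which the i-th bump is
  the largest one. There \<open>\<rho> i\<close> is bounded away from 0, so unit vectors have
  bounded coordinates in chart i, and the bundle is a finite union of continuous images of compact
  sets.\<close>

lemma compact_usphere: "compact usphere"
proof -
  define Sc where "Sc i = {x. \<forall>j<k. \<rho> j x \<le> \<rho> i x}" for i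
  have ScV: "Sc i \<subseteq> V i" if "i < k" for i
    unfolding Sc_def V_def using \<rho>_pos by (fastforce intro: less_le_trans)
  have Scc: "compact (Sc i)" if "i < k" for i
  proof -
    have "closed (\<Inter>j\<in>{..<k}. {x. \<rho> j x \<le> \<rho> i x})"
      by (intro closed_INT ballI closed_Collect_le \<rho>_cont) (use that in auto)
    moreover have "(\<Inter>j\<in>{..<k}. {x. \<rho> j x \<le> \<rho> i x}) = Sc i" unfolding Sc_def by auto
    ultimately show ?thesis using compact_Int_closed[OF compact_UNIV] by (metis Int_UNIV_left)
  qed
  have Sccov: "\<exists>i<k. x \<in> Sc i" for x
  proof -
    have ne: "finite ((\<lambda>i. \<rho> i x) ` {..<k})" "(\<lambda>i. \<rho> i x) ` {..<k} \<noteq> {}" using \<rho>_pos[of x] by auto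
    from Max_in[OF this] obtain i where "i < k" "\<rho> i x = Max ((\<lambda>i. \<rho> i x) ` {..<k})" by auto
    then show ?thesis unfolding Sc_def using Max_ge[OF ne(1)] by auto
  qed
  define P where "P i = {p \<in> Sc i \<times> UNIV. fnorm (fst p) (ic i (fst p) (snd p)) = 1}" for i
  have Pc: "compact (P i)" if i: "i < k" for i
  proof (cases "Sc i = {}")
    case False
    have "continuous_on (Sc i) (\<rho> i)" using \<rho>_cont[OF i] continuous_on_subset by blast
    from continuous_attains_inf[OF Scc[OF i] False this]
    obtain x0 where x0: "x0 \<in> Sc i" "\<And>x. x \<in> Sc i \<Longrightarrow> \<rho> i x0 \<le> \<rho> i x" by blast
    have d: "0 < \<rho> i x0" using x0(1) ScV[OF i] unfolding V_def by blast
    have bound: "norm b \<le> 1 / \<rho> i x0" if "(x, b) \<in> P i" for x b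
    proof -
      have x: "x \<in> Sc i" "fnorm x (ic i x b) = 1" using that unfolding P_def by auto
      have "x \<in> U i" using x(1) ScV[OF i] V_subset[OF i] by blast
      then have "\<rho> i x * norm b = \<rho> i x * norm (co i x (ic i x b))" using co_ic[OF i] by simp
      also have "\<dots> \<le> fnorm x (ic i x b)" unfolding fnorm_def
        by (rule member_le_sum) (use i \<rho>_nonneg in auto)
      finally have "\<rho> i x0 * norm b \<le> 1"
        using x mult_right_mono[OF x0(2)[OF x(1)], of "norm b"] by simp
      then show ?thesis using d by (simp add: field_simps)
    qed
    define T where "T = Sc i \<times> cball (0::'e) (1 / \<rho> i x0)"
    have T: "compact T" unfolding T_def by (intro compact_Times Scc[OF i] compact_cball)
    have "continuous_on T (\<lambda>p. fnorm (fst p) (ic i (fst p) (snd p)))"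
      using continuous_on_fnorm[OF i] unfolding case_prod_beta'
      by (rule continuous_on_subset) (use ScV[OF i] in \<open>auto simp: T_def\<close>)
    from continuous_closed_preimage[OF this compact_imp_closed[OF T], of "{1}"]
    have "closed (T \<inter> (\<lambda>p. fnorm (fst p) (ic i (fst p) (snd p))) -` {1})" by simp
    moreover have "T \<inter> (\<lambda>p. fnorm (fst p) (ic i (fst p) (snd p))) -` {1} = P i"
      using bound unfolding T_def P_def by auto
    ultimately show ?thesis using compact_Int_closed[OF T] by (metis Int_lower1 inf.orderE inf_commute)
  qed (simp add: P_def)
  have "usphere = (\<Union>i<k. (\<lambda>p. (fst p, emb (fst p) (ic i (fst p) (snd p)))) ` P i)"
  proof (intro equalityI subsetI)
    fix z assume "z \<in> usphere"
    then obtain x a where z: "z = (x, emb x a)" "fnorm x a = 1" using usphere_cases by metis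
    obtain i where i: "i < k" "x \<in> Sc i" using Sccov by blast
    have "ic i x (co i x a) = a" using ic_co ScV V_subset i by blast
    then have "(x, co i x a) \<in> P i" "z = (fst (x, co i x a), emb (fst (x, co i x a)) (ic i (fst (x, co i x a)) (snd (x, co i x a))))"
      using z i unfolding P_def by auto
    then show "z \<in> (\<Union>i<k. (\<lambda>p. (fst p, emb (fst p) (ic i (fst p) (snd p)))) ` P i)" using i(1) by blast
  qed (auto simp: P_def usphere_def)
  moreover have "continuous_on (P i) (\<lambda>p. (fst p, emb (fst p) (ic i (fst p) (snd p))))" if "i < k" for i
    using continuous_on_subset[OF continuous_on_emb(1)[OF that], of "P i"] ScV[OF that] unfolding case_prod_beta' P_def
    by (intro continuous_on_Pair continuous_on_fst continuous_on_id) auto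
  ultimately show ?thesis using Pc by (auto intro!: compact_UN compact_continuous_image)
qed

text \<open>Over the open set \<open>V i\<close> the decoding has a continuous expression in chart
  i. The zero vector is left out of the hypothesis so that \<open>H\<close> may divide by a norm, as
  it does for \<open>sphere_map\<close>.\<close>

lemma continuous_on_usphereI:
  fixes H :: "'m \<Rightarrow> 'e \<Rightarrow> 'b::topological_space"
  assumes H: "\<And>i. i < k \<Longrightarrow> continuous_on (V i \<times> (- {0})) (\<lambda>(x, b). H x (ic i x b))"
  shows "continuous_on usphere (\<lambda>z. H (fst z) (dec z))"
proof -
  have eq: "usphere = (\<Union>i\<in>{..<k}. usphere \<inter> (V i \<times> UNIV))" using V_cover by auto
  have i: "continuous_on (usphere \<inter> (V i \<times> UNIV)) (\<lambda>z. H (fst z) (dec z))" if i: "i < k" for i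
  proof -
    let ?c = "\<lambda>z :: 'm \<times> (nat \<Rightarrow> 'e). (fst z, snd z i /\<^sub>R \<rho> i (fst z))"
    have "continuous_on (V i \<times> UNIV) (\<lambda>z :: 'm \<times> (nat \<Rightarrow> 'e). inverse (\<rho> i (fst z)))"
      using continuous_on_compose2[OF \<rho>_cont[OF i] continuous_on_fst[OF continuous_on_id]]
      by (intro continuous_on_inverse) (auto simp: V_def id_def)
    moreover have "continuous_on X (\<lambda>z :: 'm \<times> (nat \<Rightarrow> 'e). snd z i)" for X
      by (rule continuous_on_product_then_coordinatewise[OF continuous_on_snd[OF continuous_on_id]])
    ultimately have c: "continuous_on (V i \<times> UNIV) ?c"
      by (intro continuous_on_Pair continuous_on_scaleR continuous_on_fst continuous_on_id) auto
    have im: "?c z \<in> V i \<times> (- {0}) \<and> ic i (fst (?c z)) (snd (?c z)) = dec z" if zin: "z \<in> usphere \<inter> (V i \<times> UNIV)" for z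
    proof -
      have "z \<in> usphere" using zin by blast
      then obtain x a where z: "z = (x, emb x a)" "a \<noteq> 0" "dec z = a" using usphere_cases[of z] by metis
      have x: "x \<in> V i" using zin z by simp
      then have "x \<in> U i" using V_subset[OF i] by blast
      have e: "ic i x (emb x a i /\<^sub>R \<rho> i x) = a" by (rule ic_emb[OF i x])
      then have "emb x a i /\<^sub>R \<rho> i x \<noteq> 0" using linear_0[OF lin_ic[OF i \<open>x \<in> U i\<close>]] z(2) by auto
      then show ?thesis using z e x by simp
    qed
    have "continuous_on (usphere \<inter> (V i \<times> UNIV)) (\<lambda>z. (\<lambda>(x, b). H x (ic i x b)) (?c z))"
      by (rule continuous_on_compose2[OF H[OF i] continuous_on_subset[OF c]]) (use im in blast)+
    then show ?thesis
      by (rule continuous_on_eq) (use im in \<open>auto simp: case_prod_beta'\<close>)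
  qed
  have "continuous_on (\<Union>i\<in>{..<k}. usphere \<inter> (V i \<times> UNIV)) (\<lambda>z. H (fst z) (dec z))"
    unfolding continuous_on_eq_continuous_within
  proof
    fix z assume "z \<in> (\<Union>i\<in>{..<k}. usphere \<inter> (V i \<times> UNIV))"
    then obtain i where zi: "i < k" "z \<in> usphere" "z \<in> V i \<times> UNIV" by blast
    have o: "open (V i \<times> (UNIV :: (nat \<Rightarrow> 'e) set))" using open_V[OF zi(1)] by (intro open_Times) auto
    have "continuous (at z within usphere \<inter> (V i \<times> UNIV)) (\<lambda>z. H (fst z) (dec z))"
      using i[OF zi(1)] zi unfolding continuous_on_eq_continuous_within by blast
    moreover have "at z within usphere \<inter> (V i \<times> UNIV) = at z within usphere"
      by (rule at_within_nhd[OF zi(3) o]) auto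
    ultimately have "continuous (at z within usphere) (\<lambda>z. H (fst z) (dec z))" by simp
    then show "continuous (at z within (\<Union>i\<in>{..<k}. usphere \<inter> (V i \<times> UNIV))) (\<lambda>z. H (fst z) (dec z))"
      using eq by simp
  qed
  then show ?thesis using eq by simp
qed

text \<open>The constants are the extremes over the compact sphere bundle. This compares the
  Riemannian norm with \<open>fnorm\<close> and bounds one step of the cocycle from both
  sides.\<close>

lemma homogeneous_bounds:
  fixes H :: "'m \<Rightarrow> 'e \<Rightarrow> real"
  assumes H: "\<And>i. i < k \<Longrightarrow> continuous_on (V i \<times> (- {0})) (\<lambda>(x, b). H x (ic i x b))"
    and hom: "\<And>x r a. H x (r *\<^sub>R a) = \<bar>r\<bar> * H x a" and pos: "\<And>x a. a \<noteq> 0 \<Longrightarrow> 0 < H x a"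
  shows "\<exists>c>0. \<exists>C>0. \<forall>x a. c * fnorm x a \<le> H x a \<and> H x a \<le> C * fnorm x a"
proof (cases "usphere = {}")
  case True
  have "a = 0" for a :: 'e
  proof (rule ccontr)
    assume "a \<noteq> 0"
    then have "fnorm undefined (a /\<^sub>R fnorm undefined a) = 1"
      using fnorm_pos[of a undefined] by (simp add: fnorm_scaleR)
    then show False using True unfolding usphere_def by blast
  qed
  then have "fnorm x a = 0" "H x a = 0" for x a using fnorm_0 hom[of x 0 0] by (metis abs_zero mult_zero_left scale_zero_left)+
  then show ?thesis by (intro exI[of _ 1] conjI allI) auto
next
  case False
  note c = continuous_on_usphereI[OF H]
  obtain z1 where z1: "z1 \<in> usphere" "\<And>z. z \<in> usphere \<Longrightarrow> H (fst z1) (dec z1) \<le> H (fst z) (dec z)"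
    using continuous_attains_inf[OF compact_usphere False c] by blast
  obtain z2 where z2: "z2 \<in> usphere" "\<And>z. z \<in> usphere \<Longrightarrow> H (fst z) (dec z) \<le> H (fst z2) (dec z2)"
    using continuous_attains_sup[OF compact_usphere False c] by blast
  have p: "0 < H (fst z) (dec z)" if "z \<in> usphere" for z using pos usphere_cases[OF that] by metis
  show ?thesis
  proof (rule exI[of _ "H (fst z1) (dec z1)"], rule conjI[OF p[OF z1(1)]],
      rule exI[of _ "H (fst z2) (dec z2)"], rule conjI[OF p[OF z2(1)]], intro allI)
    fix x a
    show "H (fst z1) (dec z1) * fnorm x a \<le> H x a \<and> H x a \<le> H (fst z2) (dec z2) * fnorm x a"
    proof (cases "a = 0")
      case True
      then show ?thesis using fnorm_0 hom[of x 0 0] by simp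
    next
      case False
      define b where "b = a /\<^sub>R fnorm x a"
      have n: "0 < fnorm x a" by (rule fnorm_pos[OF False])
      have "fnorm x b = 1" unfolding b_def fnorm_scaleR using n by simp
      then have "(x, emb x b) \<in> usphere" unfolding usphere_def by blast
      then have "H (fst z1) (dec z1) \<le> H x b" "H x b \<le> H (fst z2) (dec z2)"
        using z1(2) z2(2) by (force simp: dec_emb)+
      moreover have "H x a = fnorm x a * H x b" unfolding b_def hom using n by simp
      ultimately show ?thesis using n by (simp add: mult.commute mult_le_cancel_left)
    qed
  qed
qed

end

section \<open>The map induced on the sphere bundle and uniform growth along subbundles\<close>

context bundle_cocycle
begin

primrec iter :: "nat \<Rightarrow> 'm \<Rightarrow> 'e \<Rightarrow> 'e" where
  "iter 0 x a = a"
| "iter (Suc n) x a = B ((f ^^ n) x) (iter n x a)"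

lemma linear_iter: "linear (iter n x)"
proof (induction n)
  case 0
  show ?case by (simp add: linear_iff)
next
  case (Suc n)
  show ?case using linear_compose[OF Suc lin_B] by (simp add: comp_def)
qed

lemma B_eq_0_iff: "B x a = 0 \<longleftrightarrow> a = 0"
  by (metis Bi_B lin_B lin_Bi linear_0)

lemma iter_eq_0_iff: "iter n x a = 0 \<longleftrightarrow> a = 0"
  by (induction n) (simp_all add: B_eq_0_iff)

definition sphere_map :: "'m \<times> (nat \<Rightarrow> 'e) \<Rightarrow> 'm \<times> (nat \<Rightarrow> 'e)" where
  "sphere_map z = (let x = fst z; a = B x (dec z) in (f x, emb (f x) (a /\<^sub>R fnorm (f x) a)))"

lemma emb_in_usphere:
  assumes "a \<noteq> 0"
  shows "(x, emb x (a /\<^sub>R fnorm x a)) \<in> usphere"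
  using fnorm_pos[OF assms, of x] fnorm_scaleR[of x "inverse (fnorm x a)" a] unfolding usphere_def by auto

lemma sphere_map_emb:
  assumes "a \<noteq> 0"
  shows "sphere_map (x, emb x (a /\<^sub>R fnorm x a)) = (f x, emb (f x) (B x a /\<^sub>R fnorm (f x) (B x a)))"
proof -
  have c: "fnorm x a * inverse (fnorm (f x) (B x a)) * inverse (fnorm x a) = inverse (fnorm (f x) (B x a))"
    using fnorm_pos[OF assms, of x] by simp
  show ?thesis
    using fnorm_pos[OF assms, of x]
    by (simp add: sphere_map_def Let_def dec_emb linear_scale[OF lin_B] fnorm_scaleR c)
qed

lemma sphere_map_funpow:
  assumes "a \<noteq> 0"
  shows "(sphere_map ^^ n) (x, emb x (a /\<^sub>R fnorm x a)) =
    ((f ^^ n) x, emb ((f ^^ n) x) (iter n x a /\<^sub>R fnorm ((f ^^ n) x) (iter n x a)))"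
proof (induction n)
  case (Suc n)
  show ?case using sphere_map_emb[of "iter n x a" "(f ^^ n) x"] Suc assms iter_eq_0_iff by simp
qed simp

lemma sphere_map_in_usphere: "sphere_map ` usphere \<subseteq> usphere"
proof
  fix w assume "w \<in> sphere_map ` usphere"
  then obtain z where z: "z \<in> usphere" "w = sphere_map z" by blast
  then obtain x a where "z = (x, emb x a)" "dec z = a" "a \<noteq> 0" using usphere_cases by metis
  then show "w \<in> usphere" using z(2) emb_in_usphere[of "B x a" "f x"] B_eq_0_iff
    by (simp add: sphere_map_def Let_def)
qed

lemma continuous_on_sphere_map: "continuous_on usphere sphere_map"
proof -
  have "continuous_on usphere (\<lambda>z. (\<lambda>x a. (f x, emb (f x) (B x a /\<^sub>R fnorm (f x) (B x a)))) (fst z) (dec z))"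
  proof (rule continuous_on_usphereI)
    fix i assume i: "i < k"
    let ?X = "V i \<times> (- {0 :: 'e})"
    have nz: "fnorm (f (fst p)) (B (fst p) (ic i (fst p) (snd p))) \<noteq> 0" if "p \<in> ?X" for p
    proof -
      have x: "fst p \<in> U i" using that V_subset[OF i] by auto
      have "ic i (fst p) (snd p) \<noteq> 0" using co_ic[OF i x, of "snd p"] linear_0[OF lin_co[OF i x]] that by auto
      then show ?thesis by (simp add: fnorm_eq_0_iff B_eq_0_iff)
    qed
    have s: "continuous_on ?X (\<lambda>p. fnorm (f (fst p)) (B (fst p) (ic i (fst p) (snd p))))"
      "continuous_on ?X (\<lambda>p. emb (f (fst p)) (B (fst p) (ic i (fst p) (snd p))))"
      using continuous_on_subset[OF continuous_on_fnorm_B[OF i], of ?X] continuous_on_subset[OF continuous_on_emb_B(1)[OF i], of ?X]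
      by (auto simp: case_prod_beta')
    have "continuous_on ?X (\<lambda>p. f (fst p))"
      by (rule continuous_on_compose2[OF f_cont continuous_on_fst[OF continuous_on_id]]) simp
    moreover have "continuous_on ?X (\<lambda>p. emb (f (fst p)) (B (fst p) (ic i (fst p) (snd p)) /\<^sub>R fnorm (f (fst p)) (B (fst p) (ic i (fst p) (snd p)))))"
      unfolding emb_scaleR
      by (intro continuous_on_coordinatewise_then_product continuous_on_scaleR continuous_on_inverse s
          continuous_on_product_then_coordinatewise[OF s(2)]) (use nz in blast)
    ultimately show "continuous_on ?X (\<lambda>(x, b). (f x, emb (f x) (B x (ic i x b) /\<^sub>R fnorm (f x) (B x (ic i x b)))))"
      unfolding case_prod_beta' by (rule continuous_on_Pair)
  qed
  then show ?thesis unfolding sphere_map_def Let_def .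
qed

definition log_growth :: "'m \<times> (nat \<Rightarrow> 'e) \<Rightarrow> real" where
  "log_growth z = ln (fnorm (f (fst z)) (B (fst z) (dec z)))"

lemma continuous_on_log_growth: "continuous_on usphere log_growth"
proof -
  have "continuous_on usphere (\<lambda>z. (\<lambda>x a. fnorm (f x) (B x a)) (fst z) (dec z))"
    by (rule continuous_on_usphereI, rule continuous_on_subset[OF continuous_on_fnorm_B]) auto
  then show ?thesis unfolding log_growth_def
    by (rule continuous_on_ln) (use usphere_cases B_eq_0_iff fnorm_eq_0_iff in metis)
qed

text \<open>Each term is the logarithmic growth of a normalised vector, so by linearity the sum
  telescopes to the growth of the unnormalised one.\<close>

lemma sum_log_growth:
  assumes "a \<noteq> 0"
  shows "(\<Sum>j<n. log_growth ((sphere_map ^^ j) (x, emb x (a /\<^sub>R fnorm x a)))) =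
    ln (fnorm ((f ^^ n) x) (iter n x a) / fnorm x a)"
proof (induction n)
  case 0
  then show ?case using fnorm_pos[OF assms, of x] by simp
next
  case (Suc n)
  let ?y = "(f ^^ n) x" and ?b = "iter n x a"
  have b: "?b \<noteq> 0" "B ?y ?b \<noteq> 0" using assms iter_eq_0_iff B_eq_0_iff by auto
  have pos: "0 < fnorm ?y ?b" "0 < fnorm (f ?y) (B ?y ?b)" "0 < fnorm x a"
    using fnorm_pos b assms by auto
  have "log_growth ((sphere_map ^^ n) (x, emb x (a /\<^sub>R fnorm x a))) = ln (fnorm (f ?y) (B ?y ?b) / fnorm ?y ?b)"
    using pos by (simp add: sphere_map_funpow[OF assms] log_growth_def dec_emb linear_scale[OF lin_B] fnorm_scaleR
        divide_inverse mult.commute)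
  then show ?case using Suc pos by (simp add: ln_div)
qed

text \<open>The first half of the almost everywhere hypothesis says that \<open>W\<close> is closed
  at \<open>x\<close>, in chart coordinates: the limit measure is known to live only on the closure
  of the unit vectors of \<open>W\<close>, and this puts the vectors over almost every point back
  into \<open>W\<close>. In the second half, replacing \<open>fnorm\<close> by \<open>q\<close>
  changes the Birkhoff sums by the coboundary of \<open>ln q\<close>. The sums exceed every bound,
  so \<open>C\<close> is arbitrary.\<close>

theorem subbundle_uniform_growth:
  fixes W :: "'m \<Rightarrow> 'e set" and q :: "'m \<Rightarrow> 'e \<Rightarrow> real"
  assumes W_inv: "\<And>x a. a \<in> W x \<Longrightarrow> B x a \<in> W (f x)"
    and W_scale: "\<And>x a r. a \<in> W x \<Longrightarrow> r *\<^sub>R a \<in> W x"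
    and q_hom: "\<And>x r a. q x (r *\<^sub>R a) = \<bar>r\<bar> * q x a"
    and q_meas: "\<And>i. i < k \<Longrightarrow> (\<lambda>(x, b). q x (ic i x b)) \<in> borel_measurable (restrict_space borel (U i \<times> UNIV))"
    and AE: "\<And>\<mu>. \<mu> \<in> invariant_measures f \<Longrightarrow> AE x in \<mu>.
      (\<forall>i<k. x \<in> U i \<longrightarrow> (\<forall>X b c. (\<forall>n. X n \<in> U i \<and> ic i (X n) (b n) \<in> W (X n)) \<longrightarrow> X \<longlonglongrightarrow> x \<longrightarrow> b \<longlonglongrightarrow> c \<longrightarrow> ic i x c \<in> W x)) \<and>
      (\<forall>a\<in>W x. a \<noteq> 0 \<longrightarrow> 0 < q x a \<and> (\<exists>\<epsilon>>0. \<forall>\<^sub>F n in sequentially. (1 + \<epsilon>) * q x a \<le> q ((f ^^ n) x) (iter n x a)))"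
  shows "\<exists>n. \<forall>x. \<forall>a\<in>W x. C * fnorm x a \<le> fnorm ((f ^^ n) x) (iter n x a)"
proof -
  define D where "D = {(x, emb x a) | x a. a \<in> W x \<and> fnorm x a = 1}"
  have D: "D \<subseteq> usphere" unfolding D_def usphere_def by blast
  have iter_inv: "iter n x a \<in> W ((f ^^ n) x)" if "a \<in> W x" for n x a
    by (induction n) (use that W_inv in auto)
  have SD: "sphere_map ` D \<subseteq> D"
  proof
    fix w assume "w \<in> sphere_map ` D"
    then obtain x a where a: "a \<in> W x" "fnorm x a = 1" "w = sphere_map (x, emb x a)" unfolding D_def by blast
    then have "a \<noteq> 0" using fnorm_0 by auto
    then have "0 < fnorm (f x) (B x a)" using B_eq_0_iff fnorm_pos by blast
    then have "fnorm (f x) (B x a /\<^sub>R fnorm (f x) (B x a)) = 1" by (simp add: fnorm_scaleR)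
    moreover have "w = (f x, emb (f x) (B x a /\<^sub>R fnorm (f x) (B x a)))"
      using a(3) by (simp add: sphere_map_def Let_def dec_emb)
    ultimately show "w \<in> D" unfolding D_def using W_scale[OF W_inv[OF a(1)]] by blast
  qed
  define h where "h z = ln (q (fst z) (dec z))" for z
  \<comment> \<open>\<open>q\<close> is known to be measurable only in each chart, so the sphere
    bundle is cut into finitely many pieces lying over single charts.\<close>
  have hm: "(\<lambda>z. indicator usphere z *\<^sub>R h z) \<in> borel_measurable borel"
  proof (rule measurable_piecewise_restrict)
    let ?C = "insert (- usphere) ((\<lambda>i. usphere \<inter> (V i \<times> UNIV)) ` {..<k})"
    have us: "usphere \<in> sets borel" using compact_imp_closed[OF compact_usphere] by simp
    have V: "V i \<times> (UNIV :: (nat \<Rightarrow> 'e) set) \<in> sets borel" if "i < k" for i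
      using open_V[OF that] by (intro borel_open open_Times) auto
    show "countable ?C" by simp
    show "space borel \<subseteq> \<Union> ?C"
    proof
      fix z :: "'m \<times> (nat \<Rightarrow> 'e)"
      obtain i where "i < k" "fst z \<in> V i" using V_cover by blast
      then show "z \<in> \<Union> ?C" by (cases "z \<in> usphere") (auto simp: mem_Times_iff)
    qed
    fix \<Omega> assume \<Omega>: "\<Omega> \<in> ?C"
    show "\<Omega> \<inter> space borel \<in> sets borel" using \<Omega> us V by auto
    show "(\<lambda>z. indicator usphere z *\<^sub>R h z) \<in> borel_measurable (restrict_space borel \<Omega>)"
    proof (cases "\<Omega> = - usphere")
      case True
      then show ?thesis by (subst measurable_cong[where g = "\<lambda>_. 0"]) (auto simp: space_restrict_space)
    next
      case False
      then obtain i where i: "i < k" "\<Omega> = usphere \<inter> (V i \<times> UNIV)" using \<Omega> by blast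
      let ?c = "\<lambda>z :: 'm \<times> (nat \<Rightarrow> 'e). (fst z, snd z i /\<^sub>R \<rho> i (fst z))"
      have "continuous_on (V i \<times> UNIV) (\<lambda>z :: 'm \<times> (nat \<Rightarrow> 'e). inverse (\<rho> i (fst z)))"
        using continuous_on_compose2[OF \<rho>_cont[OF i(1)] continuous_on_fst[OF continuous_on_id]]
        by (intro continuous_on_inverse) (auto simp: V_def id_def)
      then have "continuous_on (V i \<times> UNIV) ?c"
        by (intro continuous_on_Pair continuous_on_scaleR continuous_on_fst continuous_on_id
            continuous_on_product_then_coordinatewise[OF continuous_on_snd[OF continuous_on_id]])
      then have "continuous_on \<Omega> ?c" by (rule continuous_on_subset) (use i(2) in auto)
      then have c: "?c \<in> measurable (restrict_space borel \<Omega>) (restrict_space borel (U i \<times> UNIV))"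
        by (intro measurable_restrict_space2 borel_measurable_continuous_on_restrict)
          (use i V_subset[OF i(1)] in \<open>auto simp: space_restrict_space\<close>)
      have "(\<lambda>z. ln ((\<lambda>(x, b). q x (ic i x b)) (?c z))) \<in> borel_measurable (restrict_space borel \<Omega>)"
        using measurable_compose[OF c q_meas[OF i(1)]] by (rule borel_measurable_ln)
      then show ?thesis
      proof (subst measurable_cong)
        fix z assume "z \<in> space (restrict_space borel \<Omega>)"
        then have z: "z \<in> usphere" "fst z \<in> V i" using i(2) by (auto simp: space_restrict_space)
        obtain x a where "z = (x, emb x a)" "dec z = a" using usphere_cases[OF z(1)] by metis
        then show "indicator usphere z *\<^sub>R h z = ln ((\<lambda>(x, b). q x (ic i x b)) (?c z))"
          using z ic_emb[OF i(1)] unfolding h_def by simp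
      qed
    qed
  qed
  \<comment> \<open>\<open>max C 1\<close> keeps the logarithm meaningful when \<open>C\<close> is
    not positive.\<close>
  have "\<exists>n. \<forall>z\<in>D. ln (max C 1) < (\<Sum>j<n. log_growth ((sphere_map ^^ j) z))"
  proof (rule birkhoff_sums_exceed_bound[OF compact_usphere continuous_on_sphere_map sphere_map_in_usphere _ f_cont _
        continuous_on_log_growth hm D SD])
    show "continuous_on usphere fst" by (intro continuous_on_fst continuous_on_id)
    show "fst (sphere_map z) = f (fst z)" for z by (simp add: sphere_map_def Let_def)
    fix \<mu> assume "\<mu> \<in> invariant_measures f"
    from AE[OF this]
    show "AE x in \<mu>. \<forall>z\<in>usphere \<inter> closure D. fst z = x \<longrightarrow>
      (\<exists>\<epsilon>>0. \<forall>\<^sub>F n in sequentially. \<epsilon> \<le> (\<Sum>j<n. log_growth ((sphere_map ^^ j) z)) + h ((sphere_map ^^ n) z) - h z)"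
    proof eventually_elim
      case (elim x)
      show ?case
      proof (intro ballI impI)
        fix z assume z: "z \<in> usphere \<inter> closure D" "fst z = x"
        then obtain a where a: "z = (x, emb x a)" "fnorm x a = 1" "a \<noteq> 0" using usphere_cases by (metis IntE fst_conv)
        obtain i where i: "i < k" "x \<in> V i" using V_cover by blast
        \<comment> \<open>\<open>z\<close> is a limit of unit vectors of \<open>W\<close>. Their
          base points tend to \<open>x\<close>, so after dropping finitely many terms they can all
          be read in chart i, where closedness of \<open>W\<close> at \<open>x\<close>
          applies.\<close>
        have aW: "a \<in> W x"
        proof -
          have "z \<in> closure D" using z(1) by blast
          then obtain Y where Y: "\<And>n. Y n \<in> D" "Y \<longlonglongrightarrow> z" unfolding closure_sequential by blast
          have Y1: "(\<lambda>n. fst (Y n)) \<longlonglongrightarrow> x" using tendsto_fst[OF Y(2)] z(2) by simp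
          then obtain N where N: "\<And>n. n \<ge> N \<Longrightarrow> fst (Y n) \<in> V i"
            using topological_tendstoD[OF Y1 open_V[OF i(1)] i(2)] unfolding eventually_sequentially by blast
          define X where "X n = fst (Y (n + N))" for n
          define b where "b n = snd (Y (n + N)) i /\<^sub>R \<rho> i (X n)" for n
          have X: "X \<longlonglongrightarrow> x" unfolding X_def using LIMSEQ_ignore_initial_segment[OF Y1] .
          have XV: "X n \<in> V i" for n unfolding X_def using N by simp
          have "ic i (X n) (b n) \<in> W (X n)" for n
          proof -
            obtain x' a' where "Y (n + N) = (x', emb x' a')" "a' \<in> W x'" using Y(1) unfolding D_def by blast
            then show ?thesis using ic_emb[OF i(1) XV[of n]] unfolding X_def b_def by simp
          qed
          moreover have "b \<longlonglongrightarrow> emb x a i /\<^sub>R \<rho> i x"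
          proof -
            have "(\<lambda>n. snd (Y (n + N)) i) \<longlonglongrightarrow> snd z i"
            proof -
              have "continuous_on UNIV (\<lambda>z :: 'm \<times> (nat \<Rightarrow> 'e). snd z i)"
                by (rule continuous_on_product_then_coordinatewise[OF continuous_on_snd[OF continuous_on_id]])
              from continuous_on_tendsto_compose[OF this LIMSEQ_ignore_initial_segment[OF Y(2)]]
              show ?thesis by simp
            qed
            moreover have "(\<lambda>n. \<rho> i (X n)) \<longlonglongrightarrow> \<rho> i x"
              using continuous_on_tendsto_compose[OF \<rho>_cont[OF i(1)] X] by simp
            ultimately show ?thesis unfolding b_def using i(2) a(1)
              by (auto intro!: tendsto_scaleR tendsto_inverse simp: V_def)
          qed
          ultimately have "ic i x (emb x a i /\<^sub>R \<rho> i x) \<in> W x"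
            using elim i(1) V_subset[OF i(1)] XV X i(2) by blast
          then show ?thesis using ic_emb[OF i] by simp
        qed
        then obtain \<epsilon> where e: "0 < q x a" "0 < \<epsilon>" "\<forall>\<^sub>F n in sequentially. (1 + \<epsilon>) * q x a \<le> q ((f ^^ n) x) (iter n x a)"
          using elim a(3) by blast
        show "\<exists>\<epsilon>>0. \<forall>\<^sub>F n in sequentially. \<epsilon> \<le> (\<Sum>j<n. log_growth ((sphere_map ^^ j) z)) + h ((sphere_map ^^ n) z) - h z"
        proof (intro exI[of _ "ln (1 + \<epsilon>)"] conjI)
          show "0 < ln (1 + \<epsilon>)" using e(2) by simp
          show "\<forall>\<^sub>F n in sequentially. ln (1 + \<epsilon>) \<le> (\<Sum>j<n. log_growth ((sphere_map ^^ j) z)) + h ((sphere_map ^^ n) z) - h z"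
            using e(3)
          proof eventually_elim
            case (elim n)
            have z': "z = (x, emb x (a /\<^sub>R fnorm x a))" using a by simp
            let ?y = "(f ^^ n) x" and ?b = "iter n x a"
            have fb: "0 < fnorm ?y ?b" using a(3) iter_eq_0_iff fnorm_pos by blast
            have qb: "0 < q ?y ?b" using elim e(1,2) by (smt (verit) mult_pos_pos)
            \<comment> \<open>The sum is the logarithm of the \<open>fnorm\<close> of the iterated
              vector, and \<open>h\<close> of the normalised vector is that of \<open>q\<close>
              divided by the same \<open>fnorm\<close>; the latter cancels and only the ratio of the
              values of \<open>q\<close> remains.\<close>
            have "h ((sphere_map ^^ n) z) = ln (q ?y ?b / fnorm ?y ?b)"
              unfolding z' sphere_map_funpow[OF a(3)] h_def using fb by (simp add: dec_emb q_hom divide_inverse mult.commute)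
            moreover have "h z = ln (q x a)" unfolding h_def using a(1) dec_emb by simp
            moreover have "(\<Sum>j<n. log_growth ((sphere_map ^^ j) z)) = ln (fnorm ?y ?b)"
              unfolding z' sum_log_growth[OF a(3)] using a(2) by simp
            moreover have "ln ((1 + \<epsilon>) * q x a) \<le> ln (q ?y ?b)" using elim e(1,2) qb by (subst ln_le_cancel_iff) auto
            ultimately show ?case using fb qb e(1,2) by (simp add: ln_div ln_mult)
          qed
        qed
      qed
    qed
  qed
  then obtain n where n: "\<And>z. z \<in> D \<Longrightarrow> ln (max C 1) < (\<Sum>j<n. log_growth ((sphere_map ^^ j) z))" by blast
  have "C * fnorm x a \<le> fnorm ((f ^^ n) x) (iter n x a)" if a: "a \<in> W x" for x a
  proof (cases "a = 0")
    case False
    have p: "0 < fnorm x a" "0 < fnorm ((f ^^ n) x) (iter n x a)" using False iter_eq_0_iff fnorm_pos by blast+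
    have "(x, emb x (a /\<^sub>R fnorm x a)) \<in> D"
      unfolding D_def using W_scale[OF a] p(1) by (auto simp: fnorm_scaleR)
    from n[OF this] have "ln (max C 1) < ln (fnorm ((f ^^ n) x) (iter n x a) / fnorm x a)"
      unfolding sum_log_growth[OF False] .
    then have "max C 1 < fnorm ((f ^^ n) x) (iter n x a) / fnorm x a"
      by (subst (asm) ln_less_cancel_iff) (use p in auto)
    then show ?thesis using p(1) by (simp add: field_simps)
  qed (simp add: fnorm_0 fnorm_nonneg)
  then show ?thesis by blast
qed

end


subsection \<open>The dual cocycle and the quotient norm\<close>

text \<open>The components of the adjoint are pairings with the finitely many images
  \<open>T x e\<close> of basis vectors, and these are continuous in \<open>x\<close>.\<close>

lemma continuous_on_adjoint:
  fixes T :: "'x::topological_space \<Rightarrow> 'e::euclidean_space \<Rightarrow> 'e"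
  assumes lin: "\<And>x. x \<in> X \<Longrightarrow> linear (T x)" and cont: "continuous_on (X \<times> UNIV) (\<lambda>(x, a). T x a)"
  shows "continuous_on (X \<times> UNIV) (\<lambda>(x, b). adjoint (T x) b)"
proof -
  have Te: "continuous_on (X \<times> (UNIV :: 'e set)) (\<lambda>p. T (fst p) e)" for e
  proof -
    have "continuous_on (X \<times> (UNIV :: 'e set)) (\<lambda>p. (\<lambda>(x, a). T x a) (fst p, e))"
      by (rule continuous_on_compose2[OF cont]) (auto intro!: continuous_intros)
    then show ?thesis by simp
  qed
  have "continuous_on (X \<times> UNIV) (\<lambda>p. \<Sum>e\<in>Basis. (T (fst p) e \<bullet> snd p) *\<^sub>R e)"
    by (intro continuous_intros Te)
  then show ?thesis
  proof (rule continuous_on_eq)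
    fix p :: "'x \<times> 'e" assume "p \<in> X \<times> UNIV"
    then have "T (fst p) e \<bullet> snd p = adjoint (T (fst p)) (snd p) \<bullet> e" for e
      using adjoint_works[OF lin[of "fst p"], of e "snd p"] by (simp add: inner_commute mem_Times_iff)
    then show "(\<Sum>e\<in>Basis. (T (fst p) e \<bullet> snd p) *\<^sub>R e) = (\<lambda>(x, b). adjoint (T x) b) p"
      by (simp add: case_prod_beta' euclidean_representation)
  qed
qed

lemma adjoint_compose:
  fixes h k :: "'e::euclidean_space \<Rightarrow> 'e"
  assumes "linear h" "linear k"
  shows "adjoint h (adjoint k b) = adjoint (\<lambda>a. k (h a)) b"
proof -
  have lin: "linear (\<lambda>a. k (h a))" using linear_compose[OF assms] by (simp add: comp_def)
  have "a \<bullet> adjoint h (adjoint k b) = a \<bullet> adjoint (\<lambda>a. k (h a)) b" for a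
    by (simp add: adjoint_works assms lin)
  then show ?thesis by (metis vector_eq_ldot)
qed

lemma adjoint_inverse:
  fixes h k :: "'e::euclidean_space \<Rightarrow> 'e"
  assumes "linear h" "linear k" "\<And>a. k (h a) = a"
  shows "adjoint h (adjoint k b) = b"
proof -
  have "a \<bullet> adjoint h (adjoint k b) = a \<bullet> b" for a by (simp add: adjoint_works assms)
  then show ?thesis by (metis vector_eq_ldot)
qed

context bundle_cocycle
begin

text \<open>Adjoints reverse arrows, so \<open>co\<close> and \<open>ic\<close> change places and
  the dual cocycle is the inverse transpose of \<open>B\<close>; continuity of \<open>Bi\<close> in
  the charts is what makes it continuous. All results on cocycles thereby apply to covectors, with
  the same bump functions.\<close>

lemma dual:
  "bundle_cocycle k U S \<rho> (\<lambda>i x. adjoint (ic i x)) (\<lambda>i x. adjoint (co i x)) f (\<lambda>x. adjoint (Bi x)) (\<lambda>x. adjoint (B x))"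
proof (rule bundle_cocycle.intro)
  fix i j :: nat and x :: 'm and a :: 'e
  show "linear (adjoint (Bi x))" "linear (adjoint (B x))" by (intro adjoint_linear lin_B lin_Bi)+
  show "adjoint (Bi x) (adjoint (B x) a) = a" "adjoint (B x) (adjoint (Bi x) a) = a"
    by (intro adjoint_inverse lin_B lin_Bi B_Bi Bi_B)+
  assume i: "i < k"
  show "linear (adjoint (ic i x))" "linear (adjoint (co i x))" if "x \<in> U i"
    using lin_ic lin_co i that adjoint_linear by blast+
  show "adjoint (ic i x) (adjoint (co i x) a) = a" if "x \<in> U i"
    using adjoint_inverse lin_ic lin_co co_ic i that by blast
  show "adjoint (co i x) (adjoint (ic i x) a) = a" if "x \<in> U i"
    using adjoint_inverse lin_ic lin_co ic_co i that by blast
  assume j: "j < k"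
  show "continuous_on ((U i \<inter> U j) \<times> UNIV) (\<lambda>(x, a). adjoint (ic j x) (adjoint (co i x) a))"
  proof -
    have "continuous_on ((U i \<inter> U j) \<times> UNIV) (\<lambda>(x, b). adjoint (\<lambda>a. co i x (ic j x a)) b)"
      by (rule continuous_on_adjoint)
        (use cont_trans[OF j i] linear_compose[OF lin_ic[OF j] lin_co[OF i]] in \<open>auto simp: comp_def Int_commute\<close>)
    then show ?thesis
      by (rule continuous_on_eq) (auto simp: adjoint_compose lin_ic[OF j] lin_co[OF i])
  qed
  show "continuous_on ((U i \<inter> f -` U j) \<times> UNIV) (\<lambda>(x, a). adjoint (ic j (f x)) (adjoint (Bi x) (adjoint (co i x) a)))"
  proof -
    have l: "linear (\<lambda>a. co i x (Bi x a))" "linear (\<lambda>a. co i x (Bi x (ic j (f x) a)))" if "x \<in> U i \<inter> f -` U j" for x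
      using linear_compose[OF lin_ic[OF j, of "f x"] linear_compose[OF lin_Bi lin_co[OF i, of x]]]
        linear_compose[OF lin_Bi lin_co[OF i, of x]] that by (auto simp: comp_def)
    have "continuous_on ((U i \<inter> f -` U j) \<times> UNIV) (\<lambda>(x, b). adjoint (\<lambda>a. co i x (Bi x (ic j (f x) a))) b)"
      by (rule continuous_on_adjoint[OF l(2) cont_Bi[OF i j]])
    then show ?thesis
      by (rule continuous_on_eq) (auto simp: adjoint_compose lin_ic[OF j] lin_co[OF i] lin_Bi l)
  qed
  show "continuous_on ((U i \<inter> f -` U j) \<times> UNIV) (\<lambda>(x, a). adjoint (ic i x) (adjoint (B x) (adjoint (co j (f x)) a)))"
  proof -
    have l: "linear (\<lambda>a. co j (f x) (B x a))" "linear (\<lambda>a. co j (f x) (B x (ic i x a)))" if "x \<in> U i \<inter> f -` U j" for x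
      using linear_compose[OF lin_ic[OF i, of x] linear_compose[OF lin_B lin_co[OF j, of "f x"]]]
        linear_compose[OF lin_B lin_co[OF j, of "f x"]] that by (auto simp: comp_def)
    have "continuous_on ((U i \<inter> f -` U j) \<times> UNIV) (\<lambda>(x, b). adjoint (\<lambda>a. co j (f x) (B x (ic i x a))) b)"
      by (rule continuous_on_adjoint[OF l(2) cont_B[OF i j]])
    then show ?thesis
      by (rule continuous_on_eq) (auto simp: adjoint_compose lin_ic[OF i] lin_co[OF j] lin_B l)
  qed
qed (use compact_UNIV open_U closed_S S_subset \<rho>_cont \<rho>_nonneg \<rho>_supp \<rho>_pos f_cont in auto)

lemma iter_add: "iter (m + n) x a = iter m ((f ^^ n) x) (iter n x a)"
  by (induction m) (simp_all add: funpow_add)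

text \<open>Used to find one time at which both a subbundle and the annihilator are expanded. Since
  \<open>1 \<le> C\<close>, further blocks of \<open>n\<close> steps do not spoil the gain of the
  first one.\<close>

lemma iter_growth_mult:
  assumes W: "\<And>x a. a \<in> W x \<Longrightarrow> B x a \<in> W (f x)" and C: "1 \<le> C"
    and g: "\<And>x a. a \<in> W x \<Longrightarrow> C * fnorm x a \<le> fnorm ((f ^^ n) x) (iter n x a)"
    and a: "a \<in> W x" and m: "0 < m"
  shows "C * fnorm x a \<le> fnorm ((f ^^ (m * n)) x) (iter (m * n) x a)"
  using m
proof (induction m rule: nat_induct_non_zero)
  case (Suc m)
  have "iter j x a \<in> W ((f ^^ j) x)" for j by (induction j) (use a W in auto)
  from g[OF this[of "m * n"]] have "C * fnorm ((f ^^ (m * n)) x) (iter (m * n) x a) \<le> fnorm ((f ^^ (Suc m * n)) x) (iter (Suc m * n) x a)"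
    by (simp add: iter_add funpow_add)
  then show ?case using Suc.IH C fnorm_nonneg[of "(f ^^ (m * n)) x" "iter (m * n) x a"]
    by (smt (verit, best) mult_le_cancel_right1)
qed (use g[OF a] in simp)

text \<open>The sum of the bumps has a positive minimum by compactness, and the largest of
  \<open>k\<close> numbers is at least their mean.\<close>

lemma \<rho>_lower_bound: "\<exists>\<delta>>0. \<forall>x. \<exists>i<k. \<delta> \<le> \<rho> i x"
proof -
  have k: "0 < k" using \<rho>_pos[of undefined] by auto
  have "continuous_on UNIV (\<lambda>x. \<Sum>i<k. \<rho> i x)" by (intro continuous_on_sum \<rho>_cont) simp
  from continuous_attains_inf[OF compact_UNIV UNIV_not_empty this]
  obtain x0 where x0: "\<And>x. (\<Sum>i<k. \<rho> i x0) \<le> (\<Sum>i<k. \<rho> i x)" by blast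
  define d where "d = (\<Sum>i<k. \<rho> i x0) / k"
  have "0 < (\<Sum>i<k. \<rho> i x0)"
  proof -
    obtain i where i: "i < k" "0 < \<rho> i x0" using \<rho>_pos by blast
    note i(2)
    also have "\<rho> i x0 \<le> (\<Sum>i<k. \<rho> i x0)" by (rule member_le_sum) (use i \<rho>_nonneg in auto)
    finally show ?thesis .
  qed
  then have d: "0 < d" unfolding d_def using k by simp
  have "\<exists>i<k. d \<le> \<rho> i x" for x
  proof (rule ccontr)
    assume "\<not> ?thesis"
    then have "(\<Sum>i<k. \<rho> i x) < (\<Sum>i<k. d)" using k by (intro sum_strict_mono) (auto simp: not_le)
    also have "\<dots> = (\<Sum>i<k. \<rho> i x0)" unfolding d_def using k by simp
    finally show False using x0[of x] by simp
  qed
  then show ?thesis using d by blast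
qed

lemma fnorm_ic_bound:
  assumes d: "0 < d"
  shows "\<exists>C>0. \<forall>i<k. \<forall>x c. d \<le> \<rho> i x \<longrightarrow> fnorm x (ic i x c) \<le> C * norm c"
proof -
  have "\<exists>C>0. \<forall>x c. d \<le> \<rho> i x \<longrightarrow> fnorm x (ic i x c) \<le> C * norm c" if i: "i < k" for i
  proof -
    define T where "T = {x. d \<le> \<rho> i x} \<times> sphere (0 :: 'e) 1"
    have "closed {x. d \<le> \<rho> i x}" by (intro closed_Collect_le continuous_intros \<rho>_cont i)
    then have "compact {x. d \<le> \<rho> i x}" using compact_Int_closed[OF compact_UNIV] by (metis Int_UNIV_left)
    then have T: "compact T" unfolding T_def by (intro compact_Times compact_sphere)
    have "continuous_on T (\<lambda>(x, b). fnorm x (ic i x b))"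
      by (rule continuous_on_subset[OF continuous_on_fnorm[OF i]]) (use d in \<open>auto simp: T_def V_def\<close>)
    from compact_imp_bounded[OF compact_continuous_image[OF this T]]
    obtain C where C: "0 < C" "\<And>x b. (x, b) \<in> T \<Longrightarrow> fnorm x (ic i x b) \<le> C"
      unfolding bounded_pos by (fastforce simp: abs_le_iff)
    have "fnorm x (ic i x c) \<le> C * norm c" if x: "d \<le> \<rho> i x" for x c
    proof (cases "c = 0")
      case True
      have "x \<in> U i" using x d V_subset[OF i] unfolding V_def by auto
      then show ?thesis using True linear_0[OF lin_ic[OF i]] fnorm_0 by simp
    next
      case False
      have xU: "x \<in> U i" using x d V_subset[OF i] unfolding V_def by auto
      have "fnorm x (ic i x (c /\<^sub>R norm c)) \<le> C" by (rule C(2)) (use x False in \<open>auto simp: T_def\<close>)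
      then show ?thesis using False linear_scale[OF lin_ic[OF i xU]] by (simp add: fnorm_scaleR field_simps)
    qed
    then show ?thesis using C(1) by blast
  qed
  then obtain C where C: "\<And>i. i < k \<Longrightarrow> 0 < C i \<and> (\<forall>x c. d \<le> \<rho> i x \<longrightarrow> fnorm x (ic i x c) \<le> C i * norm c)"
    by metis
  have k: "0 < k" using \<rho>_pos[of undefined] by auto
  have C0: "0 \<le> C i" if "i < k" for i using C[OF that] by simp
  have Cle: "C i \<le> (\<Sum>i<k. C i)" if "i < k" for i
    by (rule member_le_sum) (use that C0 in auto)
  show ?thesis
  proof (intro exI[of _ "\<Sum>i<k. C i"] conjI allI impI)
    show "0 < (\<Sum>i<k. C i)" using Cle[OF k] C[OF k] by linarith
    fix i x c assume "i < k" "d \<le> \<rho> i x"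
    then show "fnorm x (ic i x c) \<le> (\<Sum>i<k. C i) * norm c"
      using C[of i] Cle[of i] by (meson mult_right_mono norm_ge_zero order_trans)
  qed
qed

lemma norm_co_le: "i < k \<Longrightarrow> d \<le> \<rho> i x \<Longrightarrow> d * norm (co i x a) \<le> fnorm x a"
proof -
  assume i: "i < k" "d \<le> \<rho> i x"
  have "d * norm (co i x a) \<le> \<rho> i x * norm (co i x a)" using i by (intro mult_right_mono) auto
  also have "\<dots> \<le> fnorm x a" unfolding fnorm_def by (rule member_le_sum) (use i \<rho>_nonneg in auto)
  finally show ?thesis .
qed

lemma fnorm_B_bounds: "\<exists>c>0. \<exists>C>0. \<forall>x a. c * fnorm x a \<le> fnorm (f x) (B x a) \<and> fnorm (f x) (B x a) \<le> C * fnorm x a"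
proof (rule homogeneous_bounds)
  show "continuous_on (V i \<times> - {0}) (\<lambda>(x, b). fnorm (f x) (B x (ic i x b)))" if "i < k" for i
    by (rule continuous_on_subset[OF continuous_on_fnorm_B[OF that]]) auto
qed (simp_all add: linear_scale[OF lin_B] fnorm_scaleR fnorm_pos B_eq_0_iff)

end

context bundle_cocycle
begin

lemma surj_iter: "\<exists>a. iter n x a = b"
proof (induction n arbitrary: b)
  case (Suc n)
  obtain a where "iter n x a = Bi ((f ^^ n) x) b" using Suc by blast
  then show ?case by (intro exI[of _ a]) (simp add: B_Bi)
qed simp

lemma iter_image:
  assumes "\<And>x. B x ` W x = W (f x)"
  shows "iter n x ` W x = W ((f ^^ n) x)"
proof (induction n)
  case (Suc n)
  have "iter (Suc n) x ` W x = B ((f ^^ n) x) ` (iter n x ` W x)" by (simp add: image_image)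
  then show ?case using Suc assms by simp
qed simp

end

locale bundle_cocycle_with_dual =
  bundle_cocycle k U S \<rho> co ic f B Bi +
  D: bundle_cocycle k U S \<rho> "\<lambda>i x. adjoint (ic i x)" "\<lambda>i x. adjoint (co i x)" f "\<lambda>x. adjoint (Bi x)" "\<lambda>x. adjoint (B x)"
  for k and U S :: "nat \<Rightarrow> 'm::{t2_space, second_countable_topology} set" and \<rho>
    and co ic :: "nat \<Rightarrow> 'm \<Rightarrow> 'e::euclidean_space \<Rightarrow> 'e" and f B Bi
begin

text \<open>The inverse transpose preserves the pairing. This is the identity by which contraction
  of vectors turns into expansion of covectors, and expansion of covectors into contraction of the
  quotient.\<close>

lemma inner_dual_iter: "D.iter n x b \<bullet> iter n x a = b \<bullet> a"
proof -
  show ?thesis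
  proof (induction n)
    case (Suc n)
    have "adjoint (Bi y) c \<bullet> B y d = c \<bullet> d" for y c d
      using adjoint_works[OF lin_Bi[of y], of "B y d" c] by (simp add: Bi_B inner_commute)
    then show ?case using Suc by simp
  qed simp
qed

text \<open>The pairing is the same in the coordinates of any chart. In a chart with
  \<open>d \<le> \<rho> i x\<close> each of the two norms dominates d times the Euclidean norm of
  the coordinates, hence the constant 1 / (d * d).\<close>

lemma inner_le_dual_fnorm: "\<exists>C>0. \<forall>x a b. \<bar>b \<bullet> a\<bar> \<le> C * D.fnorm x b * fnorm x a"
proof -
  obtain d where d: "0 < d" "\<And>x. \<exists>i<k. d \<le> \<rho> i x" using \<rho>_lower_bound by blast
  have "\<bar>b \<bullet> a\<bar> \<le> (1 / (d * d)) * D.fnorm x b * fnorm x a" for x a b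
  proof -
    obtain i where i: "i < k" "d \<le> \<rho> i x" using d(2) by blast
    have x: "x \<in> U i" using i d(1) V_subset[OF i(1)] unfolding V_def by auto
    have "b \<bullet> a = adjoint (ic i x) b \<bullet> co i x a"
      using adjoint_works[OF lin_ic[OF i(1) x], of "co i x a" b] ic_co[OF i(1) x] by (simp add: inner_commute)
    then have "d * d * \<bar>b \<bullet> a\<bar> \<le> d * d * (norm (adjoint (ic i x) b) * norm (co i x a))"
      using Cauchy_Schwarz_ineq2 d(1) by (simp add: mult_left_mono)
    also have "\<dots> = (d * norm (adjoint (ic i x) b)) * (d * norm (co i x a))" by simp
    also have "\<dots> \<le> D.fnorm x b * fnorm x a"
      by (intro mult_mono norm_co_le[OF i] D.norm_co_le[OF i] D.fnorm_nonneg) (use d(1) in auto)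
    finally show ?thesis using d(1) by (simp add: field_simps)
  qed
  then show ?thesis using d(1) by (intro exI[of _ "1 / (d * d)"]) simp
qed

text \<open>The norm of \<open>a\<close> as a functional on the annihilator of \<open>W x\<close> is, up to constants, the norm of the
  class of \<open>a\<close> in the quotient by \<open>W x\<close>.\<close>

definition annihilator :: "('m \<Rightarrow> 'e set) \<Rightarrow> 'm \<Rightarrow> 'e set" where
  "annihilator W x = {b. \<forall>a\<in>W x. b \<bullet> a = 0}"

lemma annihilator_invariant:
  assumes "B x ` W x = W (f x)" "b \<in> annihilator W x"
  shows "adjoint (Bi x) b \<in> annihilator W (f x)"
proof -
  have "adjoint (Bi x) b \<bullet> B x w = b \<bullet> w" for w
    using adjoint_works[OF lin_Bi[of x], of "B x w" b] by (simp add: Bi_B inner_commute)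
  then show ?thesis using assms(2) unfolding annihilator_def assms(1)[symmetric] by simp
qed

definition quot_norm :: "('m \<Rightarrow> 'e set) \<Rightarrow> 'm \<Rightarrow> 'e \<Rightarrow> real" where
  "quot_norm W x a = Sup {\<bar>b \<bullet> a\<bar> | b. b \<in> annihilator W x \<and> D.fnorm x b \<le> 1}"

lemma quot_norm_upper:
  assumes "b \<in> annihilator W x"
  shows "\<bar>b \<bullet> a\<bar> \<le> quot_norm W x a * D.fnorm x b"
proof (cases "b = 0")
  case True
  show ?thesis using True by (simp add: D.fnorm_0)
next
  case False
  let ?b = "b /\<^sub>R D.fnorm x b"
  have p: "0 < D.fnorm x b" by (rule D.fnorm_pos[OF False])
  obtain C where C: "0 < C" "\<And>x a b. \<bar>b \<bullet> a\<bar> \<le> C * D.fnorm x b * fnorm x a" using inner_le_dual_fnorm by blast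
  have "\<bar>b \<bullet> a\<bar> \<le> C * fnorm x a" if "D.fnorm x b \<le> 1" for b
  proof -
    have "C * D.fnorm x b * fnorm x a \<le> C * 1 * fnorm x a"
      using that C(1) fnorm_nonneg by (intro mult_right_mono mult_left_mono) auto
    then show ?thesis using C(2)[of b a x] by simp
  qed
  then have bdd: "bdd_above {\<bar>b \<bullet> a\<bar> | b. b \<in> annihilator W x \<and> D.fnorm x b \<le> 1}" by (auto intro!: bdd_aboveI)
  have "D.fnorm x ?b \<le> 1" using p by (simp add: D.fnorm_scaleR)
  moreover have "?b \<in> annihilator W x" using assms unfolding annihilator_def by simp
  ultimately have "\<bar>?b \<bullet> a\<bar> \<le> quot_norm W x a" unfolding quot_norm_def by (intro cSup_upper bdd) blast
  then show ?thesis using p by (simp add: field_simps abs_mult)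
qed

lemma quot_norm_least:
  assumes "\<And>b. b \<in> annihilator W x \<Longrightarrow> D.fnorm x b \<le> 1 \<Longrightarrow> \<bar>b \<bullet> a\<bar> \<le> c"
  shows "quot_norm W x a \<le> c"
proof -
  have "0 \<in> annihilator W x" "D.fnorm x 0 \<le> 1" by (simp_all add: annihilator_def D.fnorm_0)
  then show ?thesis unfolding quot_norm_def by (intro cSup_least) (use assms in blast)+
qed

lemma quot_norm_nonneg: "0 \<le> quot_norm W x a"
proof (rule ccontr)
  assume neg: "\<not> ?thesis"
  have "quot_norm W x a * D.fnorm x b \<ge> 0" if "b \<in> annihilator W x" for b
    using quot_norm_upper[OF that, of a] by linarith
  then have "D.fnorm x b = 0" if "b \<in> annihilator W x" for b
    using that neg D.fnorm_nonneg[of x b] by (smt (verit) mult_neg_pos)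
  then have "\<bar>b \<bullet> a\<bar> \<le> 0" if "b \<in> annihilator W x" for b
    using quot_norm_upper[OF that, of a] that by simp
  then have "b \<bullet> a = 0" if "b \<in> annihilator W x" for b using that by fastforce
  then have "{\<bar>b \<bullet> a\<bar> | b. b \<in> annihilator W x \<and> D.fnorm x b \<le> 1} = {0}"
    using D.fnorm_0[of x] by (auto simp: annihilator_def intro!: exI[of _ 0])
  then show False using neg unfolding quot_norm_def by simp
qed

lemma quot_norm_le_fnorm: "\<exists>C>0. \<forall>W x a. quot_norm W x a \<le> C * fnorm x a"
proof -
  obtain C where C: "0 < C" "\<And>x a b. \<bar>b \<bullet> a\<bar> \<le> C * D.fnorm x b * fnorm x a" using inner_le_dual_fnorm by blast
  have "quot_norm W x a \<le> C * fnorm x a" for W x a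
  proof (rule quot_norm_least)
    fix b assume "D.fnorm x b \<le> 1"
    then have "C * D.fnorm x b * fnorm x a \<le> C * 1 * fnorm x a"
      using C(1) fnorm_nonneg by (intro mult_right_mono mult_left_mono) auto
    then show "\<bar>b \<bullet> a\<bar> \<le> C * fnorm x a" using C(2)[of b a x] by simp
  qed
  then show ?thesis using C(1) by blast
qed

text \<open>In a chart where the bump is not small, project the coordinates of \<open>a\<close>
  orthogonally onto those of \<open>W x\<close>. The residual r, read as a covector b, annihilates
  \<open>W x\<close> and satisfies \<open>b \<bullet> a = r \<bullet> r\<close>, so the size of r is
  controlled by the values of \<open>a\<close> on the annihilator.\<close>

lemma quot_norm_representative:
  assumes W: "\<And>x. subspace (W x)"
  shows "\<exists>C>0. \<forall>x a. \<exists>p\<in>W x. fnorm x (a - p) \<le> C * quot_norm W x a"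
proof -
  obtain d where d: "0 < d" "\<And>x. \<exists>i<k. d \<le> \<rho> i x" using \<rho>_lower_bound by blast
  obtain C where C: "0 < C" "\<And>i x c. i < k \<Longrightarrow> d \<le> \<rho> i x \<Longrightarrow> fnorm x (ic i x c) \<le> C * norm c"
    using fnorm_ic_bound[OF d(1)] by blast
  obtain C' where C': "0 < C'" "\<And>i x c. i < k \<Longrightarrow> d \<le> \<rho> i x \<Longrightarrow> D.fnorm x (adjoint (co i x) c) \<le> C' * norm c"
    using D.fnorm_ic_bound[OF d(1)] by blast
  have "\<exists>p\<in>W x. fnorm x (a - p) \<le> C * C' * quot_norm W x a" for x a
  proof -
    obtain i where i: "i < k" "d \<le> \<rho> i x" using d(2) by blast
    have x: "x \<in> U i" using i d(1) V_subset[OF i(1)] unfolding V_def by auto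
    note lin = lin_co[OF i(1) x] lin_ic[OF i(1) x]
    let ?Y = "co i x ` W x"
    have Y: "subspace ?Y" by (rule linear_subspace_image[OF lin(1) W])
    define r where "r = co i x a - closest_point ?Y (co i x a)"
    obtain p where p: "p \<in> W x" "closest_point ?Y (co i x a) = co i x p"
      using blinfun_apply_orth_proj(2)[OF Y, of "co i x a"] by blast
    have ap: "a - p = ic i x r"
      using p(2) ic_co[OF i(1) x] unfolding r_def by (simp add: linear_diff[OF lin(2)])
    define b where "b = adjoint (co i x) r"
    have bw: "b \<bullet> w = r \<bullet> co i x w" for w
      using adjoint_works[OF lin(1), of w r] unfolding b_def by (simp add: inner_commute)
    have "b \<in> annihilator W x"
      unfolding annihilator_def mem_Collect_eq bw using blinfun_apply_orth_proj(3)[OF Y, of _ "co i x a"]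
      by (auto simp: r_def orthogonal_def)
    from quot_norm_upper[OF this, of a] have "\<bar>b \<bullet> a\<bar> \<le> quot_norm W x a * D.fnorm x b" .
    also have "\<dots> \<le> quot_norm W x a * (C' * norm r)"
      unfolding b_def by (intro mult_left_mono C'(2) i quot_norm_nonneg)
    finally have 1: "\<bar>b \<bullet> a\<bar> \<le> quot_norm W x a * C' * norm r" by (simp add: mult.assoc)
    have "r \<bullet> co i x p = 0"
      using blinfun_apply_orth_proj(3)[OF Y, of "co i x p" "co i x a"] p(1) unfolding r_def orthogonal_def by blast
    then have "b \<bullet> a = r \<bullet> r" unfolding bw using p(2) by (metis diff_zero inner_diff_right r_def)
    then have "norm r * norm r \<le> quot_norm W x a * C' * norm r"
      using 1 by (simp add: power2_norm_eq_inner flip: power2_eq_square)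
    then have "norm r \<le> quot_norm W x a * C'"
    proof (cases "r = 0")
      case True
      then show ?thesis using quot_norm_nonneg[of W x a] C'(1) by simp
    next
      case False
      then show ?thesis
        using \<open>norm r * norm r \<le> quot_norm W x a * C' * norm r\<close> by (intro mult_right_le_imp_le[of "norm r" "norm r"]) auto
    qed
    then have "C * norm r \<le> C * (quot_norm W x a * C')" using C(1) by simp
    then have "fnorm x (a - p) \<le> C * C' * quot_norm W x a"
      using C(2)[OF i, of r] unfolding ap by (simp add: mult_ac)
    then show ?thesis using p(1) by blast
  qed
  then show ?thesis using C(1) C'(1) by (intro exI[of _ "C * C'"]) simp
qed

text \<open>Dual to the lower bound for one step on covectors. Read backwards, it limits the loss of
  the quotient norm in one backward step.\<close>

lemma quot_norm_B:
  assumes BW: "\<And>x. B x ` W x = W (f x)"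
  shows "\<exists>C>0. \<forall>x a. quot_norm W (f x) (B x a) \<le> C * quot_norm W x a"
proof -
  obtain c where c: "0 < c" "\<And>x b. c * D.fnorm x b \<le> D.fnorm (f x) (adjoint (Bi x) b)"
    using D.fnorm_B_bounds by blast
  have "quot_norm W (f x) (B x a) \<le> (1 / c) * quot_norm W x a" for x a
  proof (rule quot_norm_least)
    fix b assume b: "b \<in> annihilator W (f x)" "D.fnorm (f x) b \<le> 1"
    let ?b = "adjoint (B x) b"
    have bw: "?b \<bullet> w = b \<bullet> B x w" for w
      using adjoint_works[OF lin_B[of x], of w b] by (simp add: inner_commute)
    have "?b \<in> annihilator W x" using b(1) BW[of x] unfolding annihilator_def mem_Collect_eq bw by blast
    from quot_norm_upper[OF this, of a] have "\<bar>b \<bullet> B x a\<bar> \<le> quot_norm W x a * D.fnorm x ?b" unfolding bw .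
    also have "\<dots> \<le> quot_norm W x a * (1 / c)"
      using c(2)[of x ?b] b(2) c(1) by (intro mult_left_mono quot_norm_nonneg) (auto simp: D.B_Bi field_simps)
    finally show "\<bar>b \<bullet> B x a\<bar> \<le> (1 / c) * quot_norm W x a" by simp
  qed
  then show ?thesis using c(1) by (intro exI[of _ "1 / c"]) simp
qed

text \<open>Test the iterated vector against a covector b, which is itself an iterate of some b' in
  the annihilator at \<open>x\<close>. The pairing is unchanged, and b' is smaller than b by the
  factor \<open>C\<close>.\<close>

lemma quot_norm_iter:
  assumes BW: "\<And>x. B x ` W x = W (f x)" and C: "0 < C"
    and g: "\<And>x b. b \<in> annihilator W x \<Longrightarrow> C * D.fnorm x b \<le> D.fnorm ((f ^^ n) x) (D.iter n x b)"
  shows "C * quot_norm W ((f ^^ n) x) (iter n x a) \<le> quot_norm W x a"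
proof -
  have "quot_norm W ((f ^^ n) x) (iter n x a) \<le> quot_norm W x a / C"
  proof (rule quot_norm_least)
    fix b assume b: "b \<in> annihilator W ((f ^^ n) x)" "D.fnorm ((f ^^ n) x) b \<le> 1"
    obtain b' where b': "D.iter n x b' = b" using D.surj_iter by blast
    have "b' \<bullet> w = b \<bullet> iter n x w" for w using inner_dual_iter[of n x b' w] b' by simp
    then have "b' \<in> annihilator W x" and ba: "b' \<bullet> a = b \<bullet> iter n x a"
      using b(1) iter_image[of W n x, OF BW] unfolding annihilator_def by auto
    then have "\<bar>b \<bullet> iter n x a\<bar> \<le> quot_norm W x a * D.fnorm x b'"
      using quot_norm_upper by metis
    also have "\<dots> \<le> quot_norm W x a * (1 / C)"
      using g[OF \<open>b' \<in> annihilator W x\<close>] b(2) b' C by (intro mult_left_mono quot_norm_nonneg) (auto simp: field_simps)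
    finally show "\<bar>b \<bullet> iter n x a\<bar> \<le> quot_norm W x a / C" by simp
  qed
  then show ?thesis using C by (simp add: field_simps)
qed

lemma iter_lower_bound: "\<exists>c>0. \<forall>x a. c * fnorm x a \<le> fnorm ((f ^^ n) x) (iter n x a)"
proof (induction n)
  case 0
  show ?case by (intro exI[of _ 1]) simp
next
  case (Suc n)
  obtain c where c: "0 < c" "\<And>x a. c * fnorm x a \<le> fnorm ((f ^^ n) x) (iter n x a)" using Suc by blast
  obtain c' where c': "0 < c'" "\<And>x a. c' * fnorm x a \<le> fnorm (f x) (B x a)" using fnorm_B_bounds by blast
  have "c' * c * fnorm x a \<le> fnorm ((f ^^ Suc n) x) (iter (Suc n) x a)" for x a
    using order_trans[OF mult_left_mono[OF c(2)[of x a], of c'] c'(2)[of "(f ^^ n) x" "iter n x a"]] c'(1)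
    by (simp add: mult.assoc)
  then show ?case using c(1) c'(1) by (intro exI[of _ "c' * c"]) simp
qed

text \<open>Write the image vector as p plus a remainder, with p in \<open>W\<close> and the
  remainder controlled by the quotient norm. Going back, p shrinks by the factor 4, while the
  remainder grows at most by a constant. This is one step of the recursion along backward
  orbits.\<close>

lemma fnorm_backward_bound:
  assumes W: "\<And>x. subspace (W x)" and BW: "\<And>x. B x ` W x = W (f x)"
    and g: "\<And>x a. a \<in> W x \<Longrightarrow> 4 * fnorm x a \<le> fnorm ((f ^^ n) x) (iter n x a)"
  shows "\<exists>C>0. \<forall>x a. fnorm x a \<le> fnorm ((f ^^ n) x) (iter n x a) / 4 + C * quot_norm W ((f ^^ n) x) (iter n x a)"
proof -
  obtain C where C: "0 < C" "\<And>x a. \<exists>p\<in>W x. fnorm x (a - p) \<le> C * quot_norm W x a"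
    using quot_norm_representative[of W, OF W] by blast
  obtain c where c: "0 < c" "\<And>x a. c * fnorm x a \<le> fnorm ((f ^^ n) x) (iter n x a)"
    using iter_lower_bound by blast
  have "fnorm x a \<le> fnorm ((f ^^ n) x) (iter n x a) / 4 + (C / 4 + C / c) * quot_norm W ((f ^^ n) x) (iter n x a)" for x a
  proof -
    let ?y = "(f ^^ n) x" and ?w = "iter n x a"
    obtain p where p: "p \<in> W ?y" "fnorm ?y (?w - p) \<le> C * quot_norm W ?y ?w" using C(2) by blast
    have "p \<in> iter n x ` W x" unfolding iter_image[of W n x, OF BW] by (rule p(1))
    then obtain p' where p': "p' \<in> W x" "iter n x p' = p" by (metis imageE)
    have "4 * fnorm x p' \<le> fnorm ?y p" using g[OF p'(1)] p'(2) by simp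
    also have "fnorm ?y p \<le> fnorm ?y ?w + fnorm ?y (?w - p)"
      using fnorm_triangle[of ?y ?w "- (?w - p)"] fnorm_scaleR[of ?y "-1" "?w - p"] by simp
    finally have 1: "fnorm x p' \<le> fnorm ?y ?w / 4 + C / 4 * quot_norm W ?y ?w" using p(2) by simp
    have "c * fnorm x (a - p') \<le> fnorm ?y (?w - p)"
      using c(2)[of x "a - p'"] p'(2) by (simp add: linear_diff[OF linear_iter])
    then have "fnorm x (a - p') \<le> C / c * quot_norm W ?y ?w" using p(2) c(1) by (simp add: field_simps)
    then show ?thesis using 1 fnorm_triangle[of x p' "a - p'"] by (simp add: distrib_right)
  qed
  then show ?thesis using C(1) c(1) by (intro exI[of _ "C / 4 + C / c"]) (simp add: add_pos_pos)
qed

text \<open>The constants depend on \<open>x\<close>, since the fibre coordinates jump from point to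
  point; the comparison serves only for arguments inside a single fibre.\<close>

lemma fnorm_comparable_norm: "\<exists>c>0. \<exists>C>0. \<forall>a. c * norm a \<le> fnorm x a \<and> fnorm x a \<le> C * norm a"
proof -
  obtain d where d: "0 < d" "\<And>x. \<exists>i<k. d \<le> \<rho> i x" using \<rho>_lower_bound by blast
  obtain i where i: "i < k" "d \<le> \<rho> i x" using d(2) by blast
  have x: "x \<in> U i" using i d(1) V_subset[OF i(1)] unfolding V_def by auto
  obtain C where C: "0 < C" "\<And>c. fnorm x (ic i x c) \<le> C * norm c" using fnorm_ic_bound[OF d(1)] i by blast
  obtain K where K: "0 < K" "\<And>a. norm (co i x a) \<le> K * norm a"
    using linear_bounded_pos[OF lin_co[OF i(1) x]] by blast
  obtain L where L: "0 < L" "\<And>a. norm (ic i x a) \<le> L * norm a"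
    using linear_bounded_pos[OF lin_ic[OF i(1) x]] by blast
  show ?thesis
  proof (rule exI[of _ "d / L"], rule conjI, simp add: d(1) L(1), rule exI[of _ "C * K"], rule conjI, simp add: C(1) K(1), intro allI conjI)
    fix a
    have "norm a \<le> L * norm (co i x a)" using L(2)[of "co i x a"] ic_co[OF i(1) x] by simp
    then have "d * norm a \<le> L * (d * norm (co i x a))" using d(1) by (simp add: mult.left_commute)
    also have "\<dots> \<le> L * fnorm x a" using norm_co_le[OF i] L(1) by simp
    finally show "d / L * norm a \<le> fnorm x a" using L(1) by (simp add: field_simps)
    have "fnorm x a \<le> C * norm (co i x a)" using C(2)[of "co i x a"] ic_co[OF i(1) x] by simp
    also have "\<dots> \<le> C * (K * norm a)" using K(2) C(1) by simp
    finally show "fnorm x a \<le> C * K * norm a" by simp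
  qed
qed

text \<open>\<open>R\<close> measures the angle between \<open>E\<close> and \<open>W\<close> in one
  fibre: the distance to \<open>W\<close> is positive on the compact unit sphere of
  \<open>E\<close>. It is not uniform in \<open>x\<close>, and the dependence of the threshold on
  the point begins here.\<close>

lemma fnorm_transversal:
  assumes E: "subspace E" and W: "subspace W" and EW: "E \<inter> W = {0}"
  shows "\<exists>R>0. \<forall>a\<in>E. \<forall>p\<in>W. fnorm x a \<le> R * fnorm x (a - p)"
proof -
  obtain c C where cC: "0 < c" "0 < C" "\<And>a. c * norm a \<le> fnorm x a" "\<And>a. fnorm x a \<le> C * norm a"
    using fnorm_comparable_norm[of x] by blast
  have Wc: "closed W" "W \<noteq> {}" using W closed_subspace subspace_0 by auto
  have "\<exists>e>0. \<forall>a\<in>E. e * norm a \<le> infdist a W"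
  proof (cases "E \<inter> sphere 0 1 = {}")
    case True
    have "a = 0" if "a \<in> E" for a
    proof (rule ccontr)
      assume "a \<noteq> 0"
      then have "a /\<^sub>R norm a \<in> E \<inter> sphere 0 1" using subspace_scale[OF E that] by simp
      then show False using True by blast
    qed
    then have "1 * norm a \<le> infdist a W" if "a \<in> E" for a
      using \<open>\<And>a. a \<in> E \<Longrightarrow> a = 0\<close>[OF that] infdist_nonneg[of a W] by simp
    then show ?thesis by (intro exI[of _ 1]) simp
  next
    case False
    have "compact (E \<inter> sphere 0 1)" using closed_subspace[OF E] by (simp add: closed_Int_compact)
    moreover have "continuous_on (E \<inter> sphere 0 1) (\<lambda>a. infdist a W)" by (intro continuous_intros)
    ultimately have "\<exists>a0\<in>E \<inter> sphere 0 1. \<forall>a\<in>E \<inter> sphere 0 1. infdist a0 W \<le> infdist a W"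
      using False by (intro continuous_attains_inf)
    then obtain a0 where "a0 \<in> E \<inter> sphere 0 1" "\<forall>a\<in>E \<inter> sphere 0 1. infdist a0 W \<le> infdist a W" by blast
    then have a0: "a0 \<in> E" "norm a0 = 1" "\<And>a. a \<in> E \<Longrightarrow> norm a = 1 \<Longrightarrow> infdist a0 W \<le> infdist a W" by auto
    have "a0 \<notin> W" using a0(1,2) EW by (metis IntI empty_iff insert_iff norm_zero zero_neq_one)
    then have pos: "0 < infdist a0 W"
      using in_closed_iff_infdist_zero[OF Wc] infdist_nonneg[of a0 W] by (metis order_less_le)
    have "infdist a0 W * norm a \<le> infdist a W" if a: "a \<in> E" for a
    proof (cases "a = 0")
      case False
      have "infdist a0 W * norm a \<le> norm (a - p)" if p: "p \<in> W" for p
      proof -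
        have "infdist a0 W \<le> infdist (a /\<^sub>R norm a) W" using a0(3) subspace_scale[OF E a] False by simp
        also have "\<dots> \<le> dist (a /\<^sub>R norm a) (p /\<^sub>R norm a)" by (rule infdist_le[OF subspace_scale[OF W p]])
        also have "\<dots> = norm (a - p) / norm a"
          using norm_scaleR[of "inverse (norm a)" "a - p"] by (simp add: dist_norm scaleR_diff_right divide_inverse mult.commute)
        finally show ?thesis using False by (simp add: field_simps)
      qed
      then show ?thesis unfolding infdist_def using Wc(2) by (auto simp: dist_norm intro!: cINF_greatest)
    qed (simp add: infdist_nonneg)
    then show ?thesis using pos by blast
  qed
  then obtain e where e: "0 < e" "\<And>a. a \<in> E \<Longrightarrow> e * norm a \<le> infdist a W" by blast
  have "fnorm x a \<le> C / (e * c) * fnorm x (a - p)" if "a \<in> E" "p \<in> W" for a p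
  proof -
    have "e * norm a \<le> norm (a - p)" using e(2)[OF that(1)] infdist_le[OF that(2), of a] by (simp add: dist_norm)
    then have "c * (e * norm a) \<le> fnorm x (a - p)" using cC(1) cC(3)[of "a - p"] by (smt (verit) mult_left_mono)
    then have "norm a \<le> fnorm x (a - p) / (e * c)" using e(1) cC(1) by (simp add: field_simps)
    then have "C * norm a \<le> C * (fnorm x (a - p) / (e * c))" by (rule mult_left_mono) (use cC(2) in simp)
    then show ?thesis using cC(4)[of a] by simp
  qed
  then show ?thesis using cC e(1) by (intro exI[of _ "C / (e * c)"]) simp
qed

end


subsection \<open>Exponentially growing sequences\<close>

text \<open>Divide m by \<open>N\<close>: each full block gains the factor 4, and the fewer than
  \<open>N\<close> remaining steps lose at most \<open>c ^ N\<close>, as \<open>c \<le> 1\<close>.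
  The division by 4 pays for rounding \<open>root N 4 ^ m\<close> up to a full block.\<close>

lemma geometric_growth:
  fixes s :: "nat \<Rightarrow> real"
  assumes N: "0 < N" and s: "\<And>j. 0 \<le> s j" and g: "\<And>j. 4 * s j \<le> s (j + N)"
    and c: "0 < c" "c \<le> 1" "\<And>j. c * s j \<le> s (Suc j)"
  shows "c ^ N / 4 * root N 4 ^ m * s j \<le> s (j + m)"
proof -
  have step: "c ^ n * s j \<le> s (j + n)" for n j
  proof (induction n)
    case (Suc n)
    have "c ^ Suc n * s j \<le> c * s (j + n)" using Suc c(1) by (simp add: mult.assoc)
    then show ?case using c(3)[of "j + n"] by simp
  qed simp
  have pow: "4 ^ q * s j \<le> s (j + q * N)" for q j
  proof (induction q)
    case (Suc q)
    have "4 ^ Suc q * s j \<le> 4 * s (j + q * N)" using Suc by simp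
    then show ?case using g[of "j + q * N"] by (simp add: algebra_simps)
  qed simp
  define q r where "q = m div N" and "r = m mod N"
  have m: "m = q * N + r" "r < N" unfolding q_def r_def using N by auto
  have rN: "root N 4 ^ N = (4::real)" using N by (simp add: real_root_pow_pos2)
  have r1: "1 \<le> root N (4::real)" using N by simp
  have "root N (4::real) ^ m = 4 ^ q * root N 4 ^ r"
    unfolding m(1) power_add by (simp add: power_mult mult.commute[of q] rN)
  also have "\<dots> \<le> 4 ^ q * 4"
    using power_increasing[OF less_imp_le[OF m(2)] r1] rN by (intro mult_left_mono) auto
  finally have "c ^ N / 4 * root N 4 ^ m \<le> c ^ N / 4 * (4 ^ q * 4)" using c(1) by (intro mult_left_mono) auto
  also have "\<dots> = c ^ N * 4 ^ q" by simp
  also have "\<dots> \<le> c ^ r * 4 ^ q" using power_decreasing[OF less_imp_le[OF m(2)], of c] c by (intro mult_right_mono) auto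
  finally have "c ^ N / 4 * root N 4 ^ m * s j \<le> c ^ r * 4 ^ q * s j" by (rule mult_right_mono[OF _ s])
  also have "\<dots> = c ^ r * (4 ^ q * s j)" by simp
  also have "\<dots> \<le> c ^ r * s (j + q * N)" using pow c(1) by (intro mult_left_mono) auto
  also have "\<dots> \<le> s (j + q * N + r)" by (rule step)
  also have "j + q * N + r = j + m" using m(1) by simp
  finally show ?thesis .
qed

text \<open>Over \<open>N\<close> steps the part of t / s in excess of \<open>C\<close> is divided
  by 16, once by 4 from the recursion for t and once by 4 from the growth of s, while the constant
  part becomes 5/16 C and stays below \<open>C\<close>. Once the excess, initially at most
  \<open>max R 0\<close>, is below 1, the ratio is at most C + 1. \<open>J\<close> is fixed before s
  and t, so it serves all vectors over a point.\<close>

lemma eventually_le_of_recursion: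
  fixes N :: nat
  assumes N: "0 < N" and C: "0 < C"
  shows "\<exists>J. \<forall>s t :: nat \<Rightarrow> real. (\<forall>j. 0 \<le> s j) \<longrightarrow> (\<forall>j. 4 * s j \<le> s (j + N)) \<longrightarrow>
    (\<forall>j. t (j + N) \<le> t j / 4 + C * s j) \<longrightarrow> (\<forall>j<N. t j \<le> R * s j) \<longrightarrow> (\<forall>j\<ge>J. t j \<le> (C + 1) * s j)"
proof -
  define R' where "R' = max R 0"
  obtain q0 :: nat where "R' < 2 ^ q0" using real_arch_pow[of 2 R'] by auto
  then have q0: "R' < 16 ^ q0" by (rule less_le_trans) (rule power_mono, auto)
  have "t j \<le> (C + 1) * s j"
    if s: "\<And>j. 0 \<le> s j" "\<And>j. 4 * s j \<le> s (j + N)" and t: "\<And>j. t (j + N) \<le> t j / 4 + C * s j"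
      and R: "\<And>j. j < N \<Longrightarrow> t j \<le> R * s j" and j: "q0 * N \<le> j" for s t :: "nat \<Rightarrow> real" and j
  proof -
    have main: "t (r + q * N) \<le> (R' / 16 ^ q + C) * s (r + q * N)" if r: "r < N" for q r
    proof (induction q)
      case 0
      have "t r \<le> R' * s r" using R[OF r] s(1)[of r] mult_right_mono[of R R' "s r"] unfolding R'_def by simp
      then show ?case using C s(1)[of r] by (simp add: distrib_right add_increasing2)
    next
      case (Suc q)
      let ?j = "r + q * N"
      have "t (?j + N) \<le> t ?j / 4 + C * s ?j" by (rule t)
      also have "\<dots> \<le> ((R' / 16 ^ q + C) * s ?j) / 4 + C * s ?j"
        using Suc by (intro add_right_mono divide_right_mono) auto
      also have "\<dots> = ((R' / 16 ^ q) / 4 + C / 4 + C) * s ?j" by (simp add: field_simps)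
      also have "\<dots> \<le> ((R' / 16 ^ q) / 4 + C / 4 + C) * (s (?j + N) / 4)"
        using s(2)[of ?j] C unfolding R'_def by (intro mult_left_mono) (auto intro!: add_nonneg_nonneg)
      also have "\<dots> = ((R' / 16 ^ Suc q) + 5 / 16 * C) * s (?j + N)" by (simp add: field_simps)
      also have "\<dots> \<le> ((R' / 16 ^ Suc q) + C) * s (?j + N)"
        using C s(1) by (intro mult_right_mono add_left_mono) auto
      finally show ?case by (simp add: algebra_simps)
    qed
    define q where "q = j div N"
    have q: "q0 \<le> q" using j N unfolding q_def by (simp add: less_eq_div_iff_mult_less_eq)
    have "(16::real) ^ q0 \<le> 16 ^ q" by (rule power_increasing[OF q]) simp
    then have "R' \<le> 16 ^ q" using q0 by linarith
    then have le1: "R' / 16 ^ q + C \<le> C + 1" by (simp add: divide_le_eq)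
    have "t j \<le> (R' / 16 ^ q + C) * s j" using main[of "j mod N" q] N unfolding q_def by simp
    also have "\<dots> \<le> (C + 1) * s j" by (rule mult_right_mono[OF le1 s(1)])
    finally show ?thesis .
  qed
  then show ?thesis by (intro exI[of _ "q0 * N"]) blast
qed


subsection \<open>The derivative cocycle of a diffeomorphism\<close>

text \<open>A cone function over a closed ball in a chart, extended by 0. The preimage
  \<open>S\<close> of the ball is compact, hence closed in the whole manifold, which gives
  continuity across the boundary of the chart domain.\<close>

lemma exists_bump:
  fixes A :: "('m::{t2_space, second_countable_topology}, 'e::euclidean_space) chart set"
  assumes A: "smooth_atlas A"
  shows "\<exists>c S \<rho>. c \<in> A \<and> closed S \<and> S \<subseteq> cdom c \<and> continuous_on UNIV (\<rho> :: 'm \<Rightarrow> real) \<and>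
    (\<forall>y. 0 \<le> \<rho> y) \<and> (\<forall>y. y \<notin> S \<longrightarrow> \<rho> y = 0) \<and> 0 < \<rho> x"
proof -
  define c where "c = chart_at A x"
  have c: "c \<in> A" "x \<in> cdom c" using chart_at[OF A] unfolding c_def by auto
  note ch = atlas_chart[OF A c(1)]
  obtain r where r: "0 < r" "cball (cmap c x) r \<subseteq> cmap c ` cdom c"
    using open_contains_cball ch(2) c(2) by (metis imageI)
  define S where "S = cinv c ` cball (cmap c x) r"
  define \<rho> where "\<rho> y = (if y \<in> cdom c then max 0 (r - dist (cmap c y) (cmap c x)) else 0)" for y
  have "compact S" unfolding S_def
    by (intro compact_continuous_image continuous_on_subset[OF ch(4) r(2)] compact_cball)
  then have S: "closed S" by (rule compact_imp_closed)
  have SD: "S \<subseteq> cdom c" unfolding S_def using r(2) ch(5) by fastforce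
  have supp: "\<rho> y = 0" if "y \<notin> S" for y
  proof (cases "y \<in> cdom c")
    case True
    then have "cmap c y \<notin> cball (cmap c x) r" using that ch(5)[OF True] unfolding S_def by force
    then show ?thesis unfolding \<rho>_def by (simp add: dist_commute)
  qed (simp add: \<rho>_def)
  have "continuous_on (cdom c \<union> - S) \<rho>"
  proof (rule continuous_on_open_Un)
    show "open (cdom c)" "open (- S)" using ch(1) S by auto
    show "continuous_on (cdom c) \<rho>"
      by (rule continuous_on_eq[where f = "\<lambda>y. max 0 (r - dist (cmap c y) (cmap c x))"])
        (auto simp: \<rho>_def intro!: continuous_intros ch(3))
    show "continuous_on (- S) \<rho>" by (rule continuous_on_eq[where f = "\<lambda>_. 0"]) (auto simp: supp)
  qed
  moreover have "cdom c \<union> - S = UNIV" using SD by blast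
  ultimately have "continuous_on UNIV \<rho>" by simp
  moreover have "0 < \<rho> x" unfolding \<rho>_def using c(2) r(1) by simp
  moreover have "0 \<le> \<rho> y" for y unfolding \<rho>_def by simp
  ultimately show ?thesis using c(1) S SD supp by blast
qed

lemma exists_finite_bumps:
  fixes A :: "('m::{t2_space, second_countable_topology}, 'e::euclidean_space) chart set"
  assumes A: "closed_manifold A"
  obtains k :: nat and c S and \<rho> :: "nat \<Rightarrow> 'm \<Rightarrow> real"
  where "\<And>i. i < k \<Longrightarrow> c i \<in> A" "\<And>i. i < k \<Longrightarrow> closed (S i)" "\<And>i. i < k \<Longrightarrow> S i \<subseteq> cdom (c i)"
    "\<And>i. i < k \<Longrightarrow> continuous_on UNIV (\<rho> i)" "\<And>i x. i < k \<Longrightarrow> 0 \<le> \<rho> i x"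
    "\<And>i x. i < k \<Longrightarrow> x \<notin> S i \<Longrightarrow> \<rho> i x = 0" "\<And>x. \<exists>i<k. 0 < \<rho> i x"
proof -
  have sA: "smooth_atlas A" and comp: "compact (UNIV :: 'm set)" using A unfolding closed_manifold_def by auto
  obtain c' :: "'m \<Rightarrow> ('m, 'e) chart" and S' and \<rho>' :: "'m \<Rightarrow> 'm \<Rightarrow> real" where b: "\<And>x. c' x \<in> A \<and> closed (S' x) \<and> S' x \<subseteq> cdom (c' x) \<and>
      continuous_on UNIV (\<rho>' x) \<and> (\<forall>y. 0 \<le> \<rho>' x y) \<and> (\<forall>y. y \<notin> S' x \<longrightarrow> \<rho>' x y = 0) \<and> 0 < \<rho>' x x"
    using exists_bump[OF sA] by metis
  have op: "open {y. 0 < \<rho>' x y}" for x using b by (intro open_Collect_less continuous_intros) auto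
  have "0 < \<rho>' x x" for x using b by blast
  then have cov: "UNIV \<subseteq> (\<Union>x\<in>UNIV. {y. 0 < \<rho>' x y})" by blast
  obtain X where X: "finite X" "UNIV \<subseteq> (\<Union>x\<in>X. {y. 0 < \<rho>' x y})"
    by (rule compactE_image[OF comp op cov])
  obtain e :: "nat \<Rightarrow> 'm" where e: "bij_betw e {..<card X} X"
    using ex_bij_betw_nat_finite[OF X(1)] unfolding atLeast0LessThan by blast
  show thesis
  proof (rule that[of "card X" "c' \<circ> e" "S' \<circ> e" "\<rho>' \<circ> e"])
    fix x
    obtain y where y: "y \<in> X" "0 < \<rho>' y x" using X(2) by blast
    have "y \<in> e ` {..<card X}" unfolding bij_betw_imp_surj_on[OF e] by (rule y(1))
    then obtain i where "i < card X" "y = e i" by blast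
    then show "\<exists>i<card X. 0 < (\<rho>' \<circ> e) i x" using y(2) by (intro exI[of _ i]) simp
  qed (use b in auto)
qed

lemma C1_map_continuous: "C1_map A h \<Longrightarrow> continuous_on UNIV h"
  unfolding C1_map_def by (erule conjunct1)

text \<open>\<open>Ck_on\<close> gives continuity of the derivative in each fixed direction;
  expanding the vector in the basis makes it joint in point and vector.\<close>

lemma continuous_on_local_deriv:
  assumes A: "smooth_atlas A" and h: "C1_map A h" and c: "c \<in> A" and d: "d \<in> A"
  shows "continuous_on ((cdom c \<inter> h -` cdom d) \<times> UNIV) (\<lambda>(x, a). local_deriv c d h x a)"
proof -
  let ?X = "cdom c \<inter> h -` cdom d" and ?F = "cmap d \<circ> h \<circ> cinv c"
  have v: "continuous_on (cmap c ` ?X) (\<lambda>p. frechet_derivative ?F (at p) e)" for e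
    using h c d unfolding C1_map_def by (auto simp: One_nat_def)
  have "continuous_on ?X (cmap c)" by (rule continuous_on_subset[OF atlas_chart(3)[OF A c]]) blast
  then have "continuous_on (?X \<times> (UNIV :: 'b set)) (\<lambda>p. cmap c (fst p))"
    by (rule continuous_on_compose2) (auto intro!: continuous_intros)
  then have e: "continuous_on (?X \<times> (UNIV :: 'b set)) (\<lambda>p. local_deriv c d h (fst p) e)" for e
    unfolding local_deriv_def by (rule continuous_on_compose2[OF v]) auto
  have "continuous_on (?X \<times> UNIV) (\<lambda>p. \<Sum>e\<in>Basis. (snd p \<bullet> e) *\<^sub>R local_deriv c d h (fst p) e)"
    by (intro continuous_intros e)
  then show ?thesis
  proof (rule continuous_on_eq)
    fix p :: "'a \<times> 'b" assume p: "p \<in> ?X \<times> UNIV"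
    have lin: "linear (local_deriv c d h (fst p))"
      by (rule has_derivative_linear[OF local_deriv_has_derivative[OF h c d]]) (use p in auto)
    have "local_deriv c d h (fst p) (snd p) = local_deriv c d h (fst p) (\<Sum>e\<in>Basis. (snd p \<bullet> e) *\<^sub>R e)"
      by (simp add: euclidean_representation)
    also have "\<dots> = (\<Sum>e\<in>Basis. (snd p \<bullet> e) *\<^sub>R local_deriv c d h (fst p) e)"
      by (simp add: linear_sum[OF lin] linear_scale[OF lin])
    finally show "(\<Sum>e\<in>Basis. (snd p \<bullet> e) *\<^sub>R local_deriv c d h (fst p) e) = (\<lambda>(x, a). local_deriv c d h x a) p"
      by (simp add: case_prod_beta')
  qed
qed

text \<open>The fibre coordinates at \<open>x\<close> are those in \<open>chart_at A x\<close>, which depends on \<open>x\<close> without any regularity.\<close>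

definition manifold_co :: "('m, 'e::euclidean_space) chart set \<Rightarrow> (nat \<Rightarrow> ('m, 'e) chart) \<Rightarrow> nat \<Rightarrow> 'm \<Rightarrow> 'e \<Rightarrow> 'e" where
  "manifold_co A c i x = local_deriv (chart_at A x) (c i) id x"

definition manifold_ic :: "('m, 'e::euclidean_space) chart set \<Rightarrow> (nat \<Rightarrow> ('m, 'e) chart) \<Rightarrow> nat \<Rightarrow> 'm \<Rightarrow> 'e \<Rightarrow> 'e" where
  "manifold_ic A c i x = local_deriv (c i) (chart_at A x) id x"

definition manifold_B :: "('m, 'e::euclidean_space) chart set \<Rightarrow> ('m \<Rightarrow> 'm) \<Rightarrow> 'm \<Rightarrow> 'e \<Rightarrow> 'e" where
  "manifold_B A f x = local_deriv (chart_at A x) (chart_at A (f x)) f x"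

definition manifold_Bi :: "('m, 'e::euclidean_space) chart set \<Rightarrow> ('m \<Rightarrow> 'm) \<Rightarrow> 'm \<Rightarrow> 'e \<Rightarrow> 'e" where
  "manifold_Bi A f x = local_deriv (chart_at A (f x)) (chart_at A x) (inv f) (f x)"

lemma local_deriv_id_comp:
  assumes "smooth_atlas A" "c \<in> A" "x \<in> cdom c" "d \<in> A" "x \<in> cdom d" "e \<in> A" "x \<in> cdom e"
  shows "local_deriv d e id x (local_deriv c d id x a) = local_deriv c e id x a"
proof -
  have "local_deriv c e (id \<circ> id) x a = local_deriv d e id (id x) (local_deriv c d id x a)"
    by (rule local_deriv_comp[OF assms(1) C1_map_id[OF assms(1)] C1_map_id[OF assms(1)] assms(2,3)]) (use assms in simp_all)
  then show ?thesis by (simp only: id_comp id_apply)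
qed

lemma linear_local_deriv:
  assumes "C1_map A h" "c \<in> A" "d \<in> A" "x \<in> cdom c" "h x \<in> cdom d"
  shows "linear (local_deriv c d h x)"
  using has_derivative_linear[OF local_deriv_has_derivative[OF assms]] .

text \<open>In every composite that has to be continuous, the selected charts cancel by the chain
  rule, and a derivative between two fixed charts remains.\<close>

lemma bundle_cocycle_tangent:
  fixes A :: "('m::{t2_space, second_countable_topology}, 'e::euclidean_space) chart set"
  assumes A: "closed_manifold A" and f: "C1_diffeo A f"
    and c: "\<And>i. i < k \<Longrightarrow> c i \<in> A" and S: "\<And>i. i < k \<Longrightarrow> closed (S i)" "\<And>i. i < k \<Longrightarrow> S i \<subseteq> cdom (c i)"
    and \<rho>: "\<And>i. i < k \<Longrightarrow> continuous_on UNIV (\<rho> i)" "\<And>i x. i < k \<Longrightarrow> 0 \<le> \<rho> i x"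
      "\<And>i x. i < k \<Longrightarrow> x \<notin> S i \<Longrightarrow> \<rho> i x = 0" "\<And>x. \<exists>i<k. 0 < \<rho> i x"
  shows "bundle_cocycle k (\<lambda>i. cdom (c i)) S \<rho> (manifold_co A c) (manifold_ic A c) f (manifold_B A f) (manifold_Bi A f)"
proof (rule bundle_cocycle.intro)
  have sA: "smooth_atlas A" using A unfolding closed_manifold_def by blast
  note id = C1_map_id[OF sA] and ca = chart_at[OF sA]
  have C1: "C1_map A f" "C1_map A (inv f)" and bij: "bij f" using f unfolding C1_diffeo_def by auto
  have invf: "inv f (f x) = x" "f (inv f x) = x" for x
    using bij by (simp_all add: bij_is_inj bij_is_surj surj_f_inv_f)
  show "compact (UNIV :: 'm set)" using A unfolding closed_manifold_def by blast
  show "continuous_on UNIV f" by (rule C1_map_continuous[OF C1(1)])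
  fix i j :: nat and x :: 'm and a :: 'e
  show "linear (manifold_B A f x)" unfolding manifold_B_def by (rule linear_local_deriv[OF C1(1)]) (use ca in auto)
  show "linear (manifold_Bi A f x)" unfolding manifold_Bi_def
    by (rule linear_local_deriv[OF C1(2)]) (use ca in \<open>auto simp: invf\<close>)
  show "manifold_B A f x (manifold_Bi A f x a) = a"
  proof -
    have "local_deriv (chart_at A (f x)) (chart_at A (f x)) (f \<circ> inv f) (f x) a
        = local_deriv (chart_at A x) (chart_at A (f x)) f (inv f (f x)) (local_deriv (chart_at A (f x)) (chart_at A x) (inv f) (f x) a)"
      by (rule local_deriv_comp[OF sA C1(2,1)]) (use ca in \<open>auto simp: invf\<close>)
    moreover have "f \<circ> inv f = id" using invf by (simp add: fun_eq_iff)
    ultimately show ?thesis using local_deriv_same_chart[OF sA ca] unfolding manifold_B_def manifold_Bi_def by (simp add: invf)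
  qed
  show "manifold_Bi A f x (manifold_B A f x a) = a"
  proof -
    have "local_deriv (chart_at A x) (chart_at A x) (inv f \<circ> f) x a
        = local_deriv (chart_at A (f x)) (chart_at A x) (inv f) (f x) (local_deriv (chart_at A x) (chart_at A (f x)) f x a)"
      by (rule local_deriv_comp[OF sA C1]) (use ca in \<open>auto simp: invf\<close>)
    moreover have "inv f \<circ> f = id" using invf by (simp add: fun_eq_iff)
    ultimately show ?thesis using local_deriv_same_chart[OF sA ca] unfolding manifold_B_def manifold_Bi_def by simp
  qed
  assume i: "i < k"
  note ci = c[OF i]
  show "open (cdom (c i))" by (rule atlas_chart(1)[OF sA ci])
  show "linear (manifold_co A c i x)" "linear (manifold_ic A c i x)" if "x \<in> cdom (c i)"
    unfolding manifold_co_def manifold_ic_def using linear_local_deriv[OF id] ca ci that by auto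
  show "manifold_co A c i x (manifold_ic A c i x a) = a" if "x \<in> cdom (c i)"
    using local_deriv_id_comp[OF sA ci that ca ci that] local_deriv_same_chart[OF sA ci that]
    unfolding manifold_co_def manifold_ic_def by simp
  show "manifold_ic A c i x (manifold_co A c i x a) = a" if "x \<in> cdom (c i)"
    using local_deriv_id_comp[OF sA ca ci that ca] local_deriv_same_chart[OF sA ca]
    unfolding manifold_co_def manifold_ic_def by simp
  assume j: "j < k"
  note cj = c[OF j]
  show "continuous_on ((cdom (c i) \<inter> cdom (c j)) \<times> UNIV) (\<lambda>(x, a). manifold_co A c j x (manifold_ic A c i x a))"
  proof -
    have "continuous_on ((cdom (c i) \<inter> cdom (c j)) \<times> UNIV) (\<lambda>(x, a). local_deriv (c i) (c j) id x a)"
      using continuous_on_local_deriv[OF sA id ci cj] by simp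
    then show ?thesis
      by (rule continuous_on_eq) (use local_deriv_id_comp[OF sA ci _ ca cj] in \<open>auto simp: manifold_co_def manifold_ic_def\<close>)
  qed
  show "continuous_on ((cdom (c i) \<inter> f -` cdom (c j)) \<times> UNIV)
      (\<lambda>(x, a). manifold_co A c j (f x) (manifold_B A f x (manifold_ic A c i x a)))"
  proof (rule continuous_on_eq[OF continuous_on_local_deriv[OF sA C1(1) ci cj]])
    fix p assume "p \<in> (cdom (c i) \<inter> f -` cdom (c j)) \<times> (UNIV :: 'e set)"
    then obtain x a where p: "p = (x, a)" "x \<in> cdom (c i)" "f x \<in> cdom (c j)" by auto
    have "local_deriv (c i) (chart_at A (f x)) (f \<circ> id) x a
        = local_deriv (chart_at A x) (chart_at A (f x)) f (id x) (local_deriv (c i) (chart_at A x) id x a)"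
      by (rule local_deriv_comp[OF sA id C1(1)]) (use ca ci p in auto)
    moreover have "local_deriv (c i) (c j) (id \<circ> f) x a
        = local_deriv (chart_at A (f x)) (c j) id (f x) (local_deriv (c i) (chart_at A (f x)) f x a)"
      by (rule local_deriv_comp[OF sA C1(1) id]) (use ca ci cj p in auto)
    ultimately show "(\<lambda>(x, a). local_deriv (c i) (c j) f x a) p =
        (\<lambda>(x, a). manifold_co A c j (f x) (manifold_B A f x (manifold_ic A c i x a))) p"
      unfolding manifold_co_def manifold_B_def manifold_ic_def p(1) by simp
  qed
  show "continuous_on ((cdom (c i) \<inter> f -` cdom (c j)) \<times> UNIV)
      (\<lambda>(x, a). manifold_co A c i x (manifold_Bi A f x (manifold_ic A c j (f x) a)))"
  proof -
    have "continuous_on ((cdom (c i) \<inter> f -` cdom (c j)) \<times> (UNIV :: 'e set)) (\<lambda>p. f (fst p))"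
      by (rule continuous_on_compose2[OF C1_map_continuous[OF C1(1)]]) (auto intro!: continuous_intros)
    then have "continuous_on ((cdom (c i) \<inter> f -` cdom (c j)) \<times> (UNIV :: 'e set)) (\<lambda>p. (f (fst p), snd p))"
      by (intro continuous_on_Pair continuous_on_snd continuous_on_id)
    then have "continuous_on ((cdom (c i) \<inter> f -` cdom (c j)) \<times> UNIV)
        (\<lambda>p. (\<lambda>(x, a). local_deriv (c j) (c i) (inv f) x a) (f (fst p), snd p))"
      by (rule continuous_on_compose2[OF continuous_on_local_deriv[OF sA C1(2) cj ci]]) (auto simp: invf)
    then show ?thesis
    proof (rule continuous_on_eq)
      fix p assume "p \<in> (cdom (c i) \<inter> f -` cdom (c j)) \<times> (UNIV :: 'e set)"
      then obtain x a where p: "p = (x, a)" "x \<in> cdom (c i)" "f x \<in> cdom (c j)" by auto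
      have "local_deriv (c j) (chart_at A x) (inv f \<circ> id) (f x) a
          = local_deriv (chart_at A (f x)) (chart_at A x) (inv f) (id (f x)) (local_deriv (c j) (chart_at A (f x)) id (f x) a)"
        by (rule local_deriv_comp[OF sA id C1(2)]) (use ca cj p in \<open>auto simp: invf\<close>)
      moreover have "local_deriv (c j) (c i) (id \<circ> inv f) (f x) a
          = local_deriv (chart_at A x) (c i) id (inv f (f x)) (local_deriv (c j) (chart_at A x) (inv f) (f x) a)"
        by (rule local_deriv_comp[OF sA C1(2) id]) (use ca ci cj p in \<open>auto simp: invf\<close>)
      ultimately show "(\<lambda>(x, a). local_deriv (c j) (c i) (inv f) x a) (f (fst p), snd p) =
          (\<lambda>(x, a). manifold_co A c i x (manifold_Bi A f x (manifold_ic A c j (f x) a))) p"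
        unfolding manifold_co_def manifold_Bi_def manifold_ic_def p(1) by (simp add: invf)
    qed
  qed
qed (use S \<rho> in auto)

lemma coord_vec_in_tangent_space:
  assumes A: "smooth_atlas A" and c: "c \<in> A" "x \<in> cdom c"
  shows "coord_vec A c x a \<in> tangent_space A x"
proof (rule tangent_spaceI)
  fix d e assume "d \<in> A" "e \<in> A" "x \<in> cdom d" "x \<in> cdom e"
  then show "coord_vec A c x a e = local_deriv d e id x (coord_vec A c x a d)"
    unfolding coord_vec_def by (simp only: local_deriv_id_comp[OF A c] simp_thms if_True)
qed (auto simp: coord_vec_def)

lemma coord_vec_coordinate:
  assumes "smooth_atlas A" "c \<in> A" "x \<in> cdom c"
  shows "coord_vec A c x a c = a"
  unfolding coord_vec_def using assms by (simp only: local_deriv_same_chart simp_thms if_True)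

lemma coord_vec_of_coordinate:
  assumes A: "smooth_atlas A" and c: "c \<in> A" "x \<in> cdom c" and v: "v \<in> tangent_space A x"
  shows "coord_vec A c x (v c) = v"
  using bij_betw_chart_coordinates[OF A c] coord_vec_in_tangent_space[OF A c] coord_vec_coordinate[OF A c] v
  unfolding bij_betw_def by (meson inj_onD)

lemma coord_vec_change_chart:
  assumes A: "smooth_atlas A" and c: "c \<in> A" "x \<in> cdom c" and d: "d \<in> A" "x \<in> cdom d"
  shows "coord_vec A d x (local_deriv c d id x a) = coord_vec A c x a"
proof -
  have "coord_vec A c x a d = local_deriv c d id x a" unfolding coord_vec_def using d by (simp only: simp_thms if_True)
  then show ?thesis
    using coord_vec_of_coordinate[OF A d coord_vec_in_tangent_space[OF A c]] by metis
qed

lemma coord_vec_add_scaleR: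
  assumes A: "smooth_atlas A" and c: "c \<in> A" "x \<in> cdom c"
  shows "coord_vec A c x (r *\<^sub>R a + s *\<^sub>R b) = r *\<^sub>R coord_vec A c x a + s *\<^sub>R coord_vec A c x b"
proof
  fix d
  show "coord_vec A c x (r *\<^sub>R a + s *\<^sub>R b) d = (r *\<^sub>R coord_vec A c x a + s *\<^sub>R coord_vec A c x b) d"
  proof (cases "d \<in> A \<and> x \<in> cdom d")
    case True
    have "linear (local_deriv c d id x)" by (rule linear_local_deriv[OF C1_map_id[OF A] c(1)]) (use c True in auto)
    then show ?thesis using True unfolding coord_vec_def plus_fun_apply scaleR_fun_def
      by (simp add: linear_add linear_scale)
  next
    case False
    then show ?thesis unfolding coord_vec_def plus_fun_apply scaleR_fun_def by (simp only: if_False scaleR_zero_right add_0_right)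
  qed
qed

section \<open>The Riemannian norm in fibre coordinates\<close>

definition fibre_norm :: "('m, 'e::euclidean_space) chart set \<Rightarrow>
    ('m \<Rightarrow> ('m, 'e) tvec \<Rightarrow> ('m, 'e) tvec \<Rightarrow> real) \<Rightarrow> 'm \<Rightarrow> 'e \<Rightarrow> real" where
  "fibre_norm A g x a = rnorm g x (coord_vec A (chart_at A x) x a)"

context
  fixes A :: "('m::{t2_space, second_countable_topology}, 'e::euclidean_space) chart set"
    and g :: "'m \<Rightarrow> ('m, 'e) tvec \<Rightarrow> ('m, 'e) tvec \<Rightarrow> real"
  assumes A: "smooth_atlas A" and g: "riemannian_metric A g"
begin

lemma metric_linear:
  assumes "c \<in> A" "x \<in> cdom c"
  shows "linear (\<lambda>a. g x (coord_vec A c x a) (coord_vec A c x b))"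
    "linear (\<lambda>b. g x (coord_vec A c x a) (coord_vec A c x b))"
proof -
  have lin: "g x (r *\<^sub>R u + s *\<^sub>R v) w = r * g x u w + s * g x v w"
    and sym: "g x u v = g x v u"
    if "u \<in> tangent_space A x" "v \<in> tangent_space A x" "w \<in> tangent_space A x" for u v w r s
    using g that unfolding riemannian_metric_def by blast+
  note T = coord_vec_in_tangent_space[OF A assms] and cl = coord_vec_add_scaleR[OF A assms]
  have *: "g x (coord_vec A c x (r *\<^sub>R a + s *\<^sub>R a')) (coord_vec A c x b) =
      r * g x (coord_vec A c x a) (coord_vec A c x b) + s * g x (coord_vec A c x a') (coord_vec A c x b)" for r s a a' b
    unfolding cl by (rule lin[OF T T T])
  have **: "linear (\<lambda>a. g x (coord_vec A c x a) (coord_vec A c x b))" for b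
    using *[of 1 _ 1] *[of _ _ 0 0] by (intro linearI) auto
  show "linear (\<lambda>a. g x (coord_vec A c x a) (coord_vec A c x b))" by (rule **)
  show "linear (\<lambda>b. g x (coord_vec A c x a) (coord_vec A c x b))"
    using **[of a] sym[OF T T T] by simp
qed

lemma fibre_norm_in_chart:
  assumes c: "c \<in> A" "x \<in> cdom c"
  shows "fibre_norm A g x (local_deriv c (chart_at A x) id x a) = rnorm g x (coord_vec A c x a)"
  unfolding fibre_norm_def coord_vec_change_chart[OF A c chart_at[OF A]] ..

lemma fibre_norm_scaleR: "fibre_norm A g x (r *\<^sub>R a) = \<bar>r\<bar> * fibre_norm A g x a"
proof -
  let ?c = "coord_vec A (chart_at A x) x"
  have "g x (?c (r *\<^sub>R a)) (?c (r *\<^sub>R a)) = r * (r * g x (?c a) (?c a))"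
    using linear_scale[OF metric_linear(1)[OF chart_at[OF A]]] linear_scale[OF metric_linear(2)[OF chart_at[OF A]]] by simp
  then show ?thesis unfolding fibre_norm_def rnorm_def by (simp add: real_sqrt_mult mult.assoc[symmetric])
qed

lemma fibre_norm_pos: "a \<noteq> 0 \<Longrightarrow> 0 < fibre_norm A g x a"
proof -
  assume a: "a \<noteq> 0"
  let ?c = "coord_vec A (chart_at A x) x"
  have "?c a \<noteq> 0"
  proof
    assume "?c a = 0"
    then have "?c a (chart_at A x) = 0" by simp
    then show False using a coord_vec_coordinate[OF A chart_at[OF A]] by simp
  qed
  then have "0 < g x (?c a) (?c a)"
    using g coord_vec_in_tangent_space[OF A chart_at[OF A]] unfolding riemannian_metric_def by blast
  then show ?thesis unfolding fibre_norm_def rnorm_def by simp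
qed

text \<open>Regularity of the metric is given for fixed coordinate vectors; bilinear expansion in
  the basis makes the norm jointly continuous.\<close>

lemma continuous_on_fibre_norm:
  assumes c: "c \<in> A"
  shows "continuous_on (cdom c \<times> UNIV) (\<lambda>(x, b). fibre_norm A g x (local_deriv c (chart_at A x) id x b))"
proof -
  let ?G = "\<lambda>x a b. g x (coord_vec A c x a) (coord_vec A c x b)"
  have G: "continuous_on (cdom c \<times> (UNIV :: 'e set)) (\<lambda>p. ?G (fst p) a b)" for a b
  proof -
    have "smooth_on (\<lambda>y. g (cinv c y) (coord_vec A c (cinv c y) a) (coord_vec A c (cinv c y) b)) (cmap c ` cdom c)"
      using g c unfolding riemannian_metric_def by blast
    then have "Ck_on 0 (\<lambda>y. g (cinv c y) (coord_vec A c (cinv c y) a) (coord_vec A c (cinv c y) b)) (cmap c ` cdom c)"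
      unfolding smooth_on_def by blast
    then have 1: "continuous_on (cmap c ` cdom c) (\<lambda>y. ?G (cinv c y) a b)" by simp
    have "continuous_on (cdom c \<times> (UNIV :: 'e set)) (\<lambda>p. cmap c (fst p))"
      by (rule continuous_on_compose2[OF atlas_chart(3)[OF A c]]) (auto intro!: continuous_intros)
    then have "continuous_on (cdom c \<times> (UNIV :: 'e set)) (\<lambda>p. ?G (cinv c (cmap c (fst p))) a b)"
      by (rule continuous_on_compose2[OF 1]) auto
    then show ?thesis by (rule continuous_on_eq) (use atlas_chart(5)[OF A c] in auto)
  qed
  have "continuous_on (cdom c \<times> UNIV)
      (\<lambda>p. sqrt (\<Sum>d\<in>Basis. \<Sum>e\<in>Basis. (snd p \<bullet> d) * ((snd p \<bullet> e) * ?G (fst p) d e)))"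
    by (intro continuous_intros G)
  then show ?thesis
  proof (rule continuous_on_eq)
    fix p :: "'m \<times> 'e" assume "p \<in> cdom c \<times> UNIV"
    then obtain x b where p: "p = (x, b)" "x \<in> cdom c" by auto
    note lin1 = metric_linear(1)[OF c p(2)] and lin2 = metric_linear(2)[OF c p(2)]
    have "?G x b b = ?G x (\<Sum>d\<in>Basis. (b \<bullet> d) *\<^sub>R d) b" by (simp add: euclidean_representation)
    also have "\<dots> = (\<Sum>d\<in>Basis. (b \<bullet> d) * ?G x d b)"
      by (simp only: linear_sum[OF lin1] linear_scale[OF lin1] real_scaleR_def)
    also have "\<dots> = (\<Sum>d\<in>Basis. (b \<bullet> d) * ?G x d (\<Sum>e\<in>Basis. (b \<bullet> e) *\<^sub>R e))"
      by (simp add: euclidean_representation)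
    also have "\<dots> = (\<Sum>d\<in>Basis. \<Sum>e\<in>Basis. (b \<bullet> d) * ((b \<bullet> e) * ?G x d e))"
      by (simp only: linear_sum[OF lin2] linear_scale[OF lin2] real_scaleR_def sum_distrib_left)
    finally show "sqrt (\<Sum>d\<in>Basis. \<Sum>e\<in>Basis. (snd p \<bullet> d) * ((snd p \<bullet> e) * ?G (fst p) d e)) =
        (\<lambda>(x, b). fibre_norm A g x (local_deriv c (chart_at A x) id x b)) p"
      using fibre_norm_in_chart[OF c p(2)] unfolding p(1) rnorm_def by simp
  qed
qed

end

text \<open>\<open>local_deriv_comp\<close> without differentiability assumptions on the first map away from \<open>x\<close>, so that it
  applies to iterates.\<close>

lemma has_derivative_comp_in_charts:
  assumes A: "smooth_atlas A" and u: "continuous_on UNIV u" and h: "C1_map A h"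
    and c: "c \<in> A" "x \<in> cdom c" and d: "d \<in> A" "u x \<in> cdom d" and e: "e \<in> A" "h (u x) \<in> cdom e"
    and L: "((cmap d \<circ> u \<circ> cinv c) has_derivative L) (at (cmap c x))"
  shows "((cmap e \<circ> (h \<circ> u) \<circ> cinv c) has_derivative (\<lambda>a. local_deriv d e h (u x) (L a))) (at (cmap c x))"
proof -
  let ?p = "cmap c x" and ?F = "cmap d \<circ> u \<circ> cinv c" and ?H = "cmap e \<circ> h \<circ> cinv d"
  let ?W = "cmap c ` cdom c \<inter> cinv c -` (u -` cdom d)"
  have Fp: "?F ?p = cmap d (u x)" using atlas_chart(5)[OF A c(1)] c by simp
  have "(?H has_derivative local_deriv d e h (u x)) (at (?F ?p))"
    unfolding Fp by (rule local_deriv_has_derivative[OF h d(1) e(1) d(2) e(2)])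
  from diff_chain_at[OF L this]
  have 2: "((?H \<circ> ?F) has_derivative (\<lambda>a. local_deriv d e h (u x) (L a))) (at ?p)" by (simp add: comp_def)
  have "open (u -` cdom d)" using u atlas_chart(1)[OF A d(1)] by (simp add: continuous_on_open_vimage)
  then have W: "open ?W"
    using continuous_open_preimage[OF atlas_chart(4)[OF A c(1)] atlas_chart(2)[OF A c(1)]] by blast
  have pW: "?p \<in> ?W" using atlas_chart(5)[OF A c(1)] c d by auto
  have eq: "(?H \<circ> ?F) y = (cmap e \<circ> (h \<circ> u) \<circ> cinv c) y" if "y \<in> ?W" for y
    using that atlas_chart(5)[OF A d(1)] by auto
  show ?thesis by (rule has_derivative_transform_within_open[OF 2 W pW eq])
qed

text \<open>\<open>tangent_map\<close> takes the derivative of u itself, which for an iterate is not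
  given as a product of one-step derivatives. Any derivative known in the selected charts at
  \<open>x\<close> and \<open>u x\<close> may be substituted, and the other charts at
  \<open>u x\<close> are reached by a change of coordinates.\<close>

lemma tangent_map_eq_coord_vec:
  assumes A: "smooth_atlas A" and u: "continuous_on UNIV u"
    and L: "((cmap (chart_at A (u x)) \<circ> u \<circ> cinv (chart_at A x)) has_derivative L) (at (cmap (chart_at A x) x))"
  shows "tangent_map A u x v = coord_vec A (chart_at A (u x)) (u x) (L (v (chart_at A x)))"
proof
  fix d
  note ca = chart_at[OF A]
  show "tangent_map A u x v d = coord_vec A (chart_at A (u x)) (u x) (L (v (chart_at A x))) d"
  proof (cases "d \<in> A \<and> u x \<in> cdom d")
    case True
    have "((cmap d \<circ> (id \<circ> u) \<circ> cinv (chart_at A x)) has_derivative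
        (\<lambda>a. local_deriv (chart_at A (u x)) d id (u x) (L a))) (at (cmap (chart_at A x) x))"
      by (rule has_derivative_comp_in_charts[OF A u C1_map_id[OF A] ca ca _ _ L]) (use True in auto)
    from frechet_derivative_at[OF this]
    have "local_deriv (chart_at A x) d u x a = local_deriv (chart_at A (u x)) d id (u x) (L a)" for a
      unfolding local_deriv_def id_comp by metis
    then show ?thesis using True unfolding tangent_map_def coord_vec_def by (simp only: if_True simp_thms)
  qed (simp only: tangent_map_def coord_vec_def if_False simp_thms)
qed

section \<open>The derivative cocycle at integer times\<close>

locale manifold_cocycle =
  fixes A :: "('m::{t2_space, second_countable_topology}, 'e::euclidean_space) chart set"
    and g :: "'m \<Rightarrow> ('m, 'e) tvec \<Rightarrow> ('m, 'e) tvec \<Rightarrow> real" and f :: "'m \<Rightarrow> 'm"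
    and k :: nat and c :: "nat \<Rightarrow> ('m, 'e) chart" and S and \<rho> :: "nat \<Rightarrow> 'm \<Rightarrow> real"
  assumes A: "closed_manifold A" and g: "riemannian_metric A g" and f: "C1_diffeo A f"
    and frame: "i < k \<Longrightarrow> c i \<in> A" "i < k \<Longrightarrow> closed (S i)" "i < k \<Longrightarrow> S i \<subseteq> cdom (c i)"
      "i < k \<Longrightarrow> continuous_on UNIV (\<rho> i)" "i < k \<Longrightarrow> 0 \<le> \<rho> i x"
      "i < k \<Longrightarrow> x \<notin> S i \<Longrightarrow> \<rho> i x = 0" "\<exists>i<k. 0 < \<rho> i x"
begin

sublocale T: bundle_cocycle_with_dual k "\<lambda>i. cdom (c i)" S \<rho> "manifold_co A c" "manifold_ic A c" f "manifold_B A f" "manifold_Bi A f"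
proof -
  have "bundle_cocycle k (\<lambda>i. cdom (c i)) S \<rho> (manifold_co A c) (manifold_ic A c) f (manifold_B A f) (manifold_Bi A f)"
    by (rule bundle_cocycle_tangent[OF A f]) (rule frame; assumption)+
  from bundle_cocycle_with_dual.intro[OF this bundle_cocycle.dual[OF this]]
  show "bundle_cocycle_with_dual k (\<lambda>i. cdom (c i)) S \<rho> (manifold_co A c) (manifold_ic A c) f (manifold_B A f) (manifold_Bi A f)" .
qed

lemma atlas: "smooth_atlas A" using A unfolding closed_manifold_def by blast

lemma inv_f [simp]: "inv f (f x) = x" "f (inv f x) = x"
  using f unfolding C1_diffeo_def by (simp_all add: bij_is_inj bij_is_surj surj_f_inv_f)

lemma C1: "C1_map A f" "C1_map A (inv f)" using f unfolding C1_diffeo_def by auto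

text \<open>\<open>manifold_Bi A f y\<close> maps the fibre at \<open>f y\<close> to the fibre at y,
  so the base point is the one reached by the step; hence \<open>Suc n\<close> on the right.\<close>

primrec biter :: "nat \<Rightarrow> 'm \<Rightarrow> 'e \<Rightarrow> 'e" where
  "biter 0 x a = a"
| "biter (Suc n) x a = manifold_Bi A f ((inv f ^^ Suc n) x) (biter n x a)"

definition titer :: "int \<Rightarrow> 'm \<Rightarrow> 'e \<Rightarrow> 'e" where
  "titer n x a = (if 0 \<le> n then T.iter (nat n) x a else biter (nat (- n)) x a)"

lemma continuous_on_funpow: "continuous_on UNIV h \<Longrightarrow> continuous_on UNIV (h ^^ n)" for h :: "'m \<Rightarrow> 'm"
proof (induction n)
  case (Suc n)
  then have "continuous_on UNIV (h \<circ> h ^^ n)"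
    by (intro continuous_on_compose) (auto intro: continuous_on_subset)
  then show ?case by simp
qed (simp add: id_def)

lemma continuous_on_int_iter: "continuous_on UNIV (int_iter f n)"
  unfolding int_iter_def
  by (simp add: continuous_on_funpow C1_map_continuous[OF C1(1)] C1_map_continuous[OF C1(2)])

lemma int_iter_Suc: "int_iter f (n + 1) x = f (int_iter f n x)"
proof (cases "0 \<le> n")
  case True
  then show ?thesis unfolding int_iter_def by (simp add: nat_add_distrib)
next
  case False
  then obtain m where m: "nat (- n) = Suc m" "nat (- (n + 1)) = m" by (cases "nat (- n)") auto
  have "int_iter f n x = inv f ((inv f ^^ m) x)" using False m unfolding int_iter_def by simp
  moreover have "int_iter f (n + 1) x = (inv f ^^ m) x" using False m unfolding int_iter_def by auto
  ultimately show ?thesis by simp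
qed

lemma titer_Suc: "titer (n + 1) x a = manifold_B A f (int_iter f n x) (titer n x a)"
proof (cases "0 \<le> n")
  case True
  then show ?thesis unfolding titer_def int_iter_def by (simp add: nat_add_distrib)
next
  case False
  then obtain m where m: "nat (- n) = Suc m" "nat (- (n + 1)) = m" by (cases "nat (- n)") auto
  have "titer n x a = manifold_Bi A f ((inv f ^^ Suc m) x) (biter m x a)" using False m unfolding titer_def by simp
  moreover have "int_iter f n x = (inv f ^^ Suc m) x" using False m unfolding int_iter_def by simp
  moreover have "titer (n + 1) x a = biter m x a"
  proof (cases "n + 1 = 0")
    case True
    then have "m = 0" using m by simp
    then show ?thesis using True unfolding titer_def by simp
  qed (use False m in \<open>auto simp: titer_def\<close>)
  ultimately show ?thesis by (simp only: T.B_Bi)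
qed

lemma int_iter_add: "int_iter f (n + int m) x = (f ^^ m) (int_iter f n x)"
proof (induction m)
  case (Suc m)
  then show ?case using int_iter_Suc[of "n + int m" x] by (simp add: algebra_simps)
qed simp

lemma titer_add: "titer (n + int m) x a = T.iter m (int_iter f n x) (titer n x a)"
proof (induction m)
  case (Suc m)
  then show ?case using titer_Suc[of "n + int m" x a] by (simp add: algebra_simps int_iter_add)
qed simp

lemma titer_has_derivative:
  "((cmap (chart_at A (int_iter f n x)) \<circ> int_iter f n \<circ> cinv (chart_at A x)) has_derivative titer n x) (at (cmap (chart_at A x) x))"
proof -
  note ca = chart_at[OF atlas]
  have base: "((cmap (chart_at A (id x)) \<circ> id \<circ> cinv (chart_at A x)) has_derivative (\<lambda>a. a)) (at (cmap (chart_at A x) x))"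
  proof -
    have "local_deriv (chart_at A x) (chart_at A x) id x = (\<lambda>a. a)"
      using local_deriv_same_chart[OF atlas ca] by blast
    moreover have "id x \<in> cdom (chart_at A x)" using ca(2) by simp
    note local_deriv_has_derivative[OF C1_map_id[OF atlas] ca(1)[of x] ca(1)[of x] ca(2)[of x] this]
    ultimately show ?thesis by (simp only: id_apply[of x])
  qed
  have fwd: "((cmap (chart_at A ((f ^^ m) x)) \<circ> f ^^ m \<circ> cinv (chart_at A x)) has_derivative T.iter m x) (at (cmap (chart_at A x) x))" for m
  proof (induction m)
    case 0
    have "T.iter 0 x = (\<lambda>a. a)" by (simp add: fun_eq_iff)
    then show ?case using base by (simp only: funpow.simps id_apply[of x])
  next
    case (Suc m)
    have e: "T.iter (Suc m) x = (\<lambda>a. local_deriv (chart_at A ((f ^^ m) x)) (chart_at A (f ((f ^^ m) x))) f ((f ^^ m) x) (T.iter m x a))"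
      by (simp add: fun_eq_iff manifold_B_def)
    show ?case unfolding e funpow.simps comp_apply[of f "f ^^ m" x]
      by (rule has_derivative_comp_in_charts[OF atlas continuous_on_funpow[OF C1_map_continuous[OF C1(1)]] C1(1) ca ca ca Suc])
  qed
  have bwd: "((cmap (chart_at A ((inv f ^^ m) x)) \<circ> inv f ^^ m \<circ> cinv (chart_at A x)) has_derivative biter m x) (at (cmap (chart_at A x) x))" for m
  proof (induction m)
    case 0
    have "biter 0 x = (\<lambda>a. a)" by (simp add: fun_eq_iff)
    then show ?case using base by (simp only: funpow.simps id_apply[of x])
  next
    case (Suc m)
    have e: "biter (Suc m) x = (\<lambda>a. local_deriv (chart_at A ((inv f ^^ m) x)) (chart_at A (inv f ((inv f ^^ m) x))) (inv f) ((inv f ^^ m) x) (biter m x a))"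
      by (simp add: fun_eq_iff manifold_Bi_def)
    show ?case unfolding e funpow.simps comp_apply[of "inv f" "inv f ^^ m" x]
      by (rule has_derivative_comp_in_charts[OF atlas continuous_on_funpow[OF C1_map_continuous[OF C1(2)]] C1(2) ca ca ca Suc])
  qed
  show ?thesis
  proof (cases "0 \<le> n")
    case True
    then have "int_iter f n = f ^^ nat n" "titer n x = T.iter (nat n) x" unfolding int_iter_def titer_def by (auto simp: fun_eq_iff)
    then show ?thesis using fwd by simp
  next
    case False
    then have "int_iter f n = inv f ^^ nat (- n)" "titer n x = biter (nat (- n)) x" unfolding int_iter_def titer_def by (auto simp: fun_eq_iff)
    then show ?thesis using bwd by simp
  qed
qed

text \<open>The bridge to the abstract cocycle: derivatives of iterates, taken on the manifold,
  become products of fibre maps.\<close>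

lemma norm_iter_eq: "norm_iter A g f x n v = fibre_norm A g (int_iter f n x) (titer n x (v (chart_at A x)))"
  unfolding norm_iter_def tangent_iter_def fibre_norm_def
  using tangent_map_eq_coord_vec[OF atlas continuous_on_int_iter titer_has_derivative] by simp

lemma fibre_norm_bounds: "\<exists>r>0. \<exists>R>0. \<forall>x a. r * T.fnorm x a \<le> fibre_norm A g x a \<and> fibre_norm A g x a \<le> R * T.fnorm x a"
proof (rule T.homogeneous_bounds)
  fix i assume i: "i < k"
  show "continuous_on (T.V i \<times> - {0}) (\<lambda>(x, b). fibre_norm A g x (manifold_ic A c i x b))"
    unfolding manifold_ic_def
    by (rule continuous_on_subset[OF continuous_on_fibre_norm[OF atlas g frame(1)[OF i]]]) (use T.V_subset[OF i] in auto)
qed (use fibre_norm_scaleR[OF atlas g] fibre_norm_pos[OF atlas g] in auto)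

end


subsection \<open>Expansion of the centre-unstable field and of its annihilator\<close>

definition fibres :: "('m, 'e::euclidean_space) chart set \<Rightarrow> ('m \<Rightarrow> ('m, 'e) tvec set) \<Rightarrow> 'm \<Rightarrow> 'e set" where
  "fibres A E x = (\<lambda>v. v (chart_at A x)) ` E x"

text \<open>Membership in a subspace and in its orthogonal complement become equations for the
  projection, and equations pass to the limit wherever the projections converge.\<close>

lemma closest_point_subspace:
  fixes Y :: "'e::euclidean_space set"
  assumes Y: "subspace Y"
  shows "closest_point Y a = a \<longleftrightarrow> a \<in> Y" and "closest_point Y a = 0 \<longleftrightarrow> (\<forall>y\<in>Y. a \<bullet> y = 0)"
proof -
  have cl: "closed Y" "Y \<noteq> {}" using Y closed_subspace subspace_0 by auto
  show "closest_point Y a = a \<longleftrightarrow> a \<in> Y" using closest_point_self blinfun_apply_orth_proj(2)[OF Y, of a] by metis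
  note o = blinfun_apply_orth_proj(3)[OF Y, of _ a, unfolded orthogonal_def]
  show "closest_point Y a = 0 \<longleftrightarrow> (\<forall>y\<in>Y. a \<bullet> y = 0)"
  proof
    assume "closest_point Y a = 0"
    then show "\<forall>y\<in>Y. a \<bullet> y = 0" using o by simp
  next
    let ?p = "closest_point Y a"
    assume "\<forall>y\<in>Y. a \<bullet> y = 0"
    then have "a \<bullet> ?p = 0" "(a - ?p) \<bullet> ?p = 0" using blinfun_apply_orth_proj(2)[OF Y, of a] o by auto
    then show "?p = 0" by (simp add: inner_diff_left)
  qed
qed

context manifold_cocycle
begin

context
  fixes E
  assumes E: "subspace_field A E"
begin

lemma chart_image_fibres:
  assumes "i < k" "x \<in> cdom (c i)"
  shows "(\<lambda>v. v (c i)) ` E x = manifold_co A c i x ` fibres A E x"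
proof -
  have "v (c i) = manifold_co A c i x (v (chart_at A x))" if "v \<in> E x" for v
  proof -
    have "v \<in> tangent_space A x" using E that unfolding subspace_field_def by blast
    from tangent_spaceD(1)[OF this chart_at(1)[OF atlas] frame(1)[OF assms(1)] chart_at(2)[OF atlas] assms(2)]
    show ?thesis unfolding manifold_co_def .
  qed
  then show ?thesis unfolding fibres_def image_image by (rule image_cong[OF refl])
qed

lemma subspace_fibres: "subspace (fibres A E x)"
  unfolding fibres_def
  by (rule linear_subspace_image[OF _ conjunct1[OF E[unfolded subspace_field_def, rule_format]]])
    (auto intro!: linearI simp: scaleR_fun_def)

lemma fibres_iff: "a \<in> fibres A E x \<longleftrightarrow> coord_vec A (chart_at A x) x a \<in> E x"
proof
  have ET: "E x \<subseteq> tangent_space A x" using E unfolding subspace_field_def by blast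
  show "coord_vec A (chart_at A x) x a \<in> E x" if "a \<in> fibres A E x"
    using that ET coord_vec_of_coordinate[OF atlas chart_at[OF atlas]] unfolding fibres_def by fastforce
  show "a \<in> fibres A E x" if "coord_vec A (chart_at A x) x a \<in> E x"
    unfolding fibres_def by (rule rev_image_eqI[OF that]) (rule coord_vec_coordinate[OF atlas chart_at[OF atlas], symmetric])
qed

lemma manifold_B_fibres:
  assumes "\<And>x. tangent_map A f x ` E x = E (f x)"
  shows "manifold_B A f x ` fibres A E x = fibres A E (f x)"
proof -
  have "tangent_map A f x v (chart_at A (f x)) = manifold_B A f x (v (chart_at A x))" for v
    unfolding tangent_map_def manifold_B_def using chart_at[OF atlas, of "f x"] by simp
  then show ?thesis unfolding fibres_def assms[symmetric] image_image by simp
qed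

lemma field_in_chart_fibres:
  assumes "i < k" "x \<in> cdom (c i)"
  shows "blinfun_apply (field_in_chart (c i) E x) = closest_point (manifold_co A c i x ` fibres A E x)"
    "subspace (manifold_co A c i x ` fibres A E x)"
proof -
  show s: "subspace (manifold_co A c i x ` fibres A E x)"
    by (rule linear_subspace_image[OF T.lin_co[OF assms] subspace_fibres])
  show "blinfun_apply (field_in_chart (c i) E x) = closest_point (manifold_co A c i x ` fibres A E x)"
    unfolding field_in_chart_def chart_image_fibres[OF assms] by (rule blinfun_apply_orth_proj(1)[OF s])
qed

lemma field_limit:
  assumes x: "field_continuous_at A E x" and i: "i < k" "x \<in> cdom (c i)"
    and X: "X \<longlonglongrightarrow> x" and b: "b \<longlonglongrightarrow> d"
  shows "(\<lambda>n. blinfun_apply (field_in_chart (c i) E (X n)) (b n)) \<longlonglongrightarrow> blinfun_apply (field_in_chart (c i) E x) d"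
proof -
  have "isCont (field_in_chart (c i) E) x" using x frame(1)[OF i(1)] i(2) unfolding field_continuous_at_def by blast
  from isCont_tendsto_compose[OF this X] show ?thesis by (intro tendsto_intros b)
qed

end

lemma ic_mem_fibres_iff:
  assumes E: "subspace_field A E" and i: "i < k" "x \<in> cdom (c i)"
  shows "manifold_ic A c i x a \<in> fibres A E x \<longleftrightarrow> blinfun_apply (field_in_chart (c i) E x) a = a"
proof -
  have "manifold_ic A c i x a \<in> fibres A E x \<longleftrightarrow> a \<in> manifold_co A c i x ` fibres A E x"
  proof
    show "a \<in> manifold_co A c i x ` fibres A E x" if "manifold_ic A c i x a \<in> fibres A E x"
      by (rule rev_image_eqI[OF that]) (rule T.co_ic[OF i, symmetric])
    show "manifold_ic A c i x a \<in> fibres A E x" if "a \<in> manifold_co A c i x ` fibres A E x"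
      using that T.ic_co[OF i] by auto
  qed
  then show ?thesis
    unfolding field_in_chart_fibres(1)[OF E i] closest_point_subspace(1)[OF field_in_chart_fibres(2)[OF E i]] .
qed

text \<open>In dual coordinates the annihilator is the kernel of the projection onto the field. It
  is therefore closed at every point where the field is continuous.\<close>

lemma adjoint_co_annihilates_iff:
  assumes E: "subspace_field A E" and i: "i < k" "x \<in> cdom (c i)"
  shows "adjoint (manifold_co A c i x) b \<in> T.annihilator (fibres A E) x \<longleftrightarrow>
    blinfun_apply (field_in_chart (c i) E x) b = 0"
proof -
  have "adjoint (manifold_co A c i x) b \<bullet> a = b \<bullet> manifold_co A c i x a" for a
    using adjoint_works[OF T.lin_co[OF i], of a b] by (simp add: inner_commute)
  then have "adjoint (manifold_co A c i x) b \<in> T.annihilator (fibres A E) x \<longleftrightarrow>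
      (\<forall>y\<in>manifold_co A c i x ` fibres A E x. b \<bullet> y = 0)"
    unfolding T.annihilator_def by simp
  then show ?thesis
    unfolding field_in_chart_fibres(1)[OF E i] closest_point_subspace(2)[OF field_in_chart_fibres(2)[OF E i]] .
qed

lemma norm_iter_fibres:
  assumes E: "subspace_field A E" and a: "a \<in> fibres A E x" "a \<noteq> 0"
  obtains v where "v \<in> E x" "rnorm g x v = 1"
    "\<And>n. norm_iter A g f x (int n) v = fibre_norm A g ((f ^^ n) x) (T.iter n x a) / fibre_norm A g x a"
proof
  let ?r = "inverse (fibre_norm A g x a)"
  have p: "0 < fibre_norm A g x a" by (rule fibre_norm_pos[OF atlas g a(2)])
  define v where "v = coord_vec A (chart_at A x) x (?r *\<^sub>R a)"
  show "v \<in> E x"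
    unfolding v_def using fibres_iff[OF E] subspace_scale[OF subspace_fibres[OF E] a(1)] by blast
  have "rnorm g x v = fibre_norm A g x (?r *\<^sub>R a)" unfolding v_def fibre_norm_def ..
  then show "rnorm g x v = 1" unfolding fibre_norm_scaleR[OF atlas g] using p by simp
  have "v (chart_at A x) = ?r *\<^sub>R a" unfolding v_def by (rule coord_vec_coordinate[OF atlas chart_at[OF atlas]])
  then show "norm_iter A g f x (int n) v = fibre_norm A g ((f ^^ n) x) (T.iter n x a) / fibre_norm A g x a" for n
    unfolding norm_iter_eq titer_def int_iter_def using p
    by (simp add: linear_scale[OF T.linear_iter] fibre_norm_scaleR[OF atlas g] divide_inverse mult.commute)
qed

lemma fibre_norm_measurable:
  assumes i: "i < k"
  shows "(\<lambda>(x, b). fibre_norm A g x (manifold_ic A c i x b)) \<in> borel_measurable (restrict_space borel (cdom (c i) \<times> UNIV))"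
  unfolding manifold_ic_def
  by (intro borel_measurable_continuous_on_restrict continuous_on_fibre_norm[OF atlas g] frame(1) i)

text \<open>Here the measurable norm is the Riemannian one. Vectors of the field are fixed by the
  projections, so their limits at a continuity point are fixed too; a number strictly between 1 and
  the lower limit supplies the gain.\<close>

lemma unstable_uniform_growth:
  assumes E: "subspace_field A E" and fE: "\<And>x. tangent_map A f x ` E x = E (f x)"
    and cont: "\<forall>\<mu>\<in>invariant_measures f. AE x in \<mu>. field_continuous_at A E x"
    and exp: "\<forall>\<mu>\<in>invariant_measures f. AE x in \<mu>. \<forall>v\<in>E x. rnorm g x v = 1 \<longrightarrow>
           liminf (\<lambda>n::nat. ereal (norm_iter A g f x (int n) v)) > 1"
  shows "\<exists>n. \<forall>x. \<forall>a\<in>fibres A E x. C * T.fnorm x a \<le> T.fnorm ((f ^^ n) x) (T.iter n x a)"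
proof (rule T.subbundle_uniform_growth[where q = "fibre_norm A g"])
  show "manifold_B A f x a \<in> fibres A E (f x)" if "a \<in> fibres A E x" for x a
    using manifold_B_fibres[OF E fE, of x] that by blast
  show "r *\<^sub>R a \<in> fibres A E x" if "a \<in> fibres A E x" for x a r
    by (rule subspace_scale[OF subspace_fibres[OF E] that])
  show "fibre_norm A g x (r *\<^sub>R a) = \<bar>r\<bar> * fibre_norm A g x a" for x r a by (rule fibre_norm_scaleR[OF atlas g])
  fix \<mu> assume \<mu>: "\<mu> \<in> invariant_measures f"
  from bspec[OF cont \<mu>] bspec[OF exp \<mu>]
  show "AE x in \<mu>.
      (\<forall>i<k. x \<in> cdom (c i) \<longrightarrow> (\<forall>X b d. (\<forall>n. X n \<in> cdom (c i) \<and> manifold_ic A c i (X n) (b n) \<in> fibres A E (X n)) \<longrightarrow>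
        X \<longlonglongrightarrow> x \<longrightarrow> b \<longlonglongrightarrow> d \<longrightarrow> manifold_ic A c i x d \<in> fibres A E x)) \<and>
      (\<forall>a\<in>fibres A E x. a \<noteq> 0 \<longrightarrow> 0 < fibre_norm A g x a \<and> (\<exists>\<epsilon>>0. \<forall>\<^sub>F n in sequentially.
        (1 + \<epsilon>) * fibre_norm A g x a \<le> fibre_norm A g ((f ^^ n) x) (T.iter n x a)))"
  proof eventually_elim
    case (elim x)
    show ?case
    proof (intro conjI allI impI ballI)
      fix i X b d
      assume i: "i < k" "x \<in> cdom (c i)" and X: "X \<longlonglongrightarrow> x" and b: "b \<longlonglongrightarrow> d"
        and mem: "\<forall>n. X n \<in> cdom (c i) \<and> manifold_ic A c i (X n) (b n) \<in> fibres A E (X n)"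
      have "blinfun_apply (field_in_chart (c i) E (X n)) (b n) = b n" for n
        using mem ic_mem_fibres_iff[OF E i(1)] by blast
      then have "b \<longlonglongrightarrow> blinfun_apply (field_in_chart (c i) E x) d"
        using field_limit[OF E elim(1) i X b] by simp
      then have "blinfun_apply (field_in_chart (c i) E x) d = d" using b LIMSEQ_unique by blast
      then show "manifold_ic A c i x d \<in> fibres A E x" using ic_mem_fibres_iff[OF E i] by blast
    next
      fix a assume a: "a \<in> fibres A E x" "a \<noteq> 0"
      show p: "0 < fibre_norm A g x a" by (rule fibre_norm_pos[OF atlas g a(2)])
      obtain v where v: "v \<in> E x" "rnorm g x v = 1"
        "\<And>n. norm_iter A g f x (int n) v = fibre_norm A g ((f ^^ n) x) (T.iter n x a) / fibre_norm A g x a"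
        using norm_iter_fibres[OF E a] by blast
      obtain r where r: "1 < ereal r" "ereal r < liminf (\<lambda>n::nat. ereal (norm_iter A g f x (int n) v))"
        using ereal_dense2 elim(2) v(1,2) by blast
      have "\<forall>\<^sub>F n in sequentially. ereal r < ereal (norm_iter A g f x (int n) v)" by (rule less_LiminfD[OF r(2)])
      then have "\<forall>\<^sub>F n in sequentially. (1 + (r - 1)) * fibre_norm A g x a \<le> fibre_norm A g ((f ^^ n) x) (T.iter n x a)"
        by eventually_elim (use p in \<open>simp add: v(3) field_simps\<close>)
      then show "\<exists>\<epsilon>>0. \<forall>\<^sub>F n in sequentially. (1 + \<epsilon>) * fibre_norm A g x a \<le> fibre_norm A g ((f ^^ n) x) (T.iter n x a)"
        using r(1) by (intro exI[of _ "r - 1"]) auto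
    qed
  qed
qed (rule fibre_norm_measurable)

text \<open>On the annihilator of a complement of \<open>E x\<close> this is a norm, and the contraction along \<open>E\<close> makes it
  expand under the dual cocycle; \<open>s = 0\<close> contributes \<open>0 / 0 = 0\<close>.\<close>

definition restr_norm :: "('m \<Rightarrow> ('m, 'e) tvec set) \<Rightarrow> 'm \<Rightarrow> 'e \<Rightarrow> real" where
  "restr_norm E x b = Sup ((\<lambda>s. \<bar>b \<bullet> s\<bar> / fibre_norm A g x s) ` fibres A E x)"

lemma fibre_norm_ge_norm: "\<exists>K>0. \<forall>a. K * norm a \<le> fibre_norm A g x a"
proof -
  obtain r where r: "0 < r" "\<And>x a. r * T.fnorm x a \<le> fibre_norm A g x a" using fibre_norm_bounds by blast
  obtain K where K: "0 < K" "\<And>a. K * norm a \<le> T.fnorm x a" using T.fnorm_comparable_norm[of x] by blast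
  have "r * K * norm a \<le> fibre_norm A g x a" for a
    using order_trans[OF mult_left_mono[OF K(2)[of a], of r] r(2)[of x a]] r(1) by (simp add: mult.assoc)
  then show ?thesis using r(1) K(1) by (intro exI[of _ "r * K"]) simp
qed

lemma fibre_norm_nonneg: "0 \<le> fibre_norm A g x a"
  using fibre_norm_pos[OF atlas g, of a x] fibre_norm_scaleR[OF atlas g, of x 0 0] by (cases "a = 0") auto

lemma restr_norm_bdd: "bdd_above ((\<lambda>s. \<bar>b \<bullet> s\<bar> / fibre_norm A g x s) ` Y)"
proof -
  obtain K where K: "0 < K" "\<And>a. K * norm a \<le> fibre_norm A g x a" using fibre_norm_ge_norm by blast
  have "\<bar>b \<bullet> s\<bar> / fibre_norm A g x s \<le> norm b / K" for s
  proof (cases "s = 0")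
    case False
    have "\<bar>b \<bullet> s\<bar> * K \<le> norm b * norm s * K" using Cauchy_Schwarz_ineq2 K(1) by (simp add: mult_right_mono)
    also have "\<dots> = norm b * (K * norm s)" by simp
    also have "\<dots> \<le> norm b * fibre_norm A g x s" by (intro mult_left_mono K(2)) simp
    finally show ?thesis using fibre_norm_pos[OF atlas g False] K(1) by (simp add: field_simps)
  qed (use K(1) in simp)
  then show ?thesis by (intro bdd_aboveI2)
qed

lemma restr_norm_upper: "s \<in> fibres A E x \<Longrightarrow> \<bar>b \<bullet> s\<bar> / fibre_norm A g x s \<le> restr_norm E x b"
  unfolding restr_norm_def by (rule cSUP_upper[OF _ restr_norm_bdd])

lemma restr_norm_least:
  assumes "subspace_field A E" "\<And>s. s \<in> fibres A E x \<Longrightarrow> \<bar>b \<bullet> s\<bar> / fibre_norm A g x s \<le> r"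
  shows "restr_norm E x b \<le> r"
  unfolding restr_norm_def by (rule cSUP_least) (use assms subspace_0[OF subspace_fibres] in auto)

lemma restr_norm_scaleR:
  assumes E: "subspace_field A E"
  shows "restr_norm E x (r *\<^sub>R b) = \<bar>r\<bar> * restr_norm E x b"
proof -
  have le: "restr_norm E x (r *\<^sub>R b) \<le> \<bar>r\<bar> * restr_norm E x b" for r b
  proof (rule restr_norm_least[OF E])
    fix s assume "s \<in> fibres A E x"
    from mult_left_mono[OF restr_norm_upper[OF this, of b], of "\<bar>r\<bar>"]
    show "\<bar>(r *\<^sub>R b) \<bullet> s\<bar> / fibre_norm A g x s \<le> \<bar>r\<bar> * restr_norm E x b" by (simp add: abs_mult)
  qed
  show ?thesis
  proof (cases "r = 0")
    case True
    have "0 \<in> fibres A E x" by (rule subspace_0[OF subspace_fibres[OF E]])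
    from restr_norm_upper[OF this, of 0] show ?thesis using le[of 0 b] True by simp
  next
    case False
    then have "restr_norm E x b \<le> restr_norm E x (r *\<^sub>R b) / \<bar>r\<bar>"
      using le[of "inverse r" "r *\<^sub>R b"] by (simp add: divide_inverse mult.commute)
    then have "\<bar>r\<bar> * restr_norm E x b \<le> restr_norm E x (r *\<^sub>R b)" using False by (simp add: field_simps)
    then show ?thesis using le[of r b] by simp
  qed
qed

lemma continuous_on_fibre_norm_ic:
  assumes i: "i < k" "x \<in> cdom (c i)"
  shows "continuous_on UNIV (\<lambda>u. fibre_norm A g x (manifold_ic A c i x u))"
proof -
  have "continuous_on UNIV (\<lambda>u. (\<lambda>(x, b). fibre_norm A g x (manifold_ic A c i x b)) (x, u))"
    unfolding manifold_ic_def
    by (rule continuous_on_compose2[OF continuous_on_fibre_norm[OF atlas g frame(1)[OF i(1)]]])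
      (use i(2) in \<open>auto intro!: continuous_intros\<close>)
  then show ?thesis by simp
qed

lemma continuous_on_fibre_norm_fibre: "continuous_on UNIV (fibre_norm A g x)"
proof -
  obtain i where i: "i < k" "x \<in> cdom (c i)" using T.V_cover T.V_subset by blast
  have "continuous_on UNIV (manifold_co A c i x)"
    using T.lin_co[OF i] linear_conv_bounded_linear linear_continuous_on by blast
  then have "continuous_on UNIV (\<lambda>a. fibre_norm A g x (manifold_ic A c i x (manifold_co A c i x a)))"
    by (rule continuous_on_compose2[OF continuous_on_fibre_norm_ic[OF i]]) simp
  then show ?thesis by (simp add: T.ic_co[OF i])
qed

text \<open>The rate of contraction in the hypothesis depends on the vector. A maximising vector
  reduces the growth of the supremum to the contraction of this one vector.\<close>

lemma restr_norm_attained: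
  assumes E: "subspace_field A E" and s: "s \<in> fibres A E x" "s \<noteq> 0"
  obtains u where "u \<in> fibres A E x" "u \<noteq> 0" "restr_norm E x b = \<bar>b \<bullet> u\<bar> / fibre_norm A g x u"
proof -
  let ?K = "fibres A E x \<inter> sphere 0 1" and ?q = "\<lambda>s. \<bar>b \<bullet> s\<bar> / fibre_norm A g x s"
  have sub: "subspace (fibres A E x)" by (rule subspace_fibres[OF E])
  have K: "compact ?K" using closed_subspace[OF sub] by (simp add: closed_Int_compact)
  have normed: "s /\<^sub>R norm s \<in> ?K \<and> ?q (s /\<^sub>R norm s) = ?q s" if "s \<in> fibres A E x" "s \<noteq> 0" for s
    using that subspace_scale[OF sub that(1)] by (simp add: fibre_norm_scaleR[OF atlas g] abs_mult)
  have "fibre_norm A g x s \<noteq> 0" if "s \<in> ?K" for s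
    using fibre_norm_pos[OF atlas g, of s x] that by fastforce
  then have "continuous_on ?K ?q"
    by (intro continuous_intros continuous_on_subset[OF continuous_on_fibre_norm_fibre]) auto
  moreover have "?K \<noteq> {}" using normed[OF s] by blast
  ultimately have "\<exists>u\<in>?K. \<forall>s\<in>?K. ?q s \<le> ?q u" using K by (intro continuous_attains_sup)
  then obtain u where u: "u \<in> ?K" "\<forall>s\<in>?K. ?q s \<le> ?q u" by blast
  have "restr_norm E x b \<le> ?q u"
  proof (rule restr_norm_least[OF E])
    fix s assume s: "s \<in> fibres A E x"
    show "?q s \<le> ?q u"
    proof (cases "s = 0")
      case False
      then show ?thesis using normed[OF s False] u(2) by metis
    qed (simp add: fibre_norm_nonneg)
  qed
  moreover have "?q u \<le> restr_norm E x b" by (rule restr_norm_upper) (use u in blast)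
  ultimately show thesis using that[of u] u(1) by force
qed

text \<open>The supremum runs over a fibre that varies with \<open>x\<close>. Projecting a fixed
  countable dense set to the fibre turns it into a countable supremum of measurable functions;
  nothing is lost, because the quotient is continuous away from the zero vector.\<close>

lemma restr_norm_measurable:
  assumes E: "subspace_field A E" and meas: "field_measurable A E" and i: "i < k"
  shows "(\<lambda>(x, b). restr_norm E x (adjoint (manifold_co A c i x) b)) \<in> borel_measurable (restrict_space borel (cdom (c i) \<times> UNIV))"
proof -
  obtain Q :: "'e set" where Q: "countable Q" "\<And>X. open X \<Longrightarrow> X \<noteq> {} \<Longrightarrow> \<exists>d\<in>Q. d \<in> X"
    using countable_dense_setE by blast
  then have Qne: "Q \<noteq> {}" using open_UNIV by blast
  let ?P = "\<lambda>x. blinfun_apply (field_in_chart (c i) E x)"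
  let ?q = "\<lambda>x b d. \<bar>b \<bullet> ?P x d\<bar> / fibre_norm A g x (manifold_ic A c i x (?P x d))"
  have tm: "\<exists>s\<in>fibres A E x. ?P x d = manifold_co A c i x s \<and> manifold_ic A c i x (?P x d) = s \<and>
      ?q x b d = \<bar>adjoint (manifold_co A c i x) b \<bullet> s\<bar> / fibre_norm A g x s"
    if x: "x \<in> cdom (c i)" for x b d
  proof -
    obtain s where s: "s \<in> fibres A E x" "?P x d = manifold_co A c i x s"
      using blinfun_apply_orth_proj(2)[OF field_in_chart_fibres(2)[OF E i x], of d]
      unfolding field_in_chart_fibres(1)[OF E i x] by blast
    moreover have "adjoint (manifold_co A c i x) b \<bullet> s = b \<bullet> manifold_co A c i x s"
      using adjoint_works[OF T.lin_co[OF i x], of s b] by (simp add: inner_commute)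
    ultimately show ?thesis using T.ic_co[OF i x] by (intro bexI[of _ s]) simp_all
  qed
  have bdd: "bdd_above ((\<lambda>d. ?q x b d) ` Q)" if x: "x \<in> cdom (c i)" for x b
  proof -
    have "(\<lambda>d. ?q x b d) ` Q \<subseteq> (\<lambda>s. \<bar>adjoint (manifold_co A c i x) b \<bullet> s\<bar> / fibre_norm A g x s) ` fibres A E x"
      using tm[OF x, of _ b] by blast
    then show ?thesis by (rule bdd_above_mono[OF restr_norm_bdd])
  qed
  have eq: "restr_norm E x (adjoint (manifold_co A c i x) b) = (SUP d\<in>Q. ?q x b d)" if x: "x \<in> cdom (c i)" for x b
  proof (rule antisym)
    show "(SUP d\<in>Q. ?q x b d) \<le> restr_norm E x (adjoint (manifold_co A c i x) b)"
      by (rule cSUP_least[OF Qne]) (use tm[OF x, of _ b] restr_norm_upper in metis)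
    show "restr_norm E x (adjoint (manifold_co A c i x) b) \<le> (SUP d\<in>Q. ?q x b d)"
    proof (rule restr_norm_least[OF E])
      fix s assume s: "s \<in> fibres A E x"
      let ?u = "manifold_co A c i x s"
      have Pu: "?P x ?u = ?u" using ic_mem_fibres_iff[OF E i x, of ?u] s T.ic_co[OF i x] by simp
      have su: "\<bar>adjoint (manifold_co A c i x) b \<bullet> s\<bar> / fibre_norm A g x s = ?q x b ?u"
        using adjoint_works[OF T.lin_co[OF i x], of s b] by (simp add: Pu T.ic_co[OF i x] inner_commute)
      show "\<bar>adjoint (manifold_co A c i x) b \<bullet> s\<bar> / fibre_norm A g x s \<le> (SUP d\<in>Q. ?q x b d)"
      \<comment> \<open>At 0 the quotient is not continuous, but its value there is the default 0,
        below every other value.\<close>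
      proof (cases "s = 0")
        case True
        obtain d where d: "d \<in> Q" using Qne by blast
        have "0 \<le> ?q x b d" by (simp add: fibre_norm_nonneg)
        also have "\<dots> \<le> (SUP d\<in>Q. ?q x b d)" by (rule cSUP_upper[OF d bdd[OF x]])
        finally show ?thesis using True by simp
      next
        case False
        show ?thesis
        proof (rule ccontr)
          assume "\<not> ?thesis"
          then have less: "(SUP d\<in>Q. ?q x b d) < ?q x b ?u" unfolding su by simp
          have nz: "fibre_norm A g x (manifold_ic A c i x (?P x ?u)) \<noteq> 0"
            unfolding Pu T.ic_co[OF i x] using fibre_norm_pos[OF atlas g False, of x] by simp
          have "continuous_on UNIV (\<lambda>d. fibre_norm A g x (manifold_ic A c i x (?P x d)))"
            by (rule continuous_on_compose2[OF continuous_on_fibre_norm_ic[OF i x]]) (auto intro!: continuous_intros)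
          then have "isCont (\<lambda>d. fibre_norm A g x (manifold_ic A c i x (?P x d))) ?u"
            by (simp add: continuous_on_eq_continuous_at)
          then have "isCont (\<lambda>d. ?q x b d) ?u" by (intro continuous_intros) (use nz in auto)
          from order_tendstoD(1)[OF this[unfolded isCont_def] less] less
          have "\<forall>\<^sub>F d in nhds ?u. (SUP d\<in>Q. ?q x b d) < ?q x b d"
            unfolding eventually_nhds_conv_at by (rule conjI)
          then obtain X where X: "open X" "?u \<in> X" "\<And>d. d \<in> X \<Longrightarrow> (SUP d\<in>Q. ?q x b d) < ?q x b d"
            unfolding eventually_nhds by blast
          obtain d where "d \<in> Q" "d \<in> X" using Q(2)[OF X(1)] X(2) by blast
          then show False using X(3) cSUP_upper[OF _ bdd[OF x]] by (meson not_le)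
        qed
      qed
    qed
  qed
  let ?M = "restrict_space borel (cdom (c i) \<times> (UNIV :: 'e set))"
  have sp: "space ?M = cdom (c i) \<times> UNIV" by (simp add: space_restrict_space)
  have fst: "fst \<in> measurable ?M (restrict_space borel (cdom (c i)))"
  proof (rule measurable_restrict_space2)
    show "fst \<in> space ?M \<rightarrow> cdom (c i)" unfolding sp by auto
    show "fst \<in> borel_measurable ?M" by (intro measurable_restrict_space1 borel_measurable_continuous_onI continuous_on_fst continuous_on_id)
  qed
  have snd: "snd \<in> borel_measurable ?M"
    by (intro measurable_restrict_space1 borel_measurable_continuous_onI continuous_on_snd continuous_on_id)
  have "field_in_chart (c i) E \<in> borel_measurable (restrict_space borel (cdom (c i)))"
    using meas frame(1)[OF i] unfolding field_measurable_def by blast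
  from measurable_compose[OF fst this]
  have F: "(\<lambda>p. field_in_chart (c i) E (fst p)) \<in> borel_measurable ?M" .
  have P: "(\<lambda>p. ?P (fst p) d) \<in> borel_measurable ?M" for d
    by (rule measurable_compose[OF F borel_measurable_continuous_onI]) (intro continuous_intros)
  have q: "(\<lambda>p. ?q (fst p) (snd p) d) \<in> borel_measurable ?M" for d
  proof -
    have "(\<lambda>p. (fst p, ?P (fst p) d)) \<in> borel_measurable ?M"
      by (intro borel_measurable_Pair P measurable_restrict_space1 borel_measurable_continuous_onI continuous_on_fst continuous_on_id)
    then have "(\<lambda>p. (fst p, ?P (fst p) d)) \<in> measurable ?M ?M"
      by (rule measurable_restrict_space2[rotated]) (auto simp: sp)
    from measurable_compose[OF this fibre_norm_measurable[OF i]]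
    have "(\<lambda>p. fibre_norm A g (fst p) (manifold_ic A c i (fst p) (?P (fst p) d))) \<in> borel_measurable ?M" by simp
    moreover have "(\<lambda>p. \<bar>snd p \<bullet> ?P (fst p) d\<bar>) \<in> borel_measurable ?M"
      by (intro borel_measurable_abs borel_measurable_inner snd P)
    ultimately show ?thesis by (intro borel_measurable_divide)
  qed
  have "(\<lambda>p. SUP d\<in>Q. ?q (fst p) (snd p) d) \<in> borel_measurable ?M"
    by (rule borel_measurable_cSUP[OF Q(1) q]) (use bdd sp in auto)
  moreover have "(SUP d\<in>Q. ?q (fst p) (snd p) d) = (\<lambda>(x, b). restr_norm E x (adjoint (manifold_co A c i x) b)) p"
    if "p \<in> space ?M" for p using that eq unfolding sp by (auto simp: case_prod_beta')
  ultimately show ?thesis by (simp cong: measurable_cong)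
qed

end

context bundle_cocycle
begin

text \<open>Growth by 4 in no steps forces the fibres of \<open>W\<close> to be trivial, and then a
  single step serves as well. A positive block length is needed later for the root that defines the
  rate.\<close>

lemma iter_growth_pos:
  assumes g: "\<And>x a. a \<in> W x \<Longrightarrow> 4 * fnorm x a \<le> fnorm ((f ^^ n) x) (iter n x a)"
  shows "\<exists>n>0. \<forall>x. \<forall>a\<in>W x. 4 * fnorm x a \<le> fnorm ((f ^^ n) x) (iter n x a)"
proof (cases "n = 0")
  case True
  have "a = 0" if "a \<in> W x" for x a
    using g[OF that] True fnorm_pos[of a x] by (cases "a = 0") auto
  then have "4 * fnorm x a \<le> fnorm ((f ^^ 1) x) (iter 1 x a)" if "a \<in> W x" for x a
    using that fnorm_0 fnorm_nonneg by (metis mult_zero_right)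
  then show ?thesis by blast
qed (use g in blast)

end

context manifold_cocycle
begin

text \<open>Covectors of the annihilator are measured on \<open>E\<close>. If the vector that
  realises this norm of b is eventually shrunk below r times its length, then, the pairing being
  preserved, its image shows that the norm of the iterated covector is at least 1 / r times the
  initial one.\<close>

lemma annihilator_uniform_growth:
  assumes E: "subspace_field A E" and fE: "\<And>x. tangent_map A f x ` E x = E (f x)"
    and F: "subspace_field A F" and fF: "\<And>x. tangent_map A f x ` F x = F (f x)"
    and span: "\<And>x a. \<exists>s\<in>fibres A E x. \<exists>w\<in>fibres A F x. a = s + w"
    and meas: "field_measurable A E"
    and cont: "\<forall>\<mu>\<in>invariant_measures f. AE x in \<mu>. field_continuous_at A F x"
    and contr: "\<forall>\<mu>\<in>invariant_measures f. AE x in \<mu>. \<forall>v\<in>E x. rnorm g x v = 1 \<longrightarrow>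
           limsup (\<lambda>n::nat. ereal (norm_iter A g f x (int n) v)) < 1"
  shows "\<exists>n. \<forall>x. \<forall>b\<in>T.annihilator (fibres A F) x. C * T.D.fnorm x b \<le> T.D.fnorm ((f ^^ n) x) (T.D.iter n x b)"
proof (rule T.D.subbundle_uniform_growth[where q = "restr_norm E"])
  show "adjoint (manifold_Bi A f x) b \<in> T.annihilator (fibres A F) (f x)" if "b \<in> T.annihilator (fibres A F) x" for x b
    by (rule T.annihilator_invariant[OF manifold_B_fibres[OF F fF] that])
  show "r *\<^sub>R b \<in> T.annihilator (fibres A F) x" if "b \<in> T.annihilator (fibres A F) x" for x b r
    using that unfolding T.annihilator_def by simp
  show "restr_norm E x (r *\<^sub>R b) = \<bar>r\<bar> * restr_norm E x b" for x r b by (rule restr_norm_scaleR[OF E])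
  show "(\<lambda>(x, b). restr_norm E x (adjoint (manifold_co A c i x) b)) \<in> borel_measurable (restrict_space borel (cdom (c i) \<times> UNIV))"
    if "i < k" for i by (rule restr_norm_measurable[OF E meas that])
  fix \<mu> assume \<mu>: "\<mu> \<in> invariant_measures f"
  from bspec[OF cont \<mu>] bspec[OF contr \<mu>]
  show "AE x in \<mu>.
      (\<forall>i<k. x \<in> cdom (c i) \<longrightarrow> (\<forall>X b d. (\<forall>n. X n \<in> cdom (c i) \<and> adjoint (manifold_co A c i (X n)) (b n) \<in> T.annihilator (fibres A F) (X n)) \<longrightarrow>
        X \<longlonglongrightarrow> x \<longrightarrow> b \<longlonglongrightarrow> d \<longrightarrow> adjoint (manifold_co A c i x) d \<in> T.annihilator (fibres A F) x)) \<and>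
      (\<forall>b\<in>T.annihilator (fibres A F) x. b \<noteq> 0 \<longrightarrow> 0 < restr_norm E x b \<and> (\<exists>\<epsilon>>0. \<forall>\<^sub>F n in sequentially.
        (1 + \<epsilon>) * restr_norm E x b \<le> restr_norm E ((f ^^ n) x) (T.D.iter n x b)))"
  proof eventually_elim
    case (elim x)
    show ?case
    proof (intro conjI allI impI ballI)
      fix i X b d
      assume i: "i < k" "x \<in> cdom (c i)" and X: "X \<longlonglongrightarrow> x" and b: "b \<longlonglongrightarrow> d"
        and mem: "\<forall>n. X n \<in> cdom (c i) \<and> adjoint (manifold_co A c i (X n)) (b n) \<in> T.annihilator (fibres A F) (X n)"
      have "blinfun_apply (field_in_chart (c i) F (X n)) (b n) = 0" for n
        using mem adjoint_co_annihilates_iff[OF F i(1)] by blast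
      then have "blinfun_apply (field_in_chart (c i) F x) d = 0"
        using field_limit[OF F elim(1) i X b] by (simp add: LIMSEQ_const_iff)
      then show "adjoint (manifold_co A c i x) d \<in> T.annihilator (fibres A F) x"
        using adjoint_co_annihilates_iff[OF F i] by blast
    next
      fix b assume b: "b \<in> T.annihilator (fibres A F) x" "b \<noteq> 0"
      \<comment> \<open>Covectors are identified with vectors by the inner product of the fibre
        coordinates, so b itself can be split. Its pairing with s is then the square of its length,
        so b does not vanish on \<open>E\<close>.\<close>
      obtain s w where sw: "s \<in> fibres A E x" "w \<in> fibres A F x" "b = s + w" using span by blast
      have "b \<bullet> w = 0" using b(1) sw(2) unfolding T.annihilator_def by blast
      then have "b \<bullet> s = b \<bullet> b" using sw(3) by (metis add.right_neutral inner_add_right)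
      then have bs: "b \<bullet> s \<noteq> 0" using b(2) by simp
      then have s0: "s \<noteq> 0" by auto
      have "0 < \<bar>b \<bullet> s\<bar> / fibre_norm A g x s" using bs fibre_norm_pos[OF atlas g s0, of x] by simp
      then show p: "0 < restr_norm E x b" using restr_norm_upper[OF sw(1), of b] by linarith
      obtain u where u: "u \<in> fibres A E x" "u \<noteq> 0" "restr_norm E x b = \<bar>b \<bullet> u\<bar> / fibre_norm A g x u"
        using restr_norm_attained[OF E sw(1) s0] .
      obtain v where v: "v \<in> E x" "rnorm g x v = 1"
        "\<And>n. norm_iter A g f x (int n) v = fibre_norm A g ((f ^^ n) x) (T.iter n x u) / fibre_norm A g x u"
        using norm_iter_fibres[OF E u(1,2)] by blast
      obtain r where r: "limsup (\<lambda>n::nat. ereal (norm_iter A g f x (int n) v)) < ereal r" "ereal r < 1"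
        using ereal_dense2 elim(2) v(1,2) by blast
      have ev: "\<forall>\<^sub>F n in sequentially. ereal (norm_iter A g f x (int n) v) < ereal r" by (rule Limsup_lessD[OF r(1)])
      have Nu: "0 < fibre_norm A g x u" by (rule fibre_norm_pos[OF atlas g u(2)])
      have Nn: "0 < fibre_norm A g ((f ^^ n) x) (T.iter n x u)" for n
        using fibre_norm_pos[OF atlas g] u(2) T.iter_eq_0_iff by blast
      \<comment> \<open>The expansion factor is the reciprocal of r; that r is positive follows from
        a positive norm lying below it.\<close>
      have r0: "0 < r"
      proof -
        obtain n where "norm_iter A g f x (int n) v < r"
          using eventually_happens'[OF sequentially_bot ev] by auto
        moreover have "0 < norm_iter A g f x (int n) v" unfolding v(3) using Nn Nu by simp
        ultimately show ?thesis by linarith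
      qed
      have "\<forall>\<^sub>F n in sequentially. (1 + (1 / r - 1)) * restr_norm E x b \<le> restr_norm E ((f ^^ n) x) (T.D.iter n x b)"
        using ev
      proof eventually_elim
        case (elim n)
        let ?y = "(f ^^ n) x"
        have le: "fibre_norm A g ?y (T.iter n x u) \<le> r * fibre_norm A g x u"
          using elim Nu unfolding v(3) by (simp add: field_simps)
        have "T.iter n x u \<in> fibres A E ?y"
          using T.iter_image[of "fibres A E" n x, OF manifold_B_fibres[OF E fE]] u(1) by blast
        from restr_norm_upper[OF this, of "T.D.iter n x b"]
        have "\<bar>b \<bullet> u\<bar> / fibre_norm A g ?y (T.iter n x u) \<le> restr_norm E ?y (T.D.iter n x b)"
          unfolding T.inner_dual_iter .
        moreover have "\<bar>b \<bullet> u\<bar> / (r * fibre_norm A g x u) \<le> \<bar>b \<bullet> u\<bar> / fibre_norm A g ?y (T.iter n x u)"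
          using le Nn[of n] Nu r0 by (intro divide_left_mono) auto
        moreover have "(1 + (1 / r - 1)) * restr_norm E x b = \<bar>b \<bullet> u\<bar> / (r * fibre_norm A g x u)"
          unfolding u(3) by simp
        ultimately show ?case by linarith
      qed
      then show "\<exists>\<epsilon>>0. \<forall>\<^sub>F n in sequentially. (1 + \<epsilon>) * restr_norm E x b \<le> restr_norm E ((f ^^ n) x) (T.D.iter n x b)"
        using r(2) r0 by (intro exI[of _ "1 / r - 1"]) (simp add: field_simps)
    qed
  qed
qed

lemma titer_mem_fibres:
  assumes E: "subspace_field A E" and fE: "\<And>x. tangent_map A f x ` E x = E (f x)" and a: "a \<in> fibres A E x"
  shows "titer n x a \<in> fibres A E (int_iter f n x)"
proof (induction n rule: int_induct[where k = 0])
  case base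
  show ?case using a by (simp add: titer_def int_iter_def)
next
  case (step1 n)
  then show ?case unfolding titer_Suc int_iter_Suc using manifold_B_fibres[OF E fE] by blast
next
  case (step2 n)
  let ?y = "int_iter f (n - 1) x"
  have "manifold_B A f ?y (titer (n - 1) x a) \<in> fibres A E (f ?y)"
    using step2(2) titer_Suc[of "n - 1" x a] int_iter_Suc[of "n - 1" x] by simp
  then obtain w where "w \<in> fibres A E ?y" "manifold_B A f ?y (titer (n - 1) x a) = manifold_B A f ?y w"
    unfolding manifold_B_fibres[OF E fE, symmetric] by blast
  then show ?case by (metis T.Bi_B)
qed

end


subsection \<open>Uniform estimates\<close>

lemma unbounded_if_exponential:
  fixes t :: "nat \<Rightarrow> real"
  assumes K: "0 < K" and \<rho>: "1 < \<rho>" and t: "\<And>m. K * \<rho> ^ m \<le> t m"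
  shows "\<not> (\<forall>m. t m \<le> b)"
proof
  assume b: "\<forall>m. t m \<le> b"
  obtain m where "b / K < \<rho> ^ m" using real_arch_pow[OF \<rho>] by blast
  then have "b < K * \<rho> ^ m" using K by (simp add: field_simps)
  then show False using t[of m] b by (meson not_le order_trans)
qed

context manifold_cocycle
begin

text \<open>Along backward orbits in \<open>E\<close> the norm is eventually comparable to the quotient norm modulo \<open>F\<close>, which
  grows by the dual statement for the annihilator of \<open>F\<close>; a finite number of steps depending on the
  angle between \<open>E\<close> and \<open>F\<close> at \<open>x\<close> is lost.\<close>

lemma hyperbolic_estimates:
  assumes split: "invariant_splitting A f E F"
    and cont: "\<forall>\<mu>\<in>invariant_measures f. AE x in \<mu>. field_continuous_at A F x"
    and meas: "field_measurable A E"
    and contr: "\<forall>\<mu>\<in>invariant_measures f. AE x in \<mu>. \<forall>v\<in>E x. rnorm g x v = 1 \<longrightarrow>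
           limsup (\<lambda>n::nat. ereal (norm_iter A g f x (int n) v)) < 1"
    and exp: "\<forall>\<mu>\<in>invariant_measures f. AE x in \<mu>. \<forall>v\<in>F x. rnorm g x v = 1 \<longrightarrow>
           liminf (\<lambda>n::nat. ereal (norm_iter A g f x (int n) v)) > 1"
  shows "\<exists>K>0. \<exists>\<sigma>>1.
    (\<forall>x. \<forall>v\<in>F x. \<forall>n m. K * \<sigma> ^ m * norm_iter A g f x n v \<le> norm_iter A g f x (n + int m) v) \<and>
    (\<forall>x. \<exists>J. \<forall>v\<in>E x. \<forall>j\<ge>J. \<forall>m.
       K * \<sigma> ^ m * norm_iter A g f x (- int j) v \<le> norm_iter A g f x (- int j - int m) v) \<and>
    (\<forall>x. \<forall>v\<in>tangent_space A x - F x. \<exists>K>0. \<forall>m. K * \<sigma> ^ m \<le> norm_iter A g f x (- int m) v)"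
proof -
  have E: "subspace_field A E" and F: "subspace_field A F"
    and fE: "\<And>x. tangent_map A f x ` E x = E (f x)" and fF: "\<And>x. tangent_map A f x ` F x = F (f x)"
    and EF: "\<And>x. E x \<inter> F x = {0}" and sum: "\<And>x. tangent_space A x = {u + v | u v. u \<in> E x \<and> v \<in> F x}"
    using split unfolding invariant_splitting_def by auto
  note ca = chart_at[OF atlas]
  let ?E = "fibres A E" and ?F = "fibres A F"
  have span: "\<exists>s\<in>?E x. \<exists>w\<in>?F x. a = s + w" for x a
  proof -
    have "coord_vec A (chart_at A x) x a \<in> tangent_space A x" by (rule coord_vec_in_tangent_space[OF atlas ca])
    then obtain u v where uv: "u \<in> E x" "v \<in> F x" "coord_vec A (chart_at A x) x a = u + v" unfolding sum by blast
    then have "a = u (chart_at A x) + v (chart_at A x)"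
      using coord_vec_coordinate[OF atlas ca, of x a] by (metis plus_fun_apply)
    then show ?thesis using uv unfolding fibres_def by blast
  qed
  have trans: "?E x \<inter> ?F x = {0}" for x
  proof -
    have "a = 0" if "a \<in> ?E x" "a \<in> ?F x" for a
    proof -
      have "coord_vec A (chart_at A x) x a \<in> E x \<inter> F x" using that fibres_iff[OF E] fibres_iff[OF F] by blast
      then have "coord_vec A (chart_at A x) x a = 0" using EF by blast
      then show "a = 0" using coord_vec_coordinate[OF atlas ca, of x a] by (metis zero_fun_apply)
    qed
    then show ?thesis using subspace_0[OF subspace_fibres[OF E]] subspace_0[OF subspace_fibres[OF F]] by blast
  qed
  note FB = manifold_B_fibres[OF F fF]
  let ?Q = "T.quot_norm ?F" and ?A = "T.annihilator ?F"

  \<comment> \<open>The factor in the growth results may be prescribed; 4 is the one on which the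
    lemmas about sequences are built.\<close>
  obtain n1' where n1': "\<forall>x. \<forall>a\<in>?F x. 4 * T.fnorm x a \<le> T.fnorm ((f ^^ n1') x) (T.iter n1' x a)"
    using unstable_uniform_growth[OF F fF cont exp, of 4] ..
  have "\<exists>n>0. \<forall>x. \<forall>a\<in>?F x. 4 * T.fnorm x a \<le> T.fnorm ((f ^^ n) x) (T.iter n x a)"
    by (rule T.iter_growth_pos[of ?F n1']) (rule n1'[rule_format])
  then obtain n1 where n1: "0 < n1" "\<forall>x. \<forall>a\<in>?F x. 4 * T.fnorm x a \<le> T.fnorm ((f ^^ n1) x) (T.iter n1 x a)"
    by (elim exE conjE)
  obtain n2' where n2': "\<forall>x. \<forall>b\<in>?A x. 4 * T.D.fnorm x b \<le> T.D.fnorm ((f ^^ n2') x) (T.D.iter n2' x b)"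
    using annihilator_uniform_growth[OF E fE F fF span meas cont contr, of 4] ..
  have "\<exists>n>0. \<forall>x. \<forall>b\<in>?A x. 4 * T.D.fnorm x b \<le> T.D.fnorm ((f ^^ n) x) (T.D.iter n x b)"
    by (rule T.D.iter_growth_pos[of ?A n2']) (rule n2'[rule_format])
  then obtain n2 where n2: "0 < n2" "\<forall>x. \<forall>b\<in>?A x. 4 * T.D.fnorm x b \<le> T.D.fnorm ((f ^^ n2) x) (T.D.iter n2 x b)"
    by (elim exE conjE)
  \<comment> \<open>A common multiple of the two times, so that both bundles gain the factor 4 over
    the same block.\<close>
  define N where "N = n2 * n1"
  have N: "0 < N" unfolding N_def using n1(1) n2(1) by simp
  have gF: "4 * T.fnorm x a \<le> T.fnorm ((f ^^ N) x) (T.iter N x a)" if "a \<in> ?F x" for x a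
    unfolding N_def
    by (rule T.iter_growth_mult[of ?F 4 n1, OF _ _ n1(2)[rule_format] that n2(1)]) (use FB in auto)
  have gA: "4 * T.D.fnorm x b \<le> T.D.fnorm ((f ^^ N) x) (T.D.iter N x b)" if "b \<in> ?A x" for x b
    unfolding N_def mult.commute[of n2]
    by (rule T.D.iter_growth_mult[of ?A 4 n2, OF _ _ n2(2)[rule_format] that n1(1)])
      (use that T.annihilator_invariant[of _ ?F, OF FB] in auto)

  obtain r R where rR: "0 < r" "0 < R" "\<And>x a. r * T.fnorm x a \<le> fibre_norm A g x a" "\<And>x a. fibre_norm A g x a \<le> R * T.fnorm x a"
    using fibre_norm_bounds by blast
  obtain c0 where c0: "0 < c0" "\<And>x a. c0 * T.fnorm x a \<le> T.fnorm (f x) (manifold_B A f x a)"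
    using T.fnorm_B_bounds by blast
  obtain C1 where C1: "0 < C1" "\<And>x a. T.fnorm x a \<le> T.fnorm ((f ^^ N) x) (T.iter N x a) / 4 + C1 * ?Q ((f ^^ N) x) (T.iter N x a)"
    using T.fnorm_backward_bound[of ?F, OF subspace_fibres[OF F] FB gF] by blast
  obtain C2 where C2: "0 < C2" "\<And>x a. ?Q (f x) (manifold_B A f x a) \<le> C2 * ?Q x a"
    using T.quot_norm_B[of ?F, OF FB] by blast
  obtain C3 where C3: "0 < C3" "\<And>x a. ?Q x a \<le> C3 * T.fnorm x a" using T.quot_norm_le_fnorm by blast
  obtain C4 where C4: "0 < C4" "\<And>x a. \<exists>p\<in>?F x. T.fnorm x (a - p) \<le> C4 * ?Q x a"
    using T.quot_norm_representative[of ?F, OF subspace_fibres[OF F]] by blast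
  \<comment> \<open>The one-step bounds are capped at 1, so that their N-th powers also bound the
    loss over any smaller number of steps.\<close>
  define c1 where "c1 = min c0 1"
  define c2 where "c2 = min (1 / C2) 1"
  have c12: "0 < c1" "c1 \<le> 1" "0 < c2" "c2 \<le> 1" unfolding c1_def c2_def using c0(1) C2(1) by auto
  define \<sigma> where "\<sigma> = root N (4 :: real)"
  have \<sigma>: "1 < \<sigma>" unfolding \<sigma>_def using N by simp

  define t where "t x a n = T.fnorm (int_iter f n x) (titer n x a)" for x a n
  define s where "s x a n = ?Q (int_iter f n x) (titer n x a)" for x a n
  have t0: "0 \<le> t x a n" and s0: "0 \<le> s x a n" for x a n
    unfolding t_def s_def by (rule T.fnorm_nonneg, rule T.quot_norm_nonneg)
  have norm_t: "r * t x (v (chart_at A x)) n \<le> norm_iter A g f x n v" "norm_iter A g f x n v \<le> R * t x (v (chart_at A x)) n" for x v n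
    unfolding norm_iter_eq t_def using rR by auto
  have Q_pos: "0 < ?Q x a" if "a \<notin> ?F x" for x a
  proof (rule ccontr)
    assume "\<not> 0 < ?Q x a"
    then have "?Q x a = 0" using T.quot_norm_nonneg[of ?F x a] by linarith
    then obtain p where p: "p \<in> ?F x" "T.fnorm x (a - p) \<le> 0" using C4(2)[of x a] by auto
    then have "a = p" using T.fnorm_pos[of "a - p" x] by fastforce
    then show False using p(1) that by simp
  qed

  have t_growth: "c1 ^ N / 4 * \<sigma> ^ m * t x a n \<le> t x a (n + int m)" if a: "a \<in> ?F x" for x a n m
  proof -
    have "c1 ^ N / 4 * root N 4 ^ m * t x a (n + int 0) \<le> t x a (n + int (0 + m))"
    proof (rule geometric_growth[where s = "\<lambda>j. t x a (n + int j)", OF N t0 _ c12(1,2)])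
      fix j
      have 1: "n + int (j + N) = (n + int j) + int N" "n + int (Suc j) = (n + int j) + 1" by simp_all
      show "4 * t x a (n + int j) \<le> t x a (n + int (j + N))"
        unfolding t_def 1(1) titer_add[of "n + int j" N] int_iter_add[of "n + int j" N] using gF[OF titer_mem_fibres[OF F fF a, of "n + int j"]] .
      have "c1 * t x a (n + int j) \<le> c0 * t x a (n + int j)" unfolding c1_def by (intro mult_right_mono t0) simp
      also have "\<dots> \<le> t x a (n + int (Suc j))" unfolding t_def 1(2) titer_Suc int_iter_Suc by (rule c0(2))
      finally show "c1 * t x a (n + int j) \<le> t x a (n + int (Suc j))" .
    qed
    then show ?thesis unfolding \<sigma>_def by simp
  qed
  have backward: "- int j = - int (j + i) + int i" for i j :: nat by simp
  have sN: "4 * s x a (- int j) \<le> s x a (- int (j + N))" for x a j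
    using T.quot_norm_iter[of ?F 4 N, OF FB _ gA, of "int_iter f (- int (j + N)) x" "titer (- int (j + N)) x a"]
    unfolding s_def backward[of j N] titer_add int_iter_add by simp
  have s_growth: "c2 ^ N / 4 * \<sigma> ^ m * s x a (- int j) \<le> s x a (- int (j + m))" for x a j m
    unfolding \<sigma>_def
  proof (rule geometric_growth[where s = "\<lambda>j. s x a (- int j)", OF N s0 sN c12(3,4)])
    fix j
    have e: "- int j = - int (Suc j) + 1" by simp
    have "s x a (- int j) \<le> C2 * s x a (- int (Suc j))" unfolding s_def e titer_Suc int_iter_Suc by (rule C2(2))
    then have "1 / C2 * s x a (- int j) \<le> s x a (- int (Suc j))" using C2(1) by (simp add: field_simps)
    moreover have "c2 * s x a (- int j) \<le> 1 / C2 * s x a (- int j)" unfolding c2_def by (intro mult_right_mono s0) simp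
    ultimately show "c2 * s x a (- int j) \<le> s x a (- int (Suc j))" by linarith
  qed
  have tN: "t x a (- int (j + N)) \<le> t x a (- int j) / 4 + C1 * s x a (- int j)" for x a j
    using C1(2)[of "int_iter f (- int (j + N)) x" "titer (- int (j + N)) x a"]
    unfolding t_def s_def backward[of j N] titer_add int_iter_add .
  have s_le_t: "s x a n \<le> C3 * t x a n" for x a n unfolding s_def t_def by (rule C3(2))

  \<comment> \<open>At each of the first \<open>N\<close> backward times transversality gives some
    constant, and the sum of these dominates them all. The recursion then replaces it by C1 + 1
    after \<open>J\<close> steps, and \<open>J\<close> depends on \<open>x\<close> but not on the
    vector.\<close>
  have comparable: "\<exists>J. \<forall>a\<in>?E x. \<forall>j\<ge>J. t x a (- int j) \<le> (C1 + 1) * s x a (- int j)" for x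
  proof -
    have "\<exists>P>0. \<forall>a\<in>?E x. t x a (- int j) \<le> P * s x a (- int j)" for j
    proof -
      let ?y = "int_iter f (- int j) x"
      obtain P where P: "0 < P" "\<And>a p. a \<in> ?E ?y \<Longrightarrow> p \<in> ?F ?y \<Longrightarrow> T.fnorm ?y a \<le> P * T.fnorm ?y (a - p)"
        using T.fnorm_transversal[OF subspace_fibres[OF E] subspace_fibres[OF F] trans] by blast
      have "t x a (- int j) \<le> P * C4 * s x a (- int j)" if a: "a \<in> ?E x" for a
      proof -
        let ?b = "titer (- int j) x a"
        obtain p where p: "p \<in> ?F ?y" "T.fnorm ?y (?b - p) \<le> C4 * ?Q ?y ?b" using C4(2) by blast
        have "T.fnorm ?y ?b \<le> P * T.fnorm ?y (?b - p)" by (rule P(2)[OF titer_mem_fibres[OF E fE a] p(1)])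
        also have "\<dots> \<le> P * (C4 * ?Q ?y ?b)" by (rule mult_left_mono[OF p(2)]) (use P(1) in simp)
        finally show ?thesis unfolding t_def s_def by (simp add: mult.assoc)
      qed
      then show ?thesis using P(1) C4(1) by (intro exI[of _ "P * C4"]) simp
    qed
    then obtain P where P: "\<And>j. 0 < P j" "\<And>j a. a \<in> ?E x \<Longrightarrow> t x a (- int j) \<le> P j * s x a (- int j)" by metis
    have P': "t x a (- int j) \<le> (\<Sum>j<N. P j) * s x a (- int j)" if "a \<in> ?E x" "j < N" for a j
    proof -
      have "P j \<le> (\<Sum>j<N. P j)" by (rule member_le_sum) (use that P(1) less_imp_le in auto)
      then show ?thesis using P(2)[OF that(1), of j] mult_right_mono[OF _ s0] by (meson order_trans)
    qed
    obtain J where J: "\<forall>s t :: nat \<Rightarrow> real. (\<forall>j. 0 \<le> s j) \<longrightarrow> (\<forall>j. 4 * s j \<le> s (j + N)) \<longrightarrow>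
        (\<forall>j. t (j + N) \<le> t j / 4 + C1 * s j) \<longrightarrow> (\<forall>j<N. t j \<le> (\<Sum>j<N. P j) * s j) \<longrightarrow>
        (\<forall>j\<ge>J. t j \<le> (C1 + 1) * s j)"
      using eventually_le_of_recursion[OF N C1(1), of "\<Sum>j<N. P j"] ..
    have "t x a (- int j) \<le> (C1 + 1) * s x a (- int j)" if "a \<in> ?E x" "j \<ge> J" for a j
    proof -
      have "\<forall>j\<ge>J. t x a (- int j) \<le> (C1 + 1) * s x a (- int j)"
        by (rule J[THEN spec[of _ "\<lambda>j. s x a (- int j)"], THEN spec[of _ "\<lambda>j. t x a (- int j)"],
              THEN mp, THEN mp, THEN mp, THEN mp])
          (use s0 sN tN P'[OF that(1)] in simp_all)
      then show ?thesis using that(2) by blast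
    qed
    then show ?thesis by blast
  qed

  \<comment> \<open>The factor r / R compares the Riemannian norm with \<open>fnorm\<close>, and the
    N-th powers over 4 come from \<open>geometric_growth\<close>. In \<open>K2\<close> the growth is
    that of the quotient norm: C1 + 1 pays for passing to it at the start, and \<open>C3\<close> for
    returning to the norm at the end.\<close>
  define K1 where "K1 = r * (c1 ^ N / 4) / R"
  define K2 where "K2 = r / C3 * (c2 ^ N / 4) / ((C1 + 1) * R)"
  have K12: "0 < K1" "0 < K2" unfolding K1_def K2_def using rR c12 C1(1) C3(1) by simp_all
  have nn: "0 \<le> norm_iter A g f x n v" for x n v unfolding norm_iter_eq by (rule fibre_norm_nonneg)
  have growthF: "K1 * \<sigma> ^ m * norm_iter A g f x n v \<le> norm_iter A g f x (n + int m) v" if v: "v \<in> F x" for x v n m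
  proof -
    let ?a = "v (chart_at A x)"
    have a: "?a \<in> ?F x" using v unfolding fibres_def by blast
    have "K1 * \<sigma> ^ m * norm_iter A g f x n v \<le> K1 * \<sigma> ^ m * (R * t x ?a n)"
      by (rule mult_left_mono[OF norm_t(2)]) (use K12 \<sigma> in simp)
    also have "\<dots> = r * (c1 ^ N / 4 * \<sigma> ^ m * t x ?a n)" unfolding K1_def using rR by simp
    also have "\<dots> \<le> r * t x ?a (n + int m)" by (rule mult_left_mono[OF t_growth[OF a]]) (use rR in simp)
    also have "\<dots> \<le> norm_iter A g f x (n + int m) v" by (rule norm_t(1))
    finally show ?thesis .
  qed
  \<comment> \<open>Valid for every vector, since the norm dominates the quotient norm up to
    \<open>C3\<close>. It serves both the vectors of \<open>E\<close> and the vectors outside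
    \<open>F\<close>.\<close>
  have lower: "r / C3 * (c2 ^ N / 4 * \<sigma> ^ m * s x (v (chart_at A x)) (- int j)) \<le> norm_iter A g f x (- int (j + m)) v" for x v j m
  proof -
    let ?a = "v (chart_at A x)"
    have "r / C3 * (c2 ^ N / 4 * \<sigma> ^ m * s x ?a (- int j)) \<le> r / C3 * s x ?a (- int (j + m))"
      by (rule mult_left_mono[OF s_growth]) (use rR C3 in simp)
    also have "\<dots> \<le> r / C3 * (C3 * t x ?a (- int (j + m)))"
      by (rule mult_left_mono[OF s_le_t]) (use rR C3 in simp)
    also have "\<dots> = r * t x ?a (- int (j + m))" using C3 by simp
    also have "\<dots> \<le> norm_iter A g f x (- int (j + m)) v" by (rule norm_t(1))
    finally show ?thesis .
  qed
  have growthE: "\<exists>J. \<forall>v\<in>E x. \<forall>j\<ge>J. \<forall>m. K2 * \<sigma> ^ m * norm_iter A g f x (- int j) v \<le> norm_iter A g f x (- int j - int m) v" for x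
  proof -
    obtain J where J: "\<And>a j. a \<in> ?E x \<Longrightarrow> j \<ge> J \<Longrightarrow> t x a (- int j) \<le> (C1 + 1) * s x a (- int j)"
      using comparable by blast
    have "K2 * \<sigma> ^ m * norm_iter A g f x (- int j) v \<le> norm_iter A g f x (- int j - int m) v"
      if v: "v \<in> E x" and j: "j \<ge> J" for v j m
    proof -
      let ?a = "v (chart_at A x)"
      have a: "?a \<in> ?E x" using v unfolding fibres_def by blast
      have "norm_iter A g f x (- int j) v \<le> R * ((C1 + 1) * s x ?a (- int j))"
        using norm_t(2) mult_left_mono[OF J[OF a j], of R] rR(2) by (meson less_imp_le order_trans)
      then have "K2 * \<sigma> ^ m * norm_iter A g f x (- int j) v \<le> K2 * \<sigma> ^ m * (R * ((C1 + 1) * s x ?a (- int j)))"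
        by (rule mult_left_mono) (use K12 \<sigma> in simp)
      also have "\<dots> = K2 * ((C1 + 1) * R) * (\<sigma> ^ m * s x ?a (- int j))" by (simp only: mult_ac)
      also have "K2 * ((C1 + 1) * R) = r / C3 * (c2 ^ N / 4)" unfolding K2_def using rR C1(1) by simp
      also have "r / C3 * (c2 ^ N / 4) * (\<sigma> ^ m * s x ?a (- int j)) = r / C3 * (c2 ^ N / 4 * \<sigma> ^ m * s x ?a (- int j))"
        by (simp only: mult_ac)
      also have "\<dots> \<le> norm_iter A g f x (- int (j + m)) v" by (rule lower)
      finally show ?thesis by simp
    qed
    then show ?thesis by blast
  qed
  \<comment> \<open>Outside \<open>F\<close> the initial quotient norm is positive. It enters the
    constant, which therefore depends on the vector; for unboundedness this is enough.\<close>
  have growthT: "\<exists>K>0. \<forall>m. K * \<sigma> ^ m \<le> norm_iter A g f x (- int m) v" if v: "v \<in> tangent_space A x - F x" for x v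
  proof -
    let ?a = "v (chart_at A x)"
    have "coord_vec A (chart_at A x) x ?a = v" using coord_vec_of_coordinate[OF atlas ca] v by blast
    then have "?a \<notin> ?F x" using fibres_iff[OF F, of ?a x] v by auto
    then have "0 < s x ?a 0" using Q_pos unfolding s_def by (simp add: int_iter_def titer_def)
    moreover have "r / C3 * (c2 ^ N / 4) * s x ?a 0 * \<sigma> ^ m \<le> norm_iter A g f x (- int m) v" for m
      using lower[of m x v 0] by (simp add: mult_ac)
    ultimately show ?thesis
      using rR C3 c12 by (intro exI[of _ "r / C3 * (c2 ^ N / 4) * s x ?a 0"]) simp
  qed
  define K where "K = min K1 K2"
  have K: "0 < K" "K \<le> K1" "K \<le> K2" unfolding K_def using K12 by auto
  have weaken: "K * \<sigma> ^ m * norm_iter A g f x n v \<le> L * \<sigma> ^ m * norm_iter A g f x n v" if "K \<le> L" for m x n v L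
    by (intro mult_right_mono that nn) (use \<sigma> in simp)
  show ?thesis
  proof (rule exI[of _ K], rule conjI[OF K(1)], rule exI[of _ \<sigma>], rule conjI[OF \<sigma>], intro conjI allI ballI)
    show "K * \<sigma> ^ m * norm_iter A g f x n v \<le> norm_iter A g f x (n + int m) v" if "v \<in> F x" for x v n m
      by (rule order_trans[OF weaken[OF K(2)] growthF[OF that]])
    show "\<exists>J. \<forall>v\<in>E x. \<forall>j\<ge>J. \<forall>m. K * \<sigma> ^ m * norm_iter A g f x (- int j) v \<le> norm_iter A g f x (- int j - int m) v" for x
      using growthE[of x] order_trans[OF weaken[OF K(3)]] by meson
    show "\<exists>K>0. \<forall>m. K * \<sigma> ^ m \<le> norm_iter A g f x (- int m) v" if "v \<in> tangent_space A x - F x" for x v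
      by (rule growthT[OF that])
  qed
qed

end

theorem theorem1p1:
  fixes A :: "('m::{t2_space, second_countable_topology}, 'e::euclidean_space) chart set"
    and g :: "'m \<Rightarrow> ('m, 'e) tvec \<Rightarrow> ('m, 'e) tvec \<Rightarrow> real"
    and f :: "'m \<Rightarrow> 'm"
    and Es Ecu :: "'m \<Rightarrow> ('m, 'e) tvec set"
  assumes "closed_manifold A"
    and "DIM('e) \<ge> 2"
    and "riemannian_metric A g"
    and "C1_diffeo A f"
    and "invariant_splitting A f Es Ecu"
    and "\<forall>\<mu>\<in>invariant_measures f. AE x in \<mu>. field_continuous_at A Ecu x"
    and "field_measurable A Es"
    and "\<forall>\<mu>\<in>invariant_measures f. AE x in \<mu>. \<forall>v\<in>Es x. rnorm g x v = 1 \<longrightarrow>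
           limsup (\<lambda>n::nat. ereal (norm_iter A g f x (int n) v)) < 1"
    and "\<forall>\<mu>\<in>invariant_measures f. AE x in \<mu>. \<forall>v\<in>Ecu x. rnorm g x v = 1 \<longrightarrow>
           liminf (\<lambda>n::nat. ereal (norm_iter A g f x (int n) v)) > 1"
  shows "quasi_Anosov A g f \<and>
    (\<exists>K::real. \<exists>\<rho>::real. K > 0 \<and> \<rho> > 1 \<and>
      (\<forall>x. \<exists>l::real. l > 0 \<and>
        (\<forall>m::nat.
          (\<forall>v\<in>Ecu x. \<forall>n::int. real_of_int n \<ge> l \<longrightarrow>
             norm_iter A g f x (n + int m) v \<ge> K * \<rho> ^ m * norm_iter A g f x n v) \<and>
          (\<forall>v\<in>Es x. \<forall>n::int. real_of_int n \<le> - l \<longrightarrow>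
             norm_iter A g f x (n - int m) v \<ge> K * \<rho> ^ m * norm_iter A g f x n v))))"
proof -
  obtain k :: nat and c S and \<rho> :: "nat \<Rightarrow> 'm \<Rightarrow> real"
    where frame: "\<And>i. i < k \<Longrightarrow> c i \<in> A" "\<And>i. i < k \<Longrightarrow> closed (S i)" "\<And>i. i < k \<Longrightarrow> S i \<subseteq> cdom (c i)"
      "\<And>i. i < k \<Longrightarrow> continuous_on UNIV (\<rho> i)" "\<And>i x. i < k \<Longrightarrow> 0 \<le> \<rho> i x"
      "\<And>i x. i < k \<Longrightarrow> x \<notin> S i \<Longrightarrow> \<rho> i x = 0" "\<And>x. \<exists>i<k. 0 < \<rho> i x"
    using exists_finite_bumps[OF assms(1)] by blast
  interpret manifold_cocycle A g f k c S \<rho>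
    by (rule manifold_cocycle.intro[OF assms(1,3,4) frame])
  obtain K \<sigma> where K: "0 < K" and \<sigma>: "1 < \<sigma>"
    and fwd': "\<forall>x. \<forall>v\<in>Ecu x. \<forall>n m. K * \<sigma> ^ m * norm_iter A g f x n v \<le> norm_iter A g f x (n + int m) v"
    and bwd: "\<forall>x. \<exists>J. \<forall>v\<in>Es x. \<forall>j\<ge>J. \<forall>m.
       K * \<sigma> ^ m * norm_iter A g f x (- int j) v \<le> norm_iter A g f x (- int j - int m) v"
    and bwd': "\<forall>x. \<forall>v\<in>tangent_space A x - Ecu x. \<exists>K>0. \<forall>m. K * \<sigma> ^ m \<le> norm_iter A g f x (- int m) v"
    using hyperbolic_estimates[OF assms(5-9)] by (elim exE conjE)
  note fwd = fwd'[rule_format]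
  have "quasi_Anosov A g f" unfolding quasi_Anosov_def
  proof (intro allI ballI impI notI)
    fix x v assume v: "v \<in> tangent_space A x" "rnorm g x v = 1"
      and bdd: "bounded (range (\<lambda>n::int. norm_iter A g f x n v))"
    then obtain b where "\<And>n. \<bar>norm_iter A g f x n v\<bar> \<le> b" unfolding bounded_iff by auto
    then have b: "\<And>n. norm_iter A g f x n v \<le> b" by (simp add: abs_le_iff)
    show False
    \<comment> \<open>A vector of \<open>Ecu\<close> is unbounded in forward time; any other vector
      has a nonzero class modulo \<open>Ecu\<close> and is unbounded in backward time.\<close>
    proof (cases "v \<in> Ecu x")
      case True
      have "coord_vec A (chart_at A x) x (v (chart_at A x)) = v"
        by (rule coord_vec_of_coordinate[OF atlas chart_at[OF atlas] v(1)])
      then have "norm_iter A g f x 0 v = rnorm g x v"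
        unfolding norm_iter_eq fibre_norm_def by (simp add: int_iter_def titer_def)
      then have "K * \<sigma> ^ m \<le> norm_iter A g f x (int m) v" for m using fwd[OF True, of m 0] v(2) by simp
      from unbounded_if_exponential[OF K \<sigma> this] show False using b by blast
    next
      case False
      then obtain K' where "0 < K'" "\<And>m. K' * \<sigma> ^ m \<le> norm_iter A g f x (- int m) v" using bwd' v(1) by blast
      from unbounded_if_exponential[OF this(1) \<sigma> this(2)] show False using b by blast
    qed
  qed
  moreover have "\<exists>l::real. l > 0 \<and> (\<forall>m::nat.
          (\<forall>v\<in>Ecu x. \<forall>n::int. real_of_int n \<ge> l \<longrightarrow>
             norm_iter A g f x (n + int m) v \<ge> K * \<sigma> ^ m * norm_iter A g f x n v) \<and>
          (\<forall>v\<in>Es x. \<forall>n::int. real_of_int n \<le> - l \<longrightarrow>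
             norm_iter A g f x (n - int m) v \<ge> K * \<sigma> ^ m * norm_iter A g f x n v))" for x
  proof -
    obtain J where J: "\<And>v j m. v \<in> Es x \<Longrightarrow> j \<ge> J \<Longrightarrow>
       K * \<sigma> ^ m * norm_iter A g f x (- int j) v \<le> norm_iter A g f x (- int j - int m) v" using bwd by blast
    \<comment> \<open>Adding 1 keeps the threshold positive when \<open>J\<close> is 0.\<close>
    have "K * \<sigma> ^ m * norm_iter A g f x n v \<le> norm_iter A g f x (n - int m) v"
      if "v \<in> Es x" "real_of_int n \<le> - (real J + 1)" for v n m
    proof -
      have n: "n = - int (nat (- n))" "J \<le> nat (- n)" using that(2) by linarith+
      show ?thesis using J[OF that(1) n(2), of m] unfolding n(1)[symmetric] .
    qed
    then show ?thesis using fwd by (intro exI[of _ "real J + 1"]) auto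
  qed
  ultimately show ?thesis using K \<sigma> by blast
qed

end
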